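(* Let $\mathbf s$ be a seed in the mutation class of the initial seed $\mathbf s_0$, let $k\in I_{\mathrm{uf}}$, and let $\mathbf s'$ be the mutation of $\mathbf s$ in direction $k$. Write $\epsilon$ for the exchange matrix of $\mathbf s$, $\mathbf c_k=\mathbf c_{k;\mathbf s}$, $q_k=q^{1/d_k}$. The quantum $\mathcal X$-mutation with coefficients $\mu^q_{k,\mathbf t}:\mathcal K_{\mathbf s'}\to\mathcal K_{\mathbf s}$, defined as $\mu^q_{k,\mathbf t}=\mu^\sharp_{k,\mathbf t}\circ\mu'_{k,\mathbf t}$, is given on cluster variables by $$\mu^q_{k,\mathbf t}(\tilde X_{i;\mathbf s'})=\begin{cases}\tilde X_{k;\mathbf s}^{-1}& i=k,\\[4pt] \tilde X_{i;\mathbf s}\left(\prod_{\ell=1}^{|\epsilon_{ik}|}\left(\mathbf t^{[\operatorname{sgn}(\epsilon_{ik})\mathbf c_k]_+}+\mathbf t^{[-\operatorname{sgn}(\epsilon_{ik})\mathbf c_k]_+}q_k^{2\ell-1}\tilde X_{k;\mathbf s}^{-\operatorname{sgn}(\epsilon_{ik})}\right)\right)^{-\operatorname{sgn}(\epsilon_{ik})}& i\neq k.\end{cases}$$ Setting all $t_i=1$ in this formula gives the Fock–Goncharov quantum $\mathcal X$-mutation $$X_{k;\mathbf s'}\mapsto X_{k;\mathbf s}^{-1},\qquad X_{i;\mathbf s'}\mapsto X_{i;\mathbf s}\left(\prod_{\ell=1}^{|\epsilon_{ik}|}\left(1+q_k^{2\ell-1}X_{k;\mathbf s}^{-\operatorname{sgn}(\epsilon_{ik})}\right)\right)^{-\operatorname{sgn}(\epsilon_{ik})}\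 (i\ne k),$$ and setting $q=1$ gives the classical $\mathcal X$-mutation with principal coefficients $$\tilde X_{k;\mathbf s'}\mapsto \tilde X_{k;\mathbf s}^{-1},\qquad \tilde X_{i;\mathbf s'}\mapsto \tilde X_{i;\mathbf s}\left(\mathbf t^{[\operatorname{sgn}(\epsilon_{ik})\mathbf c_k]_+}+\mathbf t^{[-\operatorname{sgn}(\epsilon_{ik})\mathbf c_k]_+}\tilde X_{k;\mathbf s}^{-\operatorname{sgn}(\epsilon_{ik})}\right)^{-\epsilon_{ik}}\ (i\ne k).$$
   Context: Fixed data: a finite set $I$ with a subset $I_{\mathrm{uf}}$; a lattice $N$ of rank $|I|$ with a saturated sublattice $N_{\mathrm{uf}}$ of rank $|I_{\mathrm{uf}}|$; a skew-symmetric bilinear form $\{\cdot,\cdot\}:N\times N\to\mathbb Q$; positive integers $(d_i)_{i\in I}$ with gcd $1$; a finite-index sublattice $N^\circ\subseteq N$ with $\{N_{\mathrm{uf}},N^\circ\}\subset\mathbb Z$ and $\{N,N_{\mathrm{uf}}\cap N^\circ\}\subset\mathbb Z$. A seed is $\mathbf s=(e_{i;\mathbf s})_{i\in I}$, a basis of $N$ such that $(e_{i;\mathbf s})_{i\in I_{\mathrm{uf}}}$ is a basis of $N_{\mathrm{uf}}$ and $(d_ie_{i;\mathbf s})_{i\in I}$ is a basis of $N^\circ$. Put $\hat\epsilon_{ij}=\{e_{i;\mathbf s},e_{j;\mathbf s}\}$ and $\epsilon_{ij}=\hat\epsilon_{ij}d_j$ (the exchange matrix, assumed integral). Put $d=\mathrm{lcm}(d_i:i\in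 I)$, and $[r]_+=\max(0,r)$ for $r\in\mathbb R$. Mutation of $\mathbf s$ in direction $k\in I_{\mathrm{uf}}$: $e_{k;\mathbf s'}=-e_{k;\mathbf s}$, $e_{i;\mathbf s'}=e_{i;\mathbf s}+[\epsilon_{ik}]_+e_{k;\mathbf s}$ for $i\neq k$. $\mathbf c$-vectors: fix an initial seed $\mathbf s_0$. The vectors $\mathbf c_{i;\mathbf s}=(c_{ij})_{j\in I}\in\mathbb Z^I$ for seeds reached from $\mathbf s_0$ by a sequence of mutations are determined by: $\mathbf c_{i;\mathbf s_0}$ is the $i$-th standard basis vector; under mutation in direction $k$, $c'_{kj}=-c_{kj}$ and $c'_{ij}=c_{ij}+\frac12(|\epsilon_{ik}|c_{kj}+\epsilon_{ik}|c_{kj}|)$ for $i\neq k$. (Equivalently they are rows of the principal-coefficient part of the extended exchange matrix.) It is a known theorem that they are sign coherent: the entries of each are all $\ge0$ or all $\le 0$. For a sign coherent vector $\mathbf x$, $[\mathbf x]_+=\mathbf x$ if its entries are nonnegative and $[\mathbf x]_+=0$ otherwise. For $\mathbf x\in\mathbb Z^I$, $\mathbf t^{\mathbf x}=\prod_i t_i^{x_i}$. $\operatorname{sgn}(0)=0$. Algebras: $R=\mathbb C[t_i:i\in I]$. For each seed $\mathbf s$, $A_{\mathbf s}$ is the $R[q^{\pm1/d}]$-algebra generated by $\tilde X_{i;\mathbf s}$ ($i\in I$) with relations $q^{-\hat\epsilon_{ij}}\tilde X_{i;\mathbf s}\tilde X_{j;\mathbf s}=q^{-\hat\epsilon_{ji}}\tilde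 X_{j;\mathbf s}\tilde X_{i;\mathbf s}$; its quantum torus localization has an $R[q^{\pm1/d}]$-basis $\tilde X^n_{\mathbf s}$, $n\in N$, with $\tilde X^n_{\mathbf s}\tilde X^{n'}_{\mathbf s}=q^{\{n,n'\}}\tilde X^{n+n'}_{\mathbf s}$ and $\tilde X_{i;\mathbf s}=\tilde X_{\mathbf s}^{e_{i;\mathbf s}}$. $A_{\mathbf s}$ is an Ore domain and $\mathcal K_{\mathbf s}$ denotes its noncommutative fraction field. Maps: $\mu'_{k,\mathbf t}:\mathcal K_{\mathbf s'}\to\mathcal K_{\mathbf s}$ is the $R[q^{\pm1/d}]$-algebra homomorphism with $\mu'_{k,\mathbf t}(\tilde X^v_{\mathbf s'})=\mathbf t^{-\{v,e_{k;\mathbf s}\}d_k[-\mathbf c_{k;\mathbf s}]_+}\tilde X^v_{\mathbf s}$. The quantum dilogarithm is $\Psi_q(x)=\prod_{\ell\ge1}(1+q^{2\ell-1}x)^{-1}$, regarded as the formal power series in $x$ with constant term $1$ and coefficients in $\mathbb C(q)$ satisfying $\Psi_q(q^2x)=(1+qx)\Psi_q(x)$. $\mu^\sharp_{k,\mathbf t}$ is the automorphism of $\mathcal K_{\mathbf s}$ given by conjugation $$x\mapsto \Psi_{q_k}\!\left(\tfrac{\mathbf t^{[\mathbf c_{k;\mathbf s}]_+}}{\mathbf t^{[-\mathbf c_{k;\mathbf s}]_+}}\tilde X_{k;\mathbf s}\right)\,x\,\Psi_{q_k}\!\left(\tfrac{\mathbf t^{[\mathbf c_{k;\mathbf s}]_+}}{\mathbf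 t^{[-\mathbf c_{k;\mathbf s}]_+}}\tilde X_{k;\mathbf s}\right)^{-1},$$ computed in the skew field of twisted formal Laurent series in $\tilde X_{k;\mathbf s}$ over the skew field of fractions of the subalgebra generated by the $\tilde X_{i;\mathbf s}$, $i\neq k$; this skew field contains $\mathcal K_{\mathbf s}$. *)

theory Defs
  imports "HOL-Algebra.Generated_Rings" "HOL-Library.Poly_Mapping" "HOL-Library.FuncSet"
begin

section \<open>Lattices, fixed data and seeds\<close>

definition zmul :: "int \<Rightarrow> 'n::ab_group_add \<Rightarrow> 'n" where
  "zmul m x = (if 0 \<le> m then (\<Sum>_<nat m. x) else - (\<Sum>_<nat (- m). x))"

definition Z_basis :: "'j set \<Rightarrow> ('j \<Rightarrow> 'n::ab_group_add) \<Rightarrow> 'n set \<Rightarrow> bool" where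
  "Z_basis J b M \<longleftrightarrow>
     M = range (\<lambda>a. \<Sum>j\<in>J. zmul (a j) (b j)) \<and>
     (\<forall>a. (\<Sum>j\<in>J. zmul (a j) (b j)) = 0 \<longrightarrow> (\<forall>j\<in>J. a j = 0))"

definition lattice_of_rank :: "'n::ab_group_add set \<Rightarrow> nat \<Rightarrow> bool" where
  "lattice_of_rank M r \<longleftrightarrow> (\<exists>b :: nat \<Rightarrow> 'n. Z_basis {..<r} b M)"

definition additive_subgroup :: "'n::ab_group_add set \<Rightarrow> bool" where
  "additive_subgroup M \<longleftrightarrow> 0 \<in> M \<and> (\<forall>x\<in>M. \<forall>y\<in>M. x - y \<in> M)"

text \<open>The index set \<open>I\<close> is the finite type \<open>'i\<close>, and the lattice \<open>N\<close> is the whole type \<open>'n\<close>.\<close>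

record ('i, 'n) fixed_data =
  uf :: "'i set"
  Nuf :: "'n set"
  form :: "'n \<Rightarrow> 'n \<Rightarrow> rat"
  mlt :: "'i \<Rightarrow> nat"
  Ncirc :: "'n set"

definition is_fixed_data :: "('i::finite, 'n::ab_group_add) fixed_data \<Rightarrow> bool" where
  "is_fixed_data \<Gamma> \<longleftrightarrow>
     lattice_of_rank (UNIV :: 'n set) (card (UNIV :: 'i set)) \<and>
     lattice_of_rank (Nuf \<Gamma>) (card (uf \<Gamma>)) \<and>
     (\<forall>m x. m \<noteq> 0 \<and> zmul m x \<in> Nuf \<Gamma> \<longrightarrow> x \<in> Nuf \<Gamma>) \<and>
     (\<forall>x y z. form \<Gamma> (x + y) z = form \<Gamma> x z + form \<Gamma> y z) \<and>
     (\<forall>x y z. form \<Gamma> x (y + z) = form \<Gamma> x y + form \<Gamma> x z) \<and>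
     (\<forall>x y. form \<Gamma> x y = - form \<Gamma> y x) \<and>
     (\<forall>i. 0 < mlt \<Gamma> i) \<and> Gcd (range (mlt \<Gamma>)) = 1 \<and>
     additive_subgroup (Ncirc \<Gamma>) \<and> finite (range (\<lambda>x. (+) x ` Ncirc \<Gamma>)) \<and>
     (\<forall>x\<in>Nuf \<Gamma>. \<forall>y\<in>Ncirc \<Gamma>. form \<Gamma> x y \<in> \<int>) \<and>
     (\<forall>x. \<forall>y\<in>Nuf \<Gamma> \<inter> Ncirc \<Gamma>. form \<Gamma> x y \<in> \<int>)"

text \<open>The last condition is the standing assumption that the exchange matrix is integral; it
  makes the floor in \<open>exch\<close> below exact.\<close>

definition is_seed :: "('i::finite, 'n::ab_group_add) fixed_data \<Rightarrow> ('i \<Rightarrow> 'n) \<Rightarrow> bool" where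
  "is_seed \<Gamma> e \<longleftrightarrow>
     Z_basis UNIV e UNIV \<and> Z_basis (uf \<Gamma>) e (Nuf \<Gamma>) \<and>
     Z_basis UNIV (\<lambda>i. zmul (int (mlt \<Gamma> i)) (e i)) (Ncirc \<Gamma>) \<and>
     (\<forall>i j. form \<Gamma> (e i) (e j) * of_nat (mlt \<Gamma> j) \<in> \<int>)"

definition exch :: "('i, 'n) fixed_data \<Rightarrow> ('i \<Rightarrow> 'n) \<Rightarrow> 'i \<Rightarrow> 'i \<Rightarrow> int" where
  "exch \<Gamma> e i j = \<lfloor>form \<Gamma> (e i) (e j) * of_nat (mlt \<Gamma> j)\<rfloor>"

definition seed_mutation ::
    "('i, 'n::ab_group_add) fixed_data \<Rightarrow> 'i \<Rightarrow> ('i \<Rightarrow> 'n) \<Rightarrow> 'i \<Rightarrow> 'n" where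
  "seed_mutation \<Gamma> k e = (\<lambda>i. if i = k then - e k else e i + zmul (max 0 (exch \<Gamma> e i k)) (e k))"

text \<open>The numerator \<open>|\<epsilon>|c + \<epsilon>|c|\<close> is always even, so \<open>div 2\<close> is exact.\<close>

definition cvec_mutation ::
    "('i, 'n) fixed_data \<Rightarrow> 'i \<Rightarrow> ('i \<Rightarrow> 'n) \<Rightarrow> ('i \<Rightarrow> 'i \<Rightarrow> int) \<Rightarrow> 'i \<Rightarrow> 'i \<Rightarrow> int" where
  "cvec_mutation \<Gamma> k e c = (\<lambda>i j. if i = k then - c k j
     else c i j + (\<bar>exch \<Gamma> e i k\<bar> * c k j + exch \<Gamma> e i k * \<bar>c k j\<bar>) div 2)"

text \<open>\<open>seed_reachable \<Gamma> e0 e c\<close>: some sequence of mutations leads from the initial seed \<open>e0\<close> to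
  the seed \<open>e\<close>, and \<open>c\<close> is the matrix of \<open>c\<close>-vectors it produces.\<close>

inductive seed_reachable ::
    "('i, 'n::ab_group_add) fixed_data \<Rightarrow> ('i \<Rightarrow> 'n) \<Rightarrow> ('i \<Rightarrow> 'n) \<Rightarrow> ('i \<Rightarrow> 'i \<Rightarrow> int) \<Rightarrow> bool"
  for \<Gamma> e0 where
  initial: "seed_reachable \<Gamma> e0 e0 (\<lambda>i j. if i = j then 1 else 0)"
| mutate: "seed_reachable \<Gamma> e0 e c \<Longrightarrow> k \<in> uf \<Gamma> \<Longrightarrow>
     seed_reachable \<Gamma> e0 (seed_mutation \<Gamma> k e) (cvec_mutation \<Gamma> k e c)"

definition plus_part :: "('i \<Rightarrow> int) \<Rightarrow> 'i \<Rightarrow> int" where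
  "plus_part x = (if \<forall>j. 0 \<le> x j then x else (\<lambda>_. 0))"


section \<open>Coefficient rings and quantum tori\<close>

text \<open>\<open>'i tpoly\<close> is \<open>R = C[t_i : i \<in> I]\<close>. In \<open>'a qlaurent\<close>, which stands for \<open>a[q^{1/d}, q^{-1/d}]\<close>,
  the index \<open>m\<close> is the exponent of \<open>q^{1/d}\<close>.\<close>

type_synonym 'i tpoly = "('i \<Rightarrow>\<^sub>0 nat) \<Rightarrow>\<^sub>0 complex"
type_synonym 'a qlaurent = "int \<Rightarrow>\<^sub>0 'a"

text \<open>\<open>t_monomial x\<close> is \<open>t^x\<close> for \<open>x \<ge> 0\<close>; negative exponents are cut off at \<open>0\<close>.\<close>

definition t_monomial :: "('i::finite \<Rightarrow> int) \<Rightarrow> 'i tpoly" where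
  "t_monomial x = (\<Prod>i\<in>UNIV. Poly_Mapping.single (Poly_Mapping.single i 1) 1 ^ nat (x i))"

definition q_monomial :: "int \<Rightarrow> 'a::comm_ring_1 qlaurent" where
  "q_monomial m = Poly_Mapping.single m 1"

text \<open>\<open>q^r\<close> is the \<open>q_exponent \<Gamma> r\<close>-th power of \<open>q^{1/d}\<close>, \<open>d\<close> being the lcm of the multipliers; it
  is only used for \<open>r \<in> (1/d)Z\<close>.\<close>

definition q_exponent :: "('i::finite, 'n) fixed_data \<Rightarrow> rat \<Rightarrow> int" where
  "q_exponent \<Gamma> r = \<lfloor>of_nat (Lcm (range (mlt \<Gamma>))) * r\<rfloor>"

text \<open>The quantum torus with basis \<open>X^n\<close>, \<open>n \<in> N\<close>, and \<open>X^n X^n' = q^{{n,n'}} X^{n+n'}\<close>. It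
  depends on the seed only through its distinguished generators \<open>X^{e_i}\<close>. The argument
  \<open>Q\<close> sends \<open>m\<close> to the element \<open>q^{m/d}\<close> of the coefficient ring: \<open>Q = q_monomial\<close> for Laurent
  polynomial coefficients, and \<open>Q = (\<lambda>_. 1)\<close> for the commutative torus at \<open>q = 1\<close>.\<close>

definition quantum_torus ::
    "('i::finite, 'n::ab_group_add) fixed_data \<Rightarrow> (int \<Rightarrow> 'c::comm_ring_1) \<Rightarrow> ('n \<Rightarrow>\<^sub>0 'c) ring" where
  "quantum_torus \<Gamma> Q =
     \<lparr>carrier = UNIV,
      mult = (\<lambda>f g. \<Sum>n\<in>Poly_Mapping.keys f. \<Sum>n'\<in>Poly_Mapping.keys g.
                Poly_Mapping.single (n + n')
                  (Q (q_exponent \<Gamma> (form \<Gamma> n n')) * Poly_Mapping.lookup f n * Poly_Mapping.lookup g n')),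
      one = Poly_Mapping.single 0 1,
      zero = 0,
      add = (+)\<rparr>"

definition X_monomial :: "'n \<Rightarrow> 'n \<Rightarrow>\<^sub>0 'c::comm_ring_1" where
  "X_monomial v = Poly_Mapping.single v 1"

definition scalar :: "'c \<Rightarrow> 'n::ab_group_add \<Rightarrow>\<^sub>0 'c::comm_ring_1" where
  "scalar r = Poly_Mapping.single 0 r"

text \<open>The subalgebra generated over the coefficient ring by the \<open>X_i = X^{e_i}\<close>, \<open>i \<in> J\<close>. The
  algebra \<open>A_s\<close> is \<open>cluster_algebra \<Gamma> q_monomial e UNIV\<close>: it is the algebra presented by the
  relations \<open>q^{-{e_i,e_j}} X_i X_j = q^{-{e_j,e_i}} X_j X_i\<close>, realised inside its torus
  localisation.\<close>

definition cluster_algebra ::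
    "('i::finite, 'n::ab_group_add) fixed_data \<Rightarrow> (int \<Rightarrow> 'c::comm_ring_1) \<Rightarrow> ('i \<Rightarrow> 'n) \<Rightarrow> 'i set
       \<Rightarrow> ('n \<Rightarrow>\<^sub>0 'c) ring" where
  "cluster_algebra \<Gamma> Q e J = (quantum_torus \<Gamma> Q)
     \<lparr>carrier := generate_ring (quantum_torus \<Gamma> Q) (range scalar \<union> (\<lambda>i. X_monomial (e i)) ` J)\<rparr>"


section \<open>Noncommutative fraction fields\<close>

definition skew_field :: "'a ring \<Rightarrow> bool" where
  "skew_field K \<longleftrightarrow> ring K \<and> \<one>\<^bsub>K\<^esub> \<noteq> \<zero>\<^bsub>K\<^esub> \<and> Units K = carrier K - {\<zero>\<^bsub>K\<^esub>}"

definition fractions :: "'b ring \<Rightarrow> 'a ring \<Rightarrow> ('b \<Rightarrow> 'a) \<Rightarrow> 'a set" where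
  "fractions A K \<iota> = {\<iota> a \<otimes>\<^bsub>K\<^esub> inv\<^bsub>K\<^esub> (\<iota> b) | a b.
     a \<in> carrier A \<and> b \<in> carrier A \<and> b \<noteq> \<zero>\<^bsub>A\<^esub>}"

text \<open>This determines \<open>(K, \<iota>)\<close> up to unique isomorphism.\<close>

definition is_fraction_field :: "'b ring \<Rightarrow> 'a ring \<Rightarrow> ('b \<Rightarrow> 'a) \<Rightarrow> bool" where
  "is_fraction_field A K \<iota> \<longleftrightarrow>
     skew_field K \<and> \<iota> \<in> ring_hom A K \<and> inj_on \<iota> (carrier A) \<and> carrier K = fractions A K \<iota>"

text \<open>\<open>K\<close> is the fraction field of \<open>A_s\<close>; the map \<open>\<iota>\<close> is taken to be defined on the whole torus,
  which is a localisation of \<open>A_s\<close>, so that \<open>\<iota> (X_monomial v)\<close> is the element \<open>X^v\<close> of \<open>K\<close>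
  for every \<open>v \<in> N\<close>.\<close>

definition is_cluster_field ::
    "('i::finite, 'n::ab_group_add) fixed_data \<Rightarrow> (int \<Rightarrow> 'c::comm_ring_1) \<Rightarrow> ('i \<Rightarrow> 'n)
       \<Rightarrow> 'a ring \<Rightarrow> (('n \<Rightarrow>\<^sub>0 'c) \<Rightarrow> 'a) \<Rightarrow> bool" where
  "is_cluster_field \<Gamma> Q e K \<iota> \<longleftrightarrow>
     \<iota> \<in> ring_hom (quantum_torus \<Gamma> Q) K \<and>
     is_fraction_field (cluster_algebra \<Gamma> Q e UNIV) K \<iota>"

definition q_in ::
    "('i::finite, 'n::ab_group_add) fixed_data \<Rightarrow> (('n \<Rightarrow>\<^sub>0 'c::comm_ring_1 qlaurent) \<Rightarrow> 'a) \<Rightarrow> rat \<Rightarrow> 'a" where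
  "q_in \<Gamma> \<iota> r = \<iota> (scalar (q_monomial (q_exponent \<Gamma> r)))"

text \<open>\<open>t^x\<close> for arbitrary integral \<open>x\<close>, where \<open>\<eta>\<close> is the structure map of the \<open>R\<close>-algebra \<open>K\<close>.\<close>

definition t_in :: "'a ring \<Rightarrow> ('i::finite tpoly \<Rightarrow> 'a) \<Rightarrow> ('i \<Rightarrow> int) \<Rightarrow> 'a" where
  "t_in K \<eta> x = \<eta> (t_monomial x) \<otimes>\<^bsub>K\<^esub> inv\<^bsub>K\<^esub> (\<eta> (t_monomial (\<lambda>i. - x i)))"

definition R_in_quantum ::
    "(('n::ab_group_add \<Rightarrow>\<^sub>0 'i tpoly qlaurent) \<Rightarrow> 'a) \<Rightarrow> 'i tpoly \<Rightarrow> 'a" where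
  "R_in_quantum \<iota> r = \<iota> (scalar (Poly_Mapping.single 0 r))"

definition R_in_classical ::
    "(('n::ab_group_add \<Rightarrow>\<^sub>0 'i tpoly) \<Rightarrow> 'a) \<Rightarrow> 'i tpoly \<Rightarrow> 'a" where
  "R_in_classical \<iota> r = \<iota> (scalar r)"

text \<open>\<open>f 1 \<cdots> f n\<close>, in this order.\<close>

definition ordered_product :: "'a ring \<Rightarrow> (nat \<Rightarrow> 'a) \<Rightarrow> nat \<Rightarrow> 'a" where
  "ordered_product K f n = foldr (\<otimes>\<^bsub>K\<^esub>) (map f [1..<Suc n]) \<one>\<^bsub>K\<^esub>"


section \<open>Twisted Laurent series\<close>

text \<open>Series \<open>\<Sum>\<^sub>n f(n) x^n\<close> with coefficients on the left in \<open>D\<close>, finitely many negative exponents,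
  and \<open>x^m a = \<tau>(m, a) x^m\<close>.\<close>

definition twisted_laurent :: "'a ring \<Rightarrow> (int \<Rightarrow> 'a \<Rightarrow> 'a) \<Rightarrow> (int \<Rightarrow> 'a) ring" where
  "twisted_laurent D \<tau> =
     \<lparr>carrier = {f. (\<forall>n. f n \<in> carrier D) \<and> (\<exists>b. \<forall>n<b. f n = \<zero>\<^bsub>D\<^esub>)},
      mult = (\<lambda>f g n. \<Oplus>\<^bsub>D\<^esub>m\<in>{m. f m \<noteq> \<zero>\<^bsub>D\<^esub> \<and> g (n - m) \<noteq> \<zero>\<^bsub>D\<^esub>}. f m \<otimes>\<^bsub>D\<^esub> \<tau> m (g (n - m))),
      one = (\<lambda>n. if n = 0 then \<one>\<^bsub>D\<^esub> else \<zero>\<^bsub>D\<^esub>),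
      zero = (\<lambda>n. \<zero>\<^bsub>D\<^esub>),
      add = (\<lambda>f g n. f n \<oplus>\<^bsub>D\<^esub> g n)\<rparr>"

definition laurent_monomial :: "'a ring \<Rightarrow> 'a \<Rightarrow> int \<Rightarrow> int \<Rightarrow> 'a" where
  "laurent_monomial D a m = (\<lambda>n. if n = m then a else \<zero>\<^bsub>D\<^esub>)"

text \<open>The skew field of fractions, inside \<open>K_s\<close>, of the subalgebra generated by the \<open>X_i\<close>,
  \<open>i \<noteq> k\<close>.\<close>

definition coefficient_field ::
    "('i::finite, 'n::ab_group_add) fixed_data \<Rightarrow> ('i \<Rightarrow> 'n) \<Rightarrow> 'a ring
       \<Rightarrow> (('n \<Rightarrow>\<^sub>0 'c::comm_ring_1 qlaurent) \<Rightarrow> 'a) \<Rightarrow> 'i \<Rightarrow> 'a ring" where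
  "coefficient_field \<Gamma> e K \<iota> k =
     K\<lparr>carrier := fractions (cluster_algebra \<Gamma> q_monomial e (- {k})) K \<iota>\<rparr>"

definition laurent_field ::
    "('i::finite, 'n::ab_group_add) fixed_data \<Rightarrow> ('i \<Rightarrow> 'n) \<Rightarrow> 'a ring
       \<Rightarrow> (('n \<Rightarrow>\<^sub>0 'c::comm_ring_1 qlaurent) \<Rightarrow> 'a) \<Rightarrow> 'i \<Rightarrow> (int \<Rightarrow> 'a) ring" where
  "laurent_field \<Gamma> e K \<iota> k =
     twisted_laurent (coefficient_field \<Gamma> e K \<iota> k)
       (\<lambda>m a. \<iota> (X_monomial (e k)) [^]\<^bsub>K\<^esub> m \<otimes>\<^bsub>K\<^esub> a \<otimes>\<^bsub>K\<^esub> \<iota> (X_monomial (e k)) [^]\<^bsub>K\<^esub> (- m))"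

text \<open>The inclusion of \<open>K_s\<close> into the skew field of Laurent series. Here and in \<open>mu_prime\<close>, the
  restriction to \<open>extensional\<close> functions makes the homomorphism unique as a HOL function.\<close>

definition laurent_embedding ::
    "('i::finite, 'n::ab_group_add) fixed_data \<Rightarrow> ('i \<Rightarrow> 'n) \<Rightarrow> 'a ring
       \<Rightarrow> (('n \<Rightarrow>\<^sub>0 'c::comm_ring_1 qlaurent) \<Rightarrow> 'a) \<Rightarrow> 'i \<Rightarrow> 'a \<Rightarrow> int \<Rightarrow> 'a" where
  "laurent_embedding \<Gamma> e K \<iota> k =
     (let D = coefficient_field \<Gamma> e K \<iota> k in
      THE h. h \<in> ring_hom K (laurent_field \<Gamma> e K \<iota> k) \<inter> extensional (carrier K) \<and>
             (\<forall>a\<in>carrier D. h a = laurent_monomial D a 0) \<and>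
             h (\<iota> (X_monomial (e k))) = laurent_monomial D \<one>\<^bsub>D\<^esub> 1)"


section \<open>The quantum dilogarithm and the quantum mutation\<close>

text \<open>The coefficients of \<open>\<Psi>_q\<close>: the functional equation \<open>\<Psi>_q(q\<^sup>2 x) = (1 + q x) \<Psi>_q(x)\<close> is
  compared at \<open>x^{m+1}\<close>. For \<open>q\<close> not a root of unity the solution is unique and lies in \<open>C(q)\<close>.\<close>

definition dilog_coeff :: "'a ring \<Rightarrow> 'a \<Rightarrow> nat \<Rightarrow> 'a" where
  "dilog_coeff F q = (THE \<psi>. (\<forall>m. \<psi> m \<in> carrier F) \<and> \<psi> 0 = \<one>\<^bsub>F\<^esub> \<and>
     (\<forall>m. (q [^]\<^bsub>F\<^esub> (2::nat)) [^]\<^bsub>F\<^esub> Suc m \<otimes>\<^bsub>F\<^esub> \<psi> (Suc m) = \<psi> (Suc m) \<oplus>\<^bsub>F\<^esub> q \<otimes>\<^bsub>F\<^esub> \<psi> m))"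

text \<open>\<open>\<Psi>_q(a x)\<close> as a series in \<open>x\<close>, for central \<open>a\<close>.\<close>

definition dilog_series :: "'a ring \<Rightarrow> 'a \<Rightarrow> 'a \<Rightarrow> int \<Rightarrow> 'a" where
  "dilog_series F q a = (\<lambda>n. if 0 \<le> n then dilog_coeff F q (nat n) \<otimes>\<^bsub>F\<^esub> a [^]\<^bsub>F\<^esub> nat n else \<zero>\<^bsub>F\<^esub>)"

text \<open>In the following, \<open>c\<close> is the \<open>c\<close>-vector \<open>c_k\<close> of the seed \<open>e\<close>. Conjugation takes place in the
  Laurent series; \<open>inv_into\<close> reads the result back in \<open>K_s\<close>.\<close>

definition mu_sharp ::
    "('i::finite, 'n::ab_group_add) fixed_data \<Rightarrow> ('i \<Rightarrow> 'n) \<Rightarrow> ('i \<Rightarrow> int) \<Rightarrow> 'i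
       \<Rightarrow> 'a ring \<Rightarrow> (('n \<Rightarrow>\<^sub>0 'i tpoly qlaurent) \<Rightarrow> 'a) \<Rightarrow> 'a \<Rightarrow> 'a" where
  "mu_sharp \<Gamma> e c k K \<iota> x =
     (let L = laurent_field \<Gamma> e K \<iota> k;
          j = laurent_embedding \<Gamma> e K \<iota> k;
          t = t_in K (R_in_quantum \<iota>);
          \<Psi> = dilog_series (coefficient_field \<Gamma> e K \<iota> k)
                (q_in \<Gamma> \<iota> (1 / of_nat (mlt \<Gamma> k)))
                (t (plus_part c) \<otimes>\<^bsub>K\<^esub> inv\<^bsub>K\<^esub> (t (plus_part (\<lambda>j. - c j))))
      in inv_into (carrier K) j (\<Psi> \<otimes>\<^bsub>L\<^esub> j x \<otimes>\<^bsub>L\<^esub> inv\<^bsub>L\<^esub> \<Psi>))"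

definition mu_prime ::
    "('i::finite, 'n::ab_group_add) fixed_data \<Rightarrow> ('i \<Rightarrow> 'n) \<Rightarrow> ('i \<Rightarrow> int) \<Rightarrow> 'i
       \<Rightarrow> 'b ring \<Rightarrow> (('n \<Rightarrow>\<^sub>0 'i tpoly qlaurent) \<Rightarrow> 'b)
       \<Rightarrow> 'a ring \<Rightarrow> (('n \<Rightarrow>\<^sub>0 'i tpoly qlaurent) \<Rightarrow> 'a) \<Rightarrow> 'b \<Rightarrow> 'a" where
  "mu_prime \<Gamma> e c k K' \<iota>' K \<iota> =
     (THE h. h \<in> ring_hom K' K \<inter> extensional (carrier K') \<and>
        (\<forall>r. h (\<iota>' (scalar r)) = \<iota> (scalar r)) \<and>
        (\<forall>v. h (\<iota>' (X_monomial v)) =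
           t_in K (R_in_quantum \<iota>)
             (\<lambda>j. - \<lfloor>form \<Gamma> v (e k) * of_nat (mlt \<Gamma> k)\<rfloor> * plus_part (\<lambda>j. - c j) j)
           \<otimes>\<^bsub>K\<^esub> \<iota> (X_monomial v)))"

definition mu_quantum ::
    "('i::finite, 'n::ab_group_add) fixed_data \<Rightarrow> ('i \<Rightarrow> 'n) \<Rightarrow> ('i \<Rightarrow> int) \<Rightarrow> 'i
       \<Rightarrow> 'b ring \<Rightarrow> (('n \<Rightarrow>\<^sub>0 'i tpoly qlaurent) \<Rightarrow> 'b)
       \<Rightarrow> 'a ring \<Rightarrow> (('n \<Rightarrow>\<^sub>0 'i tpoly qlaurent) \<Rightarrow> 'a) \<Rightarrow> 'b \<Rightarrow> 'a" where
  "mu_quantum \<Gamma> e c k K' \<iota>' K \<iota> = mu_sharp \<Gamma> e c k K \<iota> \<circ> mu_prime \<Gamma> e c k K' \<iota>' K \<iota>"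


section \<open>Specialisation\<close>

text \<open>Substituting \<open>1\<close> for all variables of a (Laurent) polynomial.\<close>

definition eval_at_one :: "('m \<Rightarrow>\<^sub>0 'c::comm_monoid_add) \<Rightarrow> 'c" where
  "eval_at_one p = (\<Sum>m\<in>Poly_Mapping.keys p. Poly_Mapping.lookup p m)"

definition set_t_one :: "('n \<Rightarrow>\<^sub>0 'i tpoly qlaurent) \<Rightarrow> 'n \<Rightarrow>\<^sub>0 complex qlaurent" where
  "set_t_one = Poly_Mapping.map (Poly_Mapping.map eval_at_one)"

definition set_q_one :: "('n \<Rightarrow>\<^sub>0 'i tpoly qlaurent) \<Rightarrow> 'n \<Rightarrow>\<^sub>0 'i tpoly" where
  "set_q_one = Poly_Mapping.map eval_at_one"

text \<open>A specialisation \<open>\<sigma>\<close> of tori is not defined on all of \<open>K\<close>, only on fractions whose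
  denominator does not specialise to zero. \<open>specialises_to \<sigma> K \<iota> K1 \<iota>1 x y\<close> says that \<open>x \<in> K\<close> is
  such a fraction and that its value is \<open>y \<in> K1\<close>.\<close>

definition specialises_to ::
    "('f \<Rightarrow> 'g::zero) \<Rightarrow> 'a ring \<Rightarrow> ('f \<Rightarrow> 'a) \<Rightarrow> 'b ring \<Rightarrow> ('g \<Rightarrow> 'b) \<Rightarrow> 'a \<Rightarrow> 'b \<Rightarrow> bool" where
  "specialises_to \<sigma> K \<iota> K1 \<iota>1 x y \<longleftrightarrow>
     (\<exists>a b. \<sigma> b \<noteq> 0 \<and> x = \<iota> a \<otimes>\<^bsub>K\<^esub> inv\<^bsub>K\<^esub> (\<iota> b) \<and> y = \<iota>1 (\<sigma> a) \<otimes>\<^bsub>K1\<^esub> inv\<^bsub>K1\<^esub> (\<iota>1 (\<sigma> b)))"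

end

theory Submission
  imports Defs
begin

text \<open>The computation behind the formula is short. Write \<open>x\<close> for \<open>X_k\<close>, \<open>P\<close> and \<open>M\<close> for \<open>[c\<^sub>k]\<^sub>+\<close> and
  \<open>[-c\<^sub>k]\<^sub>+\<close>, and \<open>z = t\<^sup>P / t\<^sup>M\<close>. Since \<open>x X\<^sup>v = q\<^sup>2\<^sup>m X\<^sup>v x\<close> with \<open>m = {e\<^sub>k, v}\<close>, moving \<open>X\<^sup>v\<close> to
  the left past a series in \<open>x\<close> with central coefficients rescales the variable of the series:
  \<open>\<Psi>(z x) X\<^sup>v \<Psi>(z x)\<^sup>-\<^sup>1 = X\<^sup>v \<Psi>(q\<^sup>2\<^sup>m z x) \<Psi>(z x)\<^sup>-\<^sup>1\<close>. For \<open>v = e\<^sub>i'\<close>, \<open>i \<noteq> k\<close>, the factor \<open>q\<^sup>2\<^sup>m\<close> is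
  \<open>q\<^sub>k\<close> to the power \<open>-2 \<epsilon>\<^sub>i\<^sub>k\<close>, so the functional equation of \<open>\<Psi>\<close> telescopes the quotient
  to a product of \<open>|\<epsilon>\<^sub>i\<^sub>k|\<close> binomials \<open>1 + q\<^sub>k\<^sup>r z x\<close>, or to the inverse of one (\<open>conjugate_dilog\<close>).
  If \<open>\<epsilon>\<^sub>i\<^sub>k < 0\<close>, distributing the power of \<open>t\<^sup>M\<close> that the monomial map contributes over the factors
  gives the asserted product. If \<open>\<epsilon>\<^sub>i\<^sub>k > 0\<close>, one extracts in addition the monomial \<open>x\<^sup>-\<^sup>1\<close> from every
  factor, and these monomials turn \<open>X\<^sup>v\<close> into \<open>X_i\<close> (\<open>product_negative\<close>,
  \<open>product_positive\<close>).

  The larger part of the proof shows that the objects in this computation exist. The mutation is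
  defined through homomorphisms that are characterised by their values on generators, and through
  inverses of Laurent series. Such homomorphisms out of a fraction field are constructed on the
  quantum torus and extended by the Ore condition (\<open>extend_hom\<close>); the Ore condition itself comes for
  free from the assumption that every element of \<open>K\<close> is a right fraction. The coefficients of the
  Laurent series are fractions of torus elements of degree zero in \<open>X_k\<close>, and the Ore condition
  descends to them because the torus is graded by this degree (\<open>skewfield_D\<close>). Twisted Laurent series
  over a skew field form a skew field (\<open>skewfield_L\<close>). Finally all exponents of \<open>q\<close> and \<open>t\<close> must
  be integral, so that the roundings in the definitions are exact; this is a property of the initial
  seed that mutations preserve (\<open>integral_basis_mutation\<close>).

  For the specialisations, every value is a fraction of explicit elements of the torus on which the
  substitution acts as a ring homomorphism, and the binomials in the denominator stay nonzero
  (\<open>specialise_mutation\<close>).\<close>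

section \<open>Skew fields and their fractions\<close>

locale skewfield = ring K for K :: "'a ring" (structure) +
  assumes nontrivial: "\<one> \<noteq> \<zero>"
    and Units_eq: "Units K = carrier K - {\<zero>}"

lemma skew_field_iff: "skew_field K \<longleftrightarrow> skewfield K"
  by (auto simp: skew_field_def skewfield_def skewfield_axioms_def)

context skewfield
begin

lemma unit: "x \<in> carrier K \<Longrightarrow> x \<noteq> \<zero> \<Longrightarrow> x \<in> Units K"
  by (simp add: Units_eq)

lemma inv_in [simp]: "x \<in> carrier K \<Longrightarrow> x \<noteq> \<zero> \<Longrightarrow> inv x \<in> carrier K"
  using Units_inv_closed unit by blast

lemma inv_left [simp]: "x \<in> carrier K \<Longrightarrow> x \<noteq> \<zero> \<Longrightarrow> inv x \<otimes> x = \<one>"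
  using Units_l_inv unit by blast

lemma inv_right [simp]: "x \<in> carrier K \<Longrightarrow> x \<noteq> \<zero> \<Longrightarrow> x \<otimes> inv x = \<one>"
  using Units_r_inv unit by blast

lemma inv_nonzero [simp]: "x \<in> carrier K \<Longrightarrow> x \<noteq> \<zero> \<Longrightarrow> inv x \<noteq> \<zero>"
  using Units_eq Units_inv_Units unit by fastforce

lemma inv_inv' [simp]: "x \<in> carrier K \<Longrightarrow> x \<noteq> \<zero> \<Longrightarrow> inv (inv x) = x"
  using Units_inv_inv unit by blast

lemma mult_nonzero [simp]:
  assumes "x \<in> carrier K" "x \<noteq> \<zero>" "y \<in> carrier K" "y \<noteq> \<zero>"
  shows "x \<otimes> y \<noteq> \<zero>"
  using Units_m_closed[OF unit unit] assms Units_eq by blast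

lemma cancel_right [simp]:
  assumes "x \<in> carrier K" "y \<in> carrier K" "z \<in> carrier K" "z \<noteq> \<zero>"
  shows "x \<otimes> z = y \<otimes> z \<longleftrightarrow> x = y"
  by (metis assms inv_in inv_right m_assoc r_one)

lemma inv_left' [simp]: 
  assumes "x \<in> carrier K" "x \<noteq> \<zero>" "y \<in> carrier K"
  shows "inv x \<otimes> (x \<otimes> y) = y" "x \<otimes> (inv x \<otimes> y) = y"
  using assms by (simp_all flip: m_assoc)

lemma inv_right' [simp]: 
  assumes "x \<in> carrier K" "x \<noteq> \<zero>" "y \<in> carrier K"
  shows "y \<otimes> x \<otimes> inv x = y" "y \<otimes> inv x \<otimes> x = y"
  using assms by (simp_all add: m_assoc)

lemma eq_divide: 
  assumes "x \<in> carrier K" "x \<noteq> \<zero>" "y \<in> carrier K" "z \<in> carrier K"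
  shows "y = z \<otimes> inv x \<longleftrightarrow> y \<otimes> x = z"
  using assms by auto

lemma inv_unique_right:
  assumes "x \<in> carrier K" "y \<in> carrier K" "x \<otimes> y = \<one>"
  shows "inv x = y"
proof -
  have "x \<noteq> \<zero>" using assms nontrivial by auto
  have "inv x \<otimes> (x \<otimes> y) = inv x" using assms \<open>x \<noteq> \<zero>\<close> by simp
  then show ?thesis using inv_left'(1)[of x y] \<open>x \<noteq> \<zero>\<close> assms(1,2) by simp
qed

lemma inv_mult:
  assumes "x \<in> carrier K" "x \<noteq> \<zero>" "y \<in> carrier K" "y \<noteq> \<zero>"
  shows "inv (x \<otimes> y) = inv y \<otimes> inv x"
  using assms by (intro inv_unique_right) (simp_all add: m_assoc)

lemma nat_pow_nonzero: "x \<in> carrier K \<Longrightarrow> x \<noteq> \<zero> \<Longrightarrow> x [^] (n::nat) \<noteq> \<zero>"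
  by (induction n) (auto simp: nontrivial)

text \<open>Integer powers of a nonzero element are powers in the multiplicative group.\<close>

lemma int_pow_units:
  assumes "x \<in> carrier K" "x \<noteq> \<zero>"
  shows "x [^]\<^bsub>units_of K\<^esub> (m::int) = x [^] m"
  using unit[OF assms] unfolding int_pow_def2
  by (simp add: units_of_inv units_of_pow Units_pow_closed del: pow_nat)

lemma int_pow_add:
  assumes "x \<in> carrier K" "x \<noteq> \<zero>"
  shows "x [^] (m + n :: int) = x [^] m \<otimes> x [^] n"
  using group.int_pow_mult[OF units_group, of x m n] unit[OF assms]
  by (simp add: int_pow_units[OF assms] units_of_carrier units_of_mult)

lemma int_pow_nonzero [simp]:
  assumes "x \<in> carrier K" "x \<noteq> \<zero>"
  shows "x [^] (m::int) \<in> carrier K" "x [^] m \<noteq> \<zero>"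
  using assms nat_pow_nonzero[OF assms] unfolding int_pow_def2 by (auto simp del: pow_nat)

lemma int_pow_minus: "x \<in> carrier K \<Longrightarrow> x \<noteq> \<zero> \<Longrightarrow> x [^] (- m :: int) = inv (x [^] m)"
  using int_pow_add[of x m "- m"] by (intro inv_unique_right[symmetric]) auto

lemma int_pow_1 [simp]: "x \<in> carrier K \<Longrightarrow> x [^] (1::int) = x"
  unfolding int_pow_def2 by (simp del: pow_nat)

definition central :: "'a \<Rightarrow> bool" where
  "central z \<longleftrightarrow> z \<in> carrier K \<and> (\<forall>x\<in>carrier K. z \<otimes> x = x \<otimes> z)"

lemma central_closed [simp]: "central z \<Longrightarrow> z \<in> carrier K"
  unfolding central_def by blast

lemma central_commute: "central z \<Longrightarrow> x \<in> carrier K \<Longrightarrow> z \<otimes> x = x \<otimes> z"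
  unfolding central_def by blast

lemma central_one: "central \<one>" 
  unfolding central_def by simp

lemma central_mult: 
  assumes "central z" "central w" shows "central (z \<otimes> w)"
  unfolding central_def
proof (intro conjI ballI)
  fix x assume x: "x \<in> carrier K"
  have [simp]: "z \<in> carrier K" "w \<in> carrier K" using assms by auto
  have "z \<otimes> w \<otimes> x = z \<otimes> (w \<otimes> x)" using x by (simp add: m_assoc)
  also have "\<dots> = z \<otimes> (x \<otimes> w)" by (simp only: central_commute[OF assms(2) x])
  also have "\<dots> = (z \<otimes> x) \<otimes> w" using x by (simp add: m_assoc)
  also have "\<dots> = (x \<otimes> z) \<otimes> w" by (simp only: central_commute[OF assms(1) x])
  also have "\<dots> = x \<otimes> (z \<otimes> w)" using x by (simp add: m_assoc)
  finally show "z \<otimes> w \<otimes> x = x \<otimes> (z \<otimes> w)" .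
qed (simp add: assms)

lemma commute_inv:
  assumes "z \<in> carrier K" "z \<noteq> \<zero>" "x \<in> carrier K" "z \<otimes> x = x \<otimes> z"
  shows "inv z \<otimes> x = x \<otimes> inv z"
proof -
  have "inv z \<otimes> x \<otimes> z = inv z \<otimes> (x \<otimes> z)" using assms(1-3) by (simp add: m_assoc)
  also have "\<dots> = inv z \<otimes> (z \<otimes> x)" by (simp only: assms(4))
  also have "\<dots> = x" using assms(1-3) by simp
  finally show ?thesis using assms(1-3) by (subst eq_divide) auto
qed

lemma central_inv: "central z \<Longrightarrow> z \<noteq> \<zero> \<Longrightarrow> central (inv z)"
  unfolding central_def using commute_inv inv_in by blast

lemma central_pow: "central z \<Longrightarrow> central (z [^] (n::nat))"
  by (induction n) (auto simp: central_one central_mult)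

lemma central_int_pow: "central z \<Longrightarrow> z \<noteq> \<zero> \<Longrightarrow> central (z [^] (m::int))"
  unfolding int_pow_def2 by (simp add: central_pow central_inv nat_pow_nonzero del: pow_nat)

lemma central_minus:
  assumes "central z" "central w" shows "central (z \<ominus> w)"
  unfolding central_def
proof (intro conjI ballI)
  fix x assume x: "x \<in> carrier K"
  have "(z \<ominus> w) \<otimes> x = z \<otimes> x \<ominus> w \<otimes> x" using assms x by (simp add: minus_eq l_distr l_minus)
  also have "\<dots> = x \<otimes> z \<ominus> x \<otimes> w" using assms x central_commute by metis
  also have "\<dots> = x \<otimes> (z \<ominus> w)" using assms x by (simp add: minus_eq r_distr r_minus)
  finally show "(z \<ominus> w) \<otimes> x = x \<otimes> (z \<ominus> w)" .
qed (use assms in simp)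

lemma hom_nonzero:
  assumes "ring L" "\<one>\<^bsub>L\<^esub> \<noteq> \<zero>\<^bsub>L\<^esub>" "h \<in> ring_hom K L" "x \<in> carrier K" "x \<noteq> \<zero>"
  shows "h x \<noteq> \<zero>\<^bsub>L\<^esub>"
proof
  assume "h x = \<zero>\<^bsub>L\<^esub>"
  moreover have "h x \<otimes>\<^bsub>L\<^esub> h (inv x) = \<one>\<^bsub>L\<^esub>"
    using ring_hom_mult[OF assms(3,4), of "inv x"] assms ring_hom_one[OF assms(3)] by simp
  moreover have "h (inv x) \<in> carrier L" using assms ring_hom_closed by (metis inv_in)
  ultimately show False using assms by (simp add: ring.ring_simprules)
qed

lemma hom_inj:
  assumes "ring L" "\<one>\<^bsub>L\<^esub> \<noteq> \<zero>\<^bsub>L\<^esub>" "h \<in> ring_hom K L"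
  shows "inj_on h (carrier K)"
proof (rule inj_onI)
  fix x y assume *: "x \<in> carrier K" "y \<in> carrier K" "h x = h y"
  interpret L: ring L by fact
  have "h (x \<ominus> y) \<oplus>\<^bsub>L\<^esub> h y = h (x \<ominus> y \<oplus> y)"
    using * ring_hom_add[OF assms(3)] by simp
  also have "\<dots> = h y" using * by (simp add: minus_eq a_assoc l_neg)
  finally have "h (x \<ominus> y) = \<zero>\<^bsub>L\<^esub>"
    using * ring_hom_closed[OF assms(3)] by (metis L.add.r_cancel_one minus_closed)
  then have "x \<ominus> y = \<zero>" using hom_nonzero[OF assms] * by blast
  then show "x = y" using * by simp
qed

lemma hom_inv:
  assumes "skewfield L" "h \<in> ring_hom K L" "x \<in> carrier K" "x \<noteq> \<zero>"
  shows "h (inv x) = inv\<^bsub>L\<^esub> (h x)"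
proof -
  interpret L: skewfield L by fact
  have "h x \<otimes>\<^bsub>L\<^esub> h (inv x) = \<one>\<^bsub>L\<^esub>"
    using ring_hom_mult[OF assms(2,3), of "inv x"] assms ring_hom_one[OF assms(2)] by simp
  then show ?thesis
    using L.inv_unique_right[of "h x" "h (inv x)"] assms ring_hom_closed[OF assms(2)] by simp
qed

end

lemma skewfieldI:
  assumes "ring K" "\<one>\<^bsub>K\<^esub> \<noteq> \<zero>\<^bsub>K\<^esub>"
    and ex: "\<And>x. x \<in> carrier K \<Longrightarrow> x \<noteq> \<zero>\<^bsub>K\<^esub> \<Longrightarrow> \<exists>y\<in>carrier K. x \<otimes>\<^bsub>K\<^esub> y = \<one>\<^bsub>K\<^esub>"
  shows "skewfield K"
proof -
  interpret ring K by fact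
  have "x \<in> Units K" if x: "x \<in> carrier K" "x \<noteq> \<zero>\<^bsub>K\<^esub>" for x
  proof -
    obtain y where y: "y \<in> carrier K" "x \<otimes>\<^bsub>K\<^esub> y = \<one>\<^bsub>K\<^esub>" using ex[OF x] by blast
    then have "y \<noteq> \<zero>\<^bsub>K\<^esub>" using x assms(2) by auto
    then obtain z where z: "z \<in> carrier K" "y \<otimes>\<^bsub>K\<^esub> z = \<one>\<^bsub>K\<^esub>" using ex y by blast
    have "x = x \<otimes>\<^bsub>K\<^esub> (y \<otimes>\<^bsub>K\<^esub> z)" using x z by simp
    also have "\<dots> = z" using x y z m_assoc[of x y z] by simp
    finally show ?thesis using x y z by (auto simp: Units_def)
  qed
  moreover have "\<zero>\<^bsub>K\<^esub> \<notin> Units K" using assms(2) by (auto simp: Units_def)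
  ultimately show ?thesis
    using assms by unfold_locales (auto simp: Units_def)
qed

text \<open>An Ore domain \<open>T\<close> sits in its fraction field \<open>K\<close>, and the Ore condition is the statement that
  a left fraction \<open>\<iota> b\<^sup>-\<^sup>1 \<iota> a\<close> is also a right fraction.\<close>

locale fraction_field = K: skewfield K + T: ring T
  for K :: "'a ring" (structure) and T :: "('t, 'l) ring_scheme" +
  fixes \<iota> :: "'t \<Rightarrow> 'a"
  assumes hom: "\<iota> \<in> ring_hom T K" 
    and nonzero: "\<And>x. x \<in> carrier T \<Longrightarrow> x \<noteq> \<zero>\<^bsub>T\<^esub> \<Longrightarrow> \<iota> x \<noteq> \<zero>"
    and surj: "\<And>x. x \<in> carrier K \<Longrightarrow> \<exists>a\<in>carrier T. \<exists>b\<in>carrier T. b \<noteq> \<zero>\<^bsub>T\<^esub> \<and> x = \<iota> a \<otimes> inv (\<iota> b)"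
begin

lemma closed [simp]: "x \<in> carrier T \<Longrightarrow> \<iota> x \<in> carrier K"
  using ring_hom_closed[OF hom] .

lemma mult: "x \<in> carrier T \<Longrightarrow> y \<in> carrier T \<Longrightarrow> \<iota> (x \<otimes>\<^bsub>T\<^esub> y) = \<iota> x \<otimes> \<iota> y"
  using ring_hom_mult[OF hom] .

lemma add: "x \<in> carrier T \<Longrightarrow> y \<in> carrier T \<Longrightarrow> \<iota> (x \<oplus>\<^bsub>T\<^esub> y) = \<iota> x \<oplus> \<iota> y"
  using ring_hom_add[OF hom] .

lemma one [simp]: "\<iota> \<one>\<^bsub>T\<^esub> = \<one>"
  using ring_hom_one[OF hom] .

lemma zero [simp]: "\<iota> \<zero>\<^bsub>T\<^esub> = \<zero>"
  using ring_hom_zero[OF hom] T.ring_axioms K.ring_axioms by blast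

lemma zero_iff [simp]: "x \<in> carrier T \<Longrightarrow> \<iota> x = \<zero> \<longleftrightarrow> x = \<zero>\<^bsub>T\<^esub>"
  using nonzero zero by blast

lemma inj: 
  assumes "x \<in> carrier T" "y \<in> carrier T" "\<iota> x = \<iota> y" shows "x = y"
proof -
  have "\<iota> (x \<ominus>\<^bsub>T\<^esub> y) \<oplus> \<iota> y = \<iota> (x \<ominus>\<^bsub>T\<^esub> y \<oplus>\<^bsub>T\<^esub> y)"
    using assms add by simp
  also have "\<dots> = \<iota> y" using assms by (simp add: T.minus_eq T.a_assoc T.l_neg)
  finally have "\<iota> (x \<ominus>\<^bsub>T\<^esub> y) = \<zero>"
    using assms by (metis K.add.r_cancel_one T.minus_closed closed)
  then show ?thesis using assms by simp
qed

lemma left_fraction: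
  assumes "a \<in> carrier T" "b \<in> carrier T" "b \<noteq> \<zero>\<^bsub>T\<^esub>"
  obtains c d where "c \<in> carrier T" "d \<in> carrier T" "d \<noteq> \<zero>\<^bsub>T\<^esub>" "a \<otimes>\<^bsub>T\<^esub> d = b \<otimes>\<^bsub>T\<^esub> c"
    "inv (\<iota> b) \<otimes> \<iota> a = \<iota> c \<otimes> inv (\<iota> d)"
proof -
  have "inv (\<iota> b) \<otimes> \<iota> a \<in> carrier K" using assms by simp
  from surj[OF this] obtain c d where cd: "c \<in> carrier T" "d \<in> carrier T" "d \<noteq> \<zero>\<^bsub>T\<^esub>"
    "inv (\<iota> b) \<otimes> \<iota> a = \<iota> c \<otimes> inv (\<iota> d)" by blast
  then have "inv (\<iota> b) \<otimes> \<iota> a \<otimes> \<iota> d = \<iota> c"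
    using assms by simp
  then have "\<iota> b \<otimes> \<iota> c = \<iota> b \<otimes> (inv (\<iota> b) \<otimes> \<iota> a \<otimes> \<iota> d)" by simp
  also have "\<dots> = \<iota> a \<otimes> \<iota> d" using assms cd(1-3) by (simp add: K.m_assoc)
  finally have "\<iota> a \<otimes> \<iota> d = \<iota> b \<otimes> \<iota> c" by simp
  then have "\<iota> (a \<otimes>\<^bsub>T\<^esub> d) = \<iota> (b \<otimes>\<^bsub>T\<^esub> c)"
    using assms cd by (simp add: mult)
  then have "a \<otimes>\<^bsub>T\<^esub> d = b \<otimes>\<^bsub>T\<^esub> c" using inj assms cd by simp
  then show ?thesis using cd that by blast
qed

text \<open>The Ore condition is applied to the two denominators.\<close>

lemma common_denominator:
  assumes "x \<in> carrier K" "y \<in> carrier K"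
  obtains a b c where "a \<in> carrier T" "b \<in> carrier T" "c \<in> carrier T" "c \<noteq> \<zero>\<^bsub>T\<^esub>"
    "x = \<iota> a \<otimes> inv (\<iota> c)" "y = \<iota> b \<otimes> inv (\<iota> c)"
proof -
  obtain a b where ab: "a \<in> carrier T" "b \<in> carrier T" "b \<noteq> \<zero>\<^bsub>T\<^esub>" "x = \<iota> a \<otimes> inv (\<iota> b)"
    using surj[OF assms(1)] by blast
  obtain a' b' where ab': "a' \<in> carrier T" "b' \<in> carrier T" "b' \<noteq> \<zero>\<^bsub>T\<^esub>" "y = \<iota> a' \<otimes> inv (\<iota> b')"
    using surj[OF assms(2)] by blast
  obtain c d where cd: "c \<in> carrier T" "d \<in> carrier T" "d \<noteq> \<zero>\<^bsub>T\<^esub>" "b \<otimes>\<^bsub>T\<^esub> d = b' \<otimes>\<^bsub>T\<^esub> c"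
    using left_fraction[OF ab(2) ab'(2,3)] by blast
  have bd: "\<iota> b \<otimes> \<iota> d \<noteq> \<zero>" using ab cd by simp
  have eq: "\<iota> b \<otimes> \<iota> d = \<iota> b' \<otimes> \<iota> c" using cd mult ab ab' by metis
  have x: "x \<in> carrier K" "y \<in> carrier K" "x \<otimes> \<iota> b = \<iota> a" "y \<otimes> \<iota> b' = \<iota> a'" 
    using ab ab' assms by simp_all
  have "x \<otimes> (\<iota> b \<otimes> \<iota> d) = \<iota> a \<otimes> \<iota> d" "y \<otimes> (\<iota> b' \<otimes> \<iota> c) = \<iota> a' \<otimes> \<iota> c"
    using K.m_assoc[of x "\<iota> b" "\<iota> d"] K.m_assoc[of y "\<iota> b'" "\<iota> c"] x ab(1-3) ab'(1-3) cd(1-3) by simp_all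
  then have "x = \<iota> (a \<otimes>\<^bsub>T\<^esub> d) \<otimes> inv (\<iota> (b \<otimes>\<^bsub>T\<^esub> d))" "y = \<iota> (a' \<otimes>\<^bsub>T\<^esub> c) \<otimes> inv (\<iota> (b \<otimes>\<^bsub>T\<^esub> d))"
    using x ab(1-3) ab'(1-3) cd(1-3) bd eq by (simp_all add: mult K.eq_divide)
  moreover have "b \<otimes>\<^bsub>T\<^esub> d \<noteq> \<zero>\<^bsub>T\<^esub>" using bd mult[of b d] zero ab(2) cd(2) by metis
  ultimately show ?thesis using that[of "a \<otimes>\<^bsub>T\<^esub> d" "a' \<otimes>\<^bsub>T\<^esub> c" "b \<otimes>\<^bsub>T\<^esub> d"] ab(1-3) ab'(1-3) cd(1-3) by simp
qed

text \<open>Homomorphisms of skew fields respect inverses, so the numerators and denominators decide.\<close>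

lemma hom_eqI:
  assumes "skewfield L" "g \<in> ring_hom K L" "h \<in> ring_hom K L"
    and eq: "\<And>a. a \<in> carrier T \<Longrightarrow> g (\<iota> a) = h (\<iota> a)" and x: "x \<in> carrier K"
  shows "g x = h x"
proof -
  obtain a b where "a \<in> carrier T" "b \<in> carrier T" "b \<noteq> \<zero>\<^bsub>T\<^esub>" "x = \<iota> a \<otimes> inv (\<iota> b)"
    using surj[OF x] by blast
  then show ?thesis
    using assms(1-4) by (simp add: ring_hom_mult[OF assms(2)] ring_hom_mult[OF assms(3)] K.hom_inv[OF assms(1)])
qed

text \<open>Well-definedness and multiplicativity come from the Ore condition: after \<open>a d = b c\<close> in
  \<open>T\<close>, the same equation holds for the images under any homomorphism.\<close>

lemma extend_hom:
  assumes L: "skewfield L" and g: "g \<in> ring_hom T L"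
    and gnz: "\<And>x. x \<in> carrier T \<Longrightarrow> x \<noteq> \<zero>\<^bsub>T\<^esub> \<Longrightarrow> g x \<noteq> \<zero>\<^bsub>L\<^esub>"
  obtains h where "h \<in> ring_hom K L \<inter> extensional (carrier K)" "\<And>a. a \<in> carrier T \<Longrightarrow> h (\<iota> a) = g a"
proof -
  interpret L: skewfield L by fact
  note gh [simp] = ring_hom_closed[OF g] ring_hom_mult[OF g] ring_hom_add[OF g] ring_hom_one[OF g] gnz
  have wd: "g a \<otimes>\<^bsub>L\<^esub> inv\<^bsub>L\<^esub> (g b) = g a' \<otimes>\<^bsub>L\<^esub> inv\<^bsub>L\<^esub> (g b')"
    if ab: "a \<in> carrier T" "b \<in> carrier T" "b \<noteq> \<zero>\<^bsub>T\<^esub>" "a' \<in> carrier T" "b' \<in> carrier T" "b' \<noteq> \<zero>\<^bsub>T\<^esub>"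
    and eq: "\<iota> a \<otimes> inv (\<iota> b) = \<iota> a' \<otimes> inv (\<iota> b')" for a b a' b'
  proof -
    obtain c d where cd: "c \<in> carrier T" "d \<in> carrier T" "d \<noteq> \<zero>\<^bsub>T\<^esub>" "b' \<otimes>\<^bsub>T\<^esub> d = b \<otimes>\<^bsub>T\<^esub> c"
      "inv (\<iota> b) \<otimes> \<iota> b' = \<iota> c \<otimes> inv (\<iota> d)"
      using left_fraction[OF ab(5,2,3)] by blast
    have "\<iota> a' = \<iota> a \<otimes> inv (\<iota> b) \<otimes> \<iota> b'" using eq ab by simp
    also have "\<dots> = \<iota> a \<otimes> (\<iota> c \<otimes> inv (\<iota> d))" using ab(1-6) by (simp add: K.m_assoc cd(5)[symmetric])
    also have "\<dots> = \<iota> a \<otimes> \<iota> c \<otimes> inv (\<iota> d)" using ab(1-3) cd(1-3) by (simp add: K.m_assoc)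
    finally have "\<iota> (a' \<otimes>\<^bsub>T\<^esub> d) = \<iota> (a \<otimes>\<^bsub>T\<^esub> c)"
      using ab cd(1-3) by (simp add: mult)
    then have "a' \<otimes>\<^bsub>T\<^esub> d = a \<otimes>\<^bsub>T\<^esub> c" using inj ab cd by simp
    then have e1: "g a' \<otimes>\<^bsub>L\<^esub> g d = g a \<otimes>\<^bsub>L\<^esub> g c" using gh(2) ab cd by metis
    have e2: "g b' \<otimes>\<^bsub>L\<^esub> g d = g b \<otimes>\<^bsub>L\<^esub> g c" using cd(4) gh(2) ab cd by metis
    have "inv\<^bsub>L\<^esub> (g b) \<otimes>\<^bsub>L\<^esub> (g b' \<otimes>\<^bsub>L\<^esub> g d) = g c" using e2 ab cd(1-3) by simp
    then have "g a \<otimes>\<^bsub>L\<^esub> (inv\<^bsub>L\<^esub> (g b) \<otimes>\<^bsub>L\<^esub> (g b' \<otimes>\<^bsub>L\<^esub> g d)) = g a' \<otimes>\<^bsub>L\<^esub> g d" using e1 by simp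
    then have "(g a \<otimes>\<^bsub>L\<^esub> inv\<^bsub>L\<^esub> (g b) \<otimes>\<^bsub>L\<^esub> g b') \<otimes>\<^bsub>L\<^esub> g d = g a' \<otimes>\<^bsub>L\<^esub> g d"
      using ab cd(1-3) by (simp add: L.m_assoc)
    then have "g a \<otimes>\<^bsub>L\<^esub> inv\<^bsub>L\<^esub> (g b) \<otimes>\<^bsub>L\<^esub> g b' = g a'" using ab cd(1-3) by simp
    then show ?thesis using ab by (simp add: L.eq_divide)
  qed
  define P where "P x y \<longleftrightarrow> (\<exists>a\<in>carrier T. \<exists>b\<in>carrier T. b \<noteq> \<zero>\<^bsub>T\<^esub> \<and> x = \<iota> a \<otimes> inv (\<iota> b) \<and>
      y = g a \<otimes>\<^bsub>L\<^esub> inv\<^bsub>L\<^esub> (g b))" for x y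
  define h where "h = restrict (\<lambda>x. SOME y. P x y) (carrier K)"
  have hfrac: "h (\<iota> a \<otimes> inv (\<iota> b)) = g a \<otimes>\<^bsub>L\<^esub> inv\<^bsub>L\<^esub> (g b)"
    if ab: "a \<in> carrier T" "b \<in> carrier T" "b \<noteq> \<zero>\<^bsub>T\<^esub>" for a b
  proof -
    have "P (\<iota> a \<otimes> inv (\<iota> b)) (g a \<otimes>\<^bsub>L\<^esub> inv\<^bsub>L\<^esub> (g b))" using ab P_def by blast
    moreover have "y = g a \<otimes>\<^bsub>L\<^esub> inv\<^bsub>L\<^esub> (g b)" if "P (\<iota> a \<otimes> inv (\<iota> b)) y" for y
      using that wd[OF ab] unfolding P_def by fastforce
    ultimately have "(SOME y. P (\<iota> a \<otimes> inv (\<iota> b)) y) = g a \<otimes>\<^bsub>L\<^esub> inv\<^bsub>L\<^esub> (g b)" by blast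
    then show ?thesis using ab by (simp add: h_def)
  qed
  have hT: "h (\<iota> a) = g a" if "a \<in> carrier T" for a
  proof -
    have nz: "\<one>\<^bsub>T\<^esub> \<noteq> \<zero>\<^bsub>T\<^esub>" using K.nontrivial one zero by metis
    then have "h (\<iota> a \<otimes> inv (\<iota> \<one>\<^bsub>T\<^esub>)) = g a \<otimes>\<^bsub>L\<^esub> inv\<^bsub>L\<^esub> (g \<one>\<^bsub>T\<^esub>)"
      using hfrac[of a "\<one>\<^bsub>T\<^esub>"] that by blast
    then show ?thesis using that by (simp add: K.inv_one L.inv_one)
  qed
  have "h \<in> ring_hom K L"
  proof (rule ring_hom_memI)
    fix x assume x: "x \<in> carrier K"
    then obtain a b where "a \<in> carrier T" "b \<in> carrier T" "b \<noteq> \<zero>\<^bsub>T\<^esub>" "x = \<iota> a \<otimes> inv (\<iota> b)"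
      using surj[OF x] by blast
    then show "h x \<in> carrier L" using hfrac by simp
    fix y assume y: "y \<in> carrier K"
    obtain a b c where abc: "a \<in> carrier T" "b \<in> carrier T" "c \<in> carrier T" "c \<noteq> \<zero>\<^bsub>T\<^esub>"
      "x = \<iota> a \<otimes> inv (\<iota> c)" "y = \<iota> b \<otimes> inv (\<iota> c)"
      using common_denominator[OF x y] .
    have "x \<oplus> y = \<iota> (a \<oplus>\<^bsub>T\<^esub> b) \<otimes> inv (\<iota> c)"
      using abc by (simp add: add K.l_distr)
    then have "h (x \<oplus> y) = g (a \<oplus>\<^bsub>T\<^esub> b) \<otimes>\<^bsub>L\<^esub> inv\<^bsub>L\<^esub> (g c)" using hfrac abc by simp
    also have "\<dots> = g a \<otimes>\<^bsub>L\<^esub> inv\<^bsub>L\<^esub> (g c) \<oplus>\<^bsub>L\<^esub> g b \<otimes>\<^bsub>L\<^esub> inv\<^bsub>L\<^esub> (g c)" using abc(1-4) by (simp add: L.l_distr)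
    also have "\<dots> = h x \<oplus>\<^bsub>L\<^esub> h y" using hfrac abc by simp
    finally show "h (x \<oplus> y) = h x \<oplus>\<^bsub>L\<^esub> h y" .
    obtain u w where uw: "u \<in> carrier T" "w \<in> carrier T" "w \<noteq> \<zero>\<^bsub>T\<^esub>" "b \<otimes>\<^bsub>T\<^esub> w = c \<otimes>\<^bsub>T\<^esub> u"
      "inv (\<iota> c) \<otimes> \<iota> b = \<iota> u \<otimes> inv (\<iota> w)"
      using left_fraction[OF abc(2,3,4)] by blast
    have cw: "c \<otimes>\<^bsub>T\<^esub> w \<noteq> \<zero>\<^bsub>T\<^esub>" using zero_iff[of "c \<otimes>\<^bsub>T\<^esub> w"] abc(1-4) uw(1-3) by (simp add: mult)
    have "g b \<otimes>\<^bsub>L\<^esub> g w = g c \<otimes>\<^bsub>L\<^esub> g u" using gh(2) uw abc by metis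
    then have "inv\<^bsub>L\<^esub> (g c) \<otimes>\<^bsub>L\<^esub> (g b \<otimes>\<^bsub>L\<^esub> g w) = g u" using abc(1-4) uw(1-3) by simp
    then have "inv\<^bsub>L\<^esub> (g c) \<otimes>\<^bsub>L\<^esub> g b \<otimes>\<^bsub>L\<^esub> g w = g u" using abc(1-4) uw(1-3) by (simp add: L.m_assoc)
    then have gfr: "inv\<^bsub>L\<^esub> (g c) \<otimes>\<^bsub>L\<^esub> g b = g u \<otimes>\<^bsub>L\<^esub> inv\<^bsub>L\<^esub> (g w)"
      using abc(1-4) uw(1-3) by (simp add: L.eq_divide)
    have "x \<otimes> y = \<iota> a \<otimes> (inv (\<iota> c) \<otimes> \<iota> b) \<otimes> inv (\<iota> c)"
      using abc by (simp add: K.m_assoc)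
    also have "\<dots> = \<iota> (a \<otimes>\<^bsub>T\<^esub> u) \<otimes> inv (\<iota> (c \<otimes>\<^bsub>T\<^esub> w))"
      unfolding uw(5) using abc(1-4) uw(1-3) by (simp add: K.m_assoc mult K.inv_mult)
    finally have "h (x \<otimes> y) = g (a \<otimes>\<^bsub>T\<^esub> u) \<otimes>\<^bsub>L\<^esub> inv\<^bsub>L\<^esub> (g (c \<otimes>\<^bsub>T\<^esub> w))"
      using hfrac[of "a \<otimes>\<^bsub>T\<^esub> u" "c \<otimes>\<^bsub>T\<^esub> w"] abc(1-4) uw(1-3) cw by simp
    also have "\<dots> = g a \<otimes>\<^bsub>L\<^esub> (g u \<otimes>\<^bsub>L\<^esub> inv\<^bsub>L\<^esub> (g w)) \<otimes>\<^bsub>L\<^esub> inv\<^bsub>L\<^esub> (g c)"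
      using abc(1-4) uw(1-3) by (simp add: L.m_assoc L.inv_mult)
    also have "\<dots> = (g a \<otimes>\<^bsub>L\<^esub> inv\<^bsub>L\<^esub> (g c)) \<otimes>\<^bsub>L\<^esub> (g b \<otimes>\<^bsub>L\<^esub> inv\<^bsub>L\<^esub> (g c))"
      unfolding gfr[symmetric] using abc(1-4) by (simp add: L.m_assoc)
    also have "\<dots> = h x \<otimes>\<^bsub>L\<^esub> h y" using hfrac abc by simp
    finally show "h (x \<otimes> y) = h x \<otimes>\<^bsub>L\<^esub> h y" .
  next
    show "h \<one> = \<one>\<^bsub>L\<^esub>" using hT[of "\<one>\<^bsub>T\<^esub>"] by simp
  qed
  moreover have "h \<in> extensional (carrier K)" by (simp add: h_def)
  ultimately show ?thesis using that hT by blast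
qed

end

text \<open>The subring \<open>S\<close> need not have all of \<open>K\<close> as its fractions; then its own Ore condition
  has to be supplied.\<close>

lemma (in skewfield) fractions_of_Ore_subring:
  assumes S: "subring S K"
    and ore: "\<And>a b. a \<in> S \<Longrightarrow> b \<in> S \<Longrightarrow> b \<noteq> \<zero> \<Longrightarrow> \<exists>c\<in>S. \<exists>d\<in>S. d \<noteq> \<zero> \<and> a \<otimes> d = b \<otimes> c"
  shows "skewfield (K\<lparr>carrier := {a \<otimes> inv b | a b. a \<in> S \<and> b \<in> S \<and> b \<noteq> \<zero>}\<rparr>)"
proof -
  define F where "F = {a \<otimes> inv b | a b. a \<in> S \<and> b \<in> S \<and> b \<noteq> \<zero>}"
  have FI: "a \<otimes> inv b \<in> F" if "a \<in> S" "b \<in> S" "b \<noteq> \<zero>" for a b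
    using that F_def by blast
  have FE: "\<exists>a b. a \<in> S \<and> b \<in> S \<and> b \<noteq> \<zero> \<and> x = a \<otimes> inv b" if "x \<in> F" for x
    using that F_def by blast
  note Sc = subringE[OF S]
  have SK [simp]: "x \<in> carrier K" if "x \<in> S" for x using Sc(1) that by blast
  have FK: "F \<subseteq> carrier K" by (auto simp: F_def)
  have FK' [simp]: "x \<in> carrier K" if "x \<in> F" for x using FK that by blast
  have sF: "s \<in> F" if "s \<in> S" for s
    using FI[OF that Sc(3) nontrivial] that by simp
  have swap: "\<exists>c\<in>S. \<exists>d\<in>S. d \<noteq> \<zero> \<and> inv b \<otimes> a = c \<otimes> inv d" if ab: "a \<in> S" "b \<in> S" "b \<noteq> \<zero>" for a b
  proof -
    obtain c d where cd: "c \<in> S" "d \<in> S" "d \<noteq> \<zero>" "a \<otimes> d = b \<otimes> c" using ore ab by blast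
    have "inv b \<otimes> a \<otimes> d = inv b \<otimes> (b \<otimes> c)" unfolding cd(4)[symmetric] using ab cd(1-3) by (simp add: m_assoc)
    then have "inv b \<otimes> a \<otimes> d = c" using ab cd(1-3) by simp
    then show ?thesis using ab cd by (metis eq_divide inv_in SK m_closed)
  qed
  have Fmult: "x \<otimes> y \<in> F" if xy: "x \<in> F" "y \<in> F" for x y
  proof -
    obtain a b a' b' where ab: "a \<in> S" "b \<in> S" "b \<noteq> \<zero>" "x = a \<otimes> inv b"
       "a' \<in> S" "b' \<in> S" "b' \<noteq> \<zero>" "y = a' \<otimes> inv b'" using FE xy by meson
    obtain c d where cd: "c \<in> S" "d \<in> S" "d \<noteq> \<zero>" "inv b \<otimes> a' = c \<otimes> inv d" using swap ab by blast
    have "x \<otimes> y = a \<otimes> (inv b \<otimes> a') \<otimes> inv b'" using ab by (simp add: m_assoc)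
    also have "\<dots> = (a \<otimes> c) \<otimes> inv (b' \<otimes> d)" unfolding cd(4) using ab(1-3,5-7) cd(1-3) by (simp add: m_assoc inv_mult)
    finally have "x \<otimes> y = (a \<otimes> c) \<otimes> inv (b' \<otimes> d)" .
    moreover have "a \<otimes> c \<in> S" "b' \<otimes> d \<in> S" using ab cd Sc(6) by auto
    moreover have "b' \<otimes> d \<noteq> \<zero>" using ab cd by simp
    ultimately show ?thesis using FI by simp
  qed
  have Finv: "inv x \<in> F" if x: "x \<in> F" "x \<noteq> \<zero>" for x
  proof -
    obtain a b where ab: "a \<in> S" "b \<in> S" "b \<noteq> \<zero>" "x = a \<otimes> inv b" using FE x by meson
    then have a: "a \<noteq> \<zero>" using x by auto
    have "inv x = b \<otimes> inv a" using ab a by (simp add: inv_mult)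
    then show ?thesis using ab a FI by simp
  qed
  have Fadd: "x \<oplus> y \<in> F" if xy: "x \<in> F" "y \<in> F" for x y
  proof (cases "y = \<zero>")
    case True
    then show ?thesis using xy by simp
  next
    case False
    \<comment> \<open>\<open>x + y = (x y\<^sup>-\<^sup>1 + 1) y\<close>, and adding \<open>1\<close> to a fraction keeps its denominator.\<close>
    have "x \<otimes> inv y \<in> F" using xy Fmult Finv False by blast
    then obtain a b where ab: "a \<in> S" "b \<in> S" "b \<noteq> \<zero>" "x \<otimes> inv y = a \<otimes> inv b" using FE by meson
    have "x \<otimes> inv y \<oplus> \<one> = (a \<oplus> b) \<otimes> inv b" using ab by (simp add: l_distr)
    then have "x \<otimes> inv y \<oplus> \<one> \<in> F" using ab Sc(7) FI by simp
    moreover have "x \<oplus> y = (x \<otimes> inv y \<oplus> \<one>) \<otimes> y" 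
      using xy False by (simp add: l_distr)
    ultimately show ?thesis using Fmult xy by simp
  qed
  have Fminus: "\<ominus> x \<in> F" if x: "x \<in> F" for x
  proof -
    obtain a b where ab: "a \<in> S" "b \<in> S" "b \<noteq> \<zero>" "x = a \<otimes> inv b" using FE x by meson
    then have "\<ominus> x = (\<ominus> a) \<otimes> inv b" by (simp add: l_minus)
    then show ?thesis using ab Sc(5) FI by simp
  qed
  have "subring F K"
    by (rule subringI) (use FK sF Sc(3) Fminus Fmult Fadd in auto)
  then have "ring (K\<lparr>carrier := F\<rparr>)" using subring_iff FK by blast
  moreover have "\<exists>y\<in>F. x \<otimes> y = \<one>" if "x \<in> F" "x \<noteq> \<zero>" for x
    using Finv[OF that] that by (intro bexI[of _ "inv x"]) auto
  ultimately show ?thesis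
    unfolding F_def[symmetric] using nontrivial by (intro skewfieldI) auto
qed

section \<open>Twisted Laurent series over a skew field\<close>

lemma (in abelian_monoid) finsum_swap:
  assumes "finite A" "finite B" "\<And>i j. i \<in> A \<Longrightarrow> j \<in> B \<Longrightarrow> f i j \<in> carrier G"
  shows "(\<Oplus>i\<in>A. \<Oplus>j\<in>B. f i j) = (\<Oplus>j\<in>B. \<Oplus>i\<in>A. f i j)"
  using assms(1,3)
proof (induction A rule: finite_induct)
  case empty
  then show ?case by simp
next
  case (insert a A)
  have "(\<Oplus>i\<in>insert a A. \<Oplus>j\<in>B. f i j) = (\<Oplus>j\<in>B. f a j) \<oplus> (\<Oplus>i\<in>A. \<Oplus>j\<in>B. f i j)"
    using insert by (intro finsum_insert) (auto intro!: finsum_closed)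
  also have "\<dots> = (\<Oplus>j\<in>B. f a j) \<oplus> (\<Oplus>j\<in>B. \<Oplus>i\<in>A. f i j)"
    using insert by simp
  also have "\<dots> = (\<Oplus>j\<in>B. f a j \<oplus> (\<Oplus>i\<in>A. f i j))"
    using insert by (intro finsum_addf[symmetric]) (auto intro!: finsum_closed)
  also have "\<dots> = (\<Oplus>j\<in>B. \<Oplus>i\<in>insert a A. f i j)"
    using insert by (intro finsum_cong') (auto intro!: finsum_closed finsum_insert[symmetric])
  finally show ?case .
qed

text \<open>The maps \<open>\<tau> m\<close> are the powers of a single automorphism, namely conjugation by the variable.\<close>

locale twisted_series = D: skewfield D for D :: "'a ring" (structure) +
  fixes \<tau> :: "int \<Rightarrow> 'a \<Rightarrow> 'a"
  assumes twist_hom: "\<And>m. \<tau> m \<in> ring_hom D D"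
    and twist_0: "\<And>x. x \<in> carrier D \<Longrightarrow> \<tau> 0 x = x"
    and twist_add: "\<And>m n x. x \<in> carrier D \<Longrightarrow> \<tau> (m + n) x = \<tau> m (\<tau> n x)"
begin

abbreviation "L \<equiv> twisted_laurent D \<tau>"

lemma twist_closed [simp]: "x \<in> carrier D \<Longrightarrow> \<tau> m x \<in> carrier D"
  using ring_hom_closed[OF twist_hom] .

lemma twist_mult: "x \<in> carrier D \<Longrightarrow> y \<in> carrier D \<Longrightarrow> \<tau> m (x \<otimes> y) = \<tau> m x \<otimes> \<tau> m y"
  using ring_hom_mult[OF twist_hom] .

lemma twist_plus: "x \<in> carrier D \<Longrightarrow> y \<in> carrier D \<Longrightarrow> \<tau> m (x \<oplus> y) = \<tau> m x \<oplus> \<tau> m y"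
  using ring_hom_add[OF twist_hom] .

lemma twist_one [simp]: "\<tau> m \<one> = \<one>"
  using ring_hom_one[OF twist_hom] .

lemma twist_zero [simp]: "\<tau> m \<zero> = \<zero>"
  using ring_hom_zero[OF twist_hom D.ring_axioms D.ring_axioms] .

lemma twist_cancel [simp]: "x \<in> carrier D \<Longrightarrow> \<tau> m (\<tau> (- m) x) = x"
  using twist_add[of x m "- m"] twist_0 by simp

lemma twist_finsum:
  assumes "finite A" "\<And>i. i \<in> A \<Longrightarrow> f i \<in> carrier D"
  shows "\<tau> m (\<Oplus>i\<in>A. f i) = (\<Oplus>i\<in>A. \<tau> m (f i))"
  using assms
proof (induction A rule: finite_induct)
  case (insert a A)
  then have "\<tau> m (\<Oplus>i\<in>insert a A. f i) = \<tau> m (f a \<oplus> (\<Oplus>i\<in>A. f i))"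
    by (subst D.finsum_insert) auto
  also have "\<dots> = \<tau> m (f a) \<oplus> (\<Oplus>i\<in>A. \<tau> m (f i))"
    using insert by (subst twist_plus) (auto intro!: D.finsum_closed)
  also have "\<dots> = (\<Oplus>i\<in>insert a A. \<tau> m (f i))"
    using insert by (subst D.finsum_insert) auto
  finally show ?case .
qed simp

definition below :: "int \<Rightarrow> (int \<Rightarrow> 'a) \<Rightarrow> bool" where
  "below b f \<longleftrightarrow> (\<forall>n<b. f n = \<zero>)"

lemma carrier_L: "f \<in> carrier L \<longleftrightarrow> (\<forall>n. f n \<in> carrier D) \<and> (\<exists>b. below b f)"
  by (simp add: twisted_laurent_def below_def)

lemma carrier_L_coeff: "f \<in> carrier L \<Longrightarrow> f n \<in> carrier D"
  by (simp add: carrier_L)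

lemma bounded: assumes "f \<in> carrier L" obtains b where "below b f"
  using assms carrier_L by blast

lemma zero_L: "\<zero>\<^bsub>L\<^esub> = (\<lambda>n. \<zero>)"
  by (simp add: twisted_laurent_def)

lemma one_L: "\<one>\<^bsub>L\<^esub> = laurent_monomial D \<one> 0"
  by (simp add: twisted_laurent_def laurent_monomial_def)

lemma add_L: "(f \<oplus>\<^bsub>L\<^esub> g) n = f n \<oplus> g n"
  by (simp add: twisted_laurent_def)

text \<open>The index set in the definition of the product depends on the factors; comparing several products
  requires a common one.\<close>

lemma mult_finsum:
  assumes "f \<in> carrier L" "g \<in> carrier L" "finite A"
    and sub: "\<And>m. f m \<noteq> \<zero> \<Longrightarrow> g (n - m) \<noteq> \<zero> \<Longrightarrow> m \<in> A"
  shows "(f \<otimes>\<^bsub>L\<^esub> g) n = (\<Oplus>m\<in>A. f m \<otimes> \<tau> m (g (n - m)))"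
proof -
  note [simp] = carrier_L_coeff[OF assms(1)] carrier_L_coeff[OF assms(2)]
  have "(f \<otimes>\<^bsub>L\<^esub> g) n = (\<Oplus>m\<in>{m. f m \<noteq> \<zero> \<and> g (n - m) \<noteq> \<zero>}. f m \<otimes> \<tau> m (g (n - m)))"
    by (simp add: twisted_laurent_def)
  also have "\<dots> = (\<Oplus>m\<in>A. f m \<otimes> \<tau> m (g (n - m)))"
    using assms by (intro D.add.finprod_mono_neutral_cong_left) auto
  finally show ?thesis .
qed

lemma mult_interval:
  assumes "f \<in> carrier L" "g \<in> carrier L" "below b f" "below c g" "finite A" "{b..n - c} \<subseteq> A"
  shows "(f \<otimes>\<^bsub>L\<^esub> g) n = (\<Oplus>m\<in>A. f m \<otimes> \<tau> m (g (n - m)))"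
proof (rule mult_finsum)
  fix m assume "f m \<noteq> \<zero>" "g (n - m) \<noteq> \<zero>"
  then have "b \<le> m" "c \<le> n - m" using assms(3,4) unfolding below_def by (meson not_less)+
  then have "m \<in> {b..n - c}" by simp
  then show "m \<in> A" using assms(6) by blast
qed (use assms in auto)

lemma mult_below:
  assumes "f \<in> carrier L" "g \<in> carrier L" "below b f" "below c g"
  shows "below (b + c) (f \<otimes>\<^bsub>L\<^esub> g)"
  unfolding below_def
proof (intro allI impI)
  fix n assume "n < b + c"
  then have "(f \<otimes>\<^bsub>L\<^esub> g) n = (\<Oplus>m\<in>{}. f m \<otimes> \<tau> m (g (n - m)))"
    using assms by (intro mult_interval) auto
  then show "(f \<otimes>\<^bsub>L\<^esub> g) n = \<zero>" by simp
qed

lemma mult_closed: assumes "f \<in> carrier L" "g \<in> carrier L" shows "f \<otimes>\<^bsub>L\<^esub> g \<in> carrier L"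
proof -
  note [simp] = carrier_L_coeff[OF assms(1)] carrier_L_coeff[OF assms(2)]
  obtain b c where bc: "below b f" "below c g" using assms bounded by metis
  have "(f \<otimes>\<^bsub>L\<^esub> g) n \<in> carrier D" for n
    using assms bc by (subst mult_interval[where A="{b..n-c}"]) (auto intro!: D.finsum_closed)
  then show ?thesis using mult_below[OF assms bc] carrier_L by blast
qed

lemma add_closed: assumes "f \<in> carrier L" "g \<in> carrier L" shows "f \<oplus>\<^bsub>L\<^esub> g \<in> carrier L"
proof -
  note [simp] = carrier_L_coeff[OF assms(1)] carrier_L_coeff[OF assms(2)]
  obtain b c where "below b f" "below c g" using assms bounded by metis
  then have "below (min b c) (f \<oplus>\<^bsub>L\<^esub> g)" by (auto simp: below_def add_L)
  moreover have "(f \<oplus>\<^bsub>L\<^esub> g) n \<in> carrier D" for n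
    using assms by (simp add: add_L)
  ultimately show ?thesis using carrier_L by blast
qed

lemma monomial_closed [simp]: "a \<in> carrier D \<Longrightarrow> laurent_monomial D a m \<in> carrier L"
  unfolding carrier_L by (auto simp: laurent_monomial_def below_def intro!: exI[of _ m])

lemma monomial_mult_left:
  assumes "a \<in> carrier D" "g \<in> carrier L"
  shows "(laurent_monomial D a m \<otimes>\<^bsub>L\<^esub> g) n = a \<otimes> \<tau> m (g (n - m))"
proof -
  note [simp] = carrier_L_coeff[OF assms(2)]
  have "(laurent_monomial D a m \<otimes>\<^bsub>L\<^esub> g) n = (\<Oplus>i\<in>{m}. laurent_monomial D a m i \<otimes> \<tau> i (g (n - i)))"
    using assms by (intro mult_finsum monomial_closed) (auto simp: laurent_monomial_def split: if_splits)
  then show ?thesis using assms by (simp add: laurent_monomial_def)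
qed

lemma monomial_mult_right:
  assumes "a \<in> carrier D" "f \<in> carrier L"
  shows "(f \<otimes>\<^bsub>L\<^esub> laurent_monomial D a m) n = f (n - m) \<otimes> \<tau> (n - m) a"
proof -
  note [simp] = carrier_L_coeff[OF assms(2)]
  have "(f \<otimes>\<^bsub>L\<^esub> laurent_monomial D a m) n = (\<Oplus>i\<in>{n - m}. f i \<otimes> \<tau> i (laurent_monomial D a m (n - i)))"
    using assms by (intro mult_finsum monomial_closed) (auto simp: laurent_monomial_def split: if_splits)
  then show ?thesis using assms by (simp add: laurent_monomial_def)
qed

lemma monomial_mult_monomial:
  assumes "a \<in> carrier D" "b \<in> carrier D"
  shows "laurent_monomial D a m \<otimes>\<^bsub>L\<^esub> laurent_monomial D b n = laurent_monomial D (a \<otimes> \<tau> m b) (m + n)"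
proof
  fix i show "(laurent_monomial D a m \<otimes>\<^bsub>L\<^esub> laurent_monomial D b n) i = laurent_monomial D (a \<otimes> \<tau> m b) (m + n) i"
    using assms by (simp add: monomial_mult_left) (auto simp: laurent_monomial_def)
qed

text \<open>Both sides are \<open>\<Sum> f\<^sub>l \<tau>\<^sub>l(g\<^sub>m\<^sub>-\<^sub>l) \<tau>\<^sub>m(h\<^sub>n\<^sub>-\<^sub>m)\<close>, and since the supports are bounded below the
  indices \<open>l\<close> and \<open>m\<close> may be restricted to one finite box, where the sums can be exchanged.\<close>

lemma mult_assoc:
  assumes fgh: "f \<in> carrier L" "g \<in> carrier L" "h \<in> carrier L"
  shows "f \<otimes>\<^bsub>L\<^esub> g \<otimes>\<^bsub>L\<^esub> h = f \<otimes>\<^bsub>L\<^esub> (g \<otimes>\<^bsub>L\<^esub> h)"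
proof
  note [simp] = carrier_L_coeff[OF fgh(1)] carrier_L_coeff[OF fgh(2)] carrier_L_coeff[OF fgh(3)]
  fix n
  obtain b c d where bcd: "below b f" "below c g" "below d h" using assms bounded by metis
  define A B where "A = {b + c..n - d}" and "B = {b..n - d - c}"
  have fin: "finite A" "finite B" by (simp_all add: A_def B_def)
  define F where "F m l = f l \<otimes> \<tau> l (g (m - l)) \<otimes> \<tau> m (h (n - m))" for m l
  have F: "F m l \<in> carrier D" for m l using fgh by (simp add: F_def)
  have "(f \<otimes>\<^bsub>L\<^esub> g \<otimes>\<^bsub>L\<^esub> h) n = (\<Oplus>m\<in>A. (f \<otimes>\<^bsub>L\<^esub> g) m \<otimes> \<tau> m (h (n - m)))"
    using fgh bcd by (intro mult_interval[where b="b + c" and c=d] mult_closed mult_below) (auto simp: A_def)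
  also have "\<dots> = (\<Oplus>m\<in>A. \<Oplus>l\<in>B. F m l)"
  proof (rule D.finsum_cong')
    fix m assume "m \<in> A"
    then have "(f \<otimes>\<^bsub>L\<^esub> g) m = (\<Oplus>l\<in>B. f l \<otimes> \<tau> l (g (m - l)))"
      using fgh bcd by (intro mult_interval) (auto simp: A_def B_def)
    then show "(f \<otimes>\<^bsub>L\<^esub> g) m \<otimes> \<tau> m (h (n - m)) = (\<Oplus>l\<in>B. F m l)"
      using fgh fin unfolding F_def by (simp add: D.finsum_ldistr)
  qed (use F in \<open>auto intro!: D.finsum_closed\<close>)
  also have "\<dots> = (\<Oplus>l\<in>B. \<Oplus>m\<in>A. F m l)"
    using fin F by (intro D.finsum_swap) auto
  also have "\<dots> = (\<Oplus>l\<in>B. f l \<otimes> \<tau> l ((g \<otimes>\<^bsub>L\<^esub> h) (n - l)))"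
  proof (rule D.finsum_cong')
    fix l assume l: "l \<in> B"
    have "(g \<otimes>\<^bsub>L\<^esub> h) (n - l) = (\<Oplus>p\<in>(\<lambda>m. m - l) ` A. g p \<otimes> \<tau> p (h (n - l - p)))"
    proof (rule mult_interval)
      show "{c..n - l - d} \<subseteq> (\<lambda>m. m - l) ` A"
        using l by (auto simp: A_def B_def image_iff intro!: bexI[of _ "_ + l"])
    qed (use fgh bcd fin in auto)
    also have "\<dots> = (\<Oplus>m\<in>A. g (m - l) \<otimes> \<tau> (m - l) (h (n - m)))"
      using fgh by (subst D.finsum_reindex) (auto simp: inj_on_def)
    finally have "\<tau> l ((g \<otimes>\<^bsub>L\<^esub> h) (n - l)) = (\<Oplus>m\<in>A. \<tau> l (g (m - l)) \<otimes> \<tau> m (h (n - m)))"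
      using fgh fin twist_add[of "h _" l "_ - l"] by (simp add: twist_finsum twist_mult flip: twist_add)
    then show "(\<Oplus>m\<in>A. F m l) = f l \<otimes> \<tau> l ((g \<otimes>\<^bsub>L\<^esub> h) (n - l))"
      using fgh fin unfolding F_def by (simp add: D.finsum_rdistr D.m_assoc)
  qed (use fgh carrier_L_coeff[OF mult_closed[OF fgh(2,3)]] in auto)
  also have "\<dots> = (f \<otimes>\<^bsub>L\<^esub> (g \<otimes>\<^bsub>L\<^esub> h)) n"
    using fgh bcd fin mult_below[of g h c d]
    by (intro mult_interval[symmetric, where c="c + d"] mult_closed) (auto simp: B_def)
  finally show "(f \<otimes>\<^bsub>L\<^esub> g \<otimes>\<^bsub>L\<^esub> h) n = (f \<otimes>\<^bsub>L\<^esub> (g \<otimes>\<^bsub>L\<^esub> h)) n" .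
qed

lemma ring_L: "ring L"
proof (rule ringI)
  show "abelian_group L"
  proof (rule abelian_groupI)
    fix f assume f: "f \<in> carrier L"
    then obtain b where "below b f" using bounded by blast
    then have "(\<lambda>n. \<ominus> f n) \<in> carrier L" unfolding carrier_L using carrier_L_coeff[OF f] by (auto simp: below_def)
    then show "\<exists>g\<in>carrier L. g \<oplus>\<^bsub>L\<^esub> f = \<zero>\<^bsub>L\<^esub>"
      by (rule bexI[rotated]) (use carrier_L_coeff[OF f] in \<open>simp add: fun_eq_iff add_L zero_L D.l_neg\<close>)
  next
    show "\<zero>\<^bsub>L\<^esub> \<in> carrier L" by (simp add: carrier_L zero_L below_def)
  qed (simp_all add: add_closed fun_eq_iff add_L zero_L D.a_ac carrier_L_coeff)
  have "\<one>\<^bsub>L\<^esub> \<otimes>\<^bsub>L\<^esub> f = f" "f \<otimes>\<^bsub>L\<^esub> \<one>\<^bsub>L\<^esub> = f" if "f \<in> carrier L" for f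
    using that carrier_L_coeff[OF that]
    by (auto simp: fun_eq_iff one_L monomial_mult_left monomial_mult_right twist_0)
  then show "monoid L"
    by (intro monoidI) (auto simp: mult_closed mult_assoc one_L)
  fix f g h assume fgh: "f \<in> carrier L" "g \<in> carrier L" "h \<in> carrier L"
  note [simp] = carrier_L_coeff[OF fgh(1)] carrier_L_coeff[OF fgh(2)] carrier_L_coeff[OF fgh(3)]
  obtain b c d where bcd: "below b f" "below c g" "below d h" using fgh bounded by metis
  show "(f \<oplus>\<^bsub>L\<^esub> g) \<otimes>\<^bsub>L\<^esub> h = f \<otimes>\<^bsub>L\<^esub> h \<oplus>\<^bsub>L\<^esub> g \<otimes>\<^bsub>L\<^esub> h"
  proof
    fix n
    define A where "A = {min b c..n - d}"
    have "below (min b c) (f \<oplus>\<^bsub>L\<^esub> g)" using bcd by (auto simp: below_def add_L)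
    then have "((f \<oplus>\<^bsub>L\<^esub> g) \<otimes>\<^bsub>L\<^esub> h) n = (\<Oplus>m\<in>A. (f \<oplus>\<^bsub>L\<^esub> g) m \<otimes> \<tau> m (h (n - m)))"
      using fgh bcd by (intro mult_interval add_closed) (auto simp: A_def)
    also have "\<dots> = (\<Oplus>m\<in>A. f m \<otimes> \<tau> m (h (n - m)) \<oplus> g m \<otimes> \<tau> m (h (n - m)))"
      using fgh by (simp add: add_L D.l_distr)
    also have "\<dots> = (\<Oplus>m\<in>A. f m \<otimes> \<tau> m (h (n - m))) \<oplus> (\<Oplus>m\<in>A. g m \<otimes> \<tau> m (h (n - m)))"
      using fgh by (intro D.finsum_addf) auto
    also have "(\<Oplus>m\<in>A. f m \<otimes> \<tau> m (h (n - m))) = (f \<otimes>\<^bsub>L\<^esub> h) n"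
      using fgh bcd by (intro mult_interval[symmetric]) (auto simp: A_def)
    also have "(\<Oplus>m\<in>A. g m \<otimes> \<tau> m (h (n - m))) = (g \<otimes>\<^bsub>L\<^esub> h) n"
      using fgh bcd by (intro mult_interval[symmetric]) (auto simp: A_def)
    finally show "((f \<oplus>\<^bsub>L\<^esub> g) \<otimes>\<^bsub>L\<^esub> h) n = (f \<otimes>\<^bsub>L\<^esub> h \<oplus>\<^bsub>L\<^esub> g \<otimes>\<^bsub>L\<^esub> h) n" by (simp only: add_L[of "f \<otimes>\<^bsub>L\<^esub> h"])
  qed
  show "h \<otimes>\<^bsub>L\<^esub> (f \<oplus>\<^bsub>L\<^esub> g) = h \<otimes>\<^bsub>L\<^esub> f \<oplus>\<^bsub>L\<^esub> h \<otimes>\<^bsub>L\<^esub> g"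
  proof
    fix n
    define A where "A = {d..n - min b c}"
    have "below (min b c) (f \<oplus>\<^bsub>L\<^esub> g)" using bcd by (auto simp: below_def add_L)
    then have "(h \<otimes>\<^bsub>L\<^esub> (f \<oplus>\<^bsub>L\<^esub> g)) n = (\<Oplus>m\<in>A. h m \<otimes> \<tau> m ((f \<oplus>\<^bsub>L\<^esub> g) (n - m)))"
      using fgh bcd by (intro mult_interval add_closed) (auto simp: A_def)
    also have "\<dots> = (\<Oplus>m\<in>A. h m \<otimes> \<tau> m (f (n - m)) \<oplus> h m \<otimes> \<tau> m (g (n - m)))"
      using fgh by (simp add: add_L twist_plus D.r_distr)
    also have "\<dots> = (\<Oplus>m\<in>A. h m \<otimes> \<tau> m (f (n - m))) \<oplus> (\<Oplus>m\<in>A. h m \<otimes> \<tau> m (g (n - m)))"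
      using fgh by (intro D.finsum_addf) auto
    also have "(\<Oplus>m\<in>A. h m \<otimes> \<tau> m (f (n - m))) = (h \<otimes>\<^bsub>L\<^esub> f) n"
      using fgh bcd by (intro mult_interval[symmetric]) (auto simp: A_def)
    also have "(\<Oplus>m\<in>A. h m \<otimes> \<tau> m (g (n - m))) = (h \<otimes>\<^bsub>L\<^esub> g) n"
      using fgh bcd by (intro mult_interval[symmetric]) (auto simp: A_def)
    finally show "(h \<otimes>\<^bsub>L\<^esub> (f \<oplus>\<^bsub>L\<^esub> g)) n = (h \<otimes>\<^bsub>L\<^esub> f \<oplus>\<^bsub>L\<^esub> h \<otimes>\<^bsub>L\<^esub> g) n" by (simp only: add_L[of "h \<otimes>\<^bsub>L\<^esub> f"])
  qed
qed

text \<open>The lowest coefficient of \<open>f\<close> is invertible, so the equations \<open>(f g)\<^sub>n = \<delta>\<^sub>n\<^sub>0\<close> determine the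
  coefficients of \<open>g\<close> one after the other.\<close>

lemma right_inverse:
  assumes f: "f \<in> carrier L" "f \<noteq> \<zero>\<^bsub>L\<^esub>"
  obtains g where "g \<in> carrier L" "f \<otimes>\<^bsub>L\<^esub> g = \<one>\<^bsub>L\<^esub>"
proof -
  note [simp] = carrier_L_coeff[OF f(1)]
  obtain b0 where b0: "below b0 f" using bounded f by blast
  obtain n0 where n0: "f n0 \<noteq> \<zero>" using f(2) by (auto simp: zero_L)
  have "b0 \<le> n0" using b0 n0 unfolding below_def by (meson not_less)
  then have ex: "\<exists>i::nat. f (b0 + int i) \<noteq> \<zero>" using n0 by (intro exI[of _ "nat (n0 - b0)"]) simp
  define b where "b = b0 + int (LEAST i. f (b0 + int i) \<noteq> \<zero>)"
  have fb: "f b \<noteq> \<zero>" unfolding b_def using LeastI_ex[OF ex] .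
  have below: "below b f"
    unfolding below_def
  proof (intro allI impI)
    fix n assume n: "n < b"
    show "f n = \<zero>"
    proof (cases "n < b0")
      case False
      then have "nat (n - b0) < (LEAST i. f (b0 + int i) \<noteq> \<zero>)" using n by (simp add: b_def)
      then show ?thesis using not_less_Least[of "nat (n - b0)" "\<lambda>i. f (b0 + int i) \<noteq> \<zero>"] False by simp
    qed (use b0 below_def in auto)
  qed
  \<comment> \<open>the value of the \<open>i\<close>-th coefficient of \<open>g\<close>, counted from degree \<open>-b\<close>, in terms of the earlier ones\<close>
  define \<Phi> where "\<Phi> G i = \<tau> (- b) (inv (f b) \<otimes> ((if i = 0 then \<one> else \<zero>) \<ominus>
      (\<Oplus>j\<in>{..<i}. f (b + int i - int j) \<otimes> \<tau> (b + int i - int j) (G j))))" for G i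
  define G where "G = wfrec less_than \<Phi>"
  have Gcut: "G i = \<Phi> (cut G less_than i) i" for i
    unfolding G_def by (rule wfrec) simp
  have Gclosed: "G i \<in> carrier D" for i
  proof (induction i rule: less_induct)
    case (less i)
    then have "f (b + int i - int j) \<otimes> \<tau> (b + int i - int j) (cut G less_than i j) \<in> carrier D" if "j < i" for j
      using that f by (simp add: cut_apply)
    then show ?case using f fb by (subst Gcut) (auto simp: \<Phi>_def intro!: twist_closed D.m_closed D.minus_closed D.finsum_closed)
  qed
  define S where "S i = (\<Oplus>j\<in>{..<i}. f (b + int i - int j) \<otimes> \<tau> (b + int i - int j) (G j))" for i
  have S: "S i \<in> carrier D" for i using f Gclosed by (auto simp: S_def intro!: D.finsum_closed)
  have G: "G i = \<tau> (- b) (inv (f b) \<otimes> ((if i = 0 then \<one> else \<zero>) \<ominus> S i))" for i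
  proof -
    have "(\<Oplus>j\<in>{..<i}. f (b + int i - int j) \<otimes> \<tau> (b + int i - int j) (cut G less_than i j)) = S i"
      unfolding S_def using f Gclosed by (intro D.finsum_cong') (auto simp: cut_apply)
    then show ?thesis by (subst Gcut) (simp add: \<Phi>_def)
  qed
  define g where "g n = (if n < - b then \<zero> else G (nat (n + b)))" for n
  have g: "g \<in> carrier L" "below (- b) g" using Gclosed by (auto simp: carrier_L g_def below_def)
  have "(f \<otimes>\<^bsub>L\<^esub> g) n = \<one>\<^bsub>L\<^esub> n" for n
  proof (cases "n < 0")
    case True
    then show ?thesis using mult_below[OF f(1) g(1) below g(2)] by (simp add: below_def one_L laurent_monomial_def)
  next
    case False
    define i where "i = nat n"
    have n: "n = int i" using False by (simp add: i_def)
    have "(f \<otimes>\<^bsub>L\<^esub> g) n = (\<Oplus>m\<in>(\<lambda>j. b + int i - int j) ` {..i}. f m \<otimes> \<tau> m (g (n - m)))"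
    proof (rule mult_interval[OF f(1) g(1) below g(2)])
      show "{b..n - - b} \<subseteq> (\<lambda>j. b + int i - int j) ` {..i}"
      proof
        fix x assume "x \<in> {b..n - - b}"
        then show "x \<in> (\<lambda>j. b + int i - int j) ` {..i}"
          using n by (intro image_eqI[of _ _ "nat (b + int i - x)"]) auto
      qed
    qed simp
    also have "\<dots> = (\<Oplus>j\<in>{..i}. f (b + int i - int j) \<otimes> \<tau> (b + int i - int j) (G j))"
      using f g n Gclosed by (subst D.finsum_reindex) (auto simp: inj_on_def g_def intro!: D.finsum_cong')
    also have "{..i} = insert i {..<i}" by auto
    also have "(\<Oplus>j\<in>insert i {..<i}. f (b + int i - int j) \<otimes> \<tau> (b + int i - int j) (G j)) = f b \<otimes> \<tau> b (G i) \<oplus> S i"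
      using f Gclosed by (subst D.finsum_insert) (auto simp: S_def)
    also have "\<dots> = (if i = 0 then \<one> else \<zero>)"
      using f fb S by (simp add: G D.minus_eq D.a_assoc D.l_neg)
    finally show ?thesis using n by (simp add: one_L laurent_monomial_def)
  qed
  then show ?thesis using that g(1) by blast
qed

lemma skewfield_L: "skewfield L"
proof (rule skewfieldI)
  show "\<one>\<^bsub>L\<^esub> \<noteq> \<zero>\<^bsub>L\<^esub>" using D.nontrivial by (auto simp: one_L zero_L laurent_monomial_def fun_eq_iff)
qed (use ring_L right_inverse in blast)+

end

section \<open>Integer combinations\<close>

text \<open>The definition of \<open>zmul\<close> splits on the sign; this recursion holds across \<open>0\<close> and serves the
  inductions over the integers.\<close>

lemma zmul_add_one: "zmul (m + 1) x = zmul m x + x"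
proof -
  consider "0 \<le> m" | "m = -1" | "m < -1" by linarith
  then show ?thesis
  proof cases
    case 3
    then have "nat (- m) = Suc (nat (- (m + 1)))" by simp
    then show ?thesis using 3 by (simp add: zmul_def)
  qed (simp_all add: zmul_def nat_add_distrib)
qed

lemma zmul_0 [simp]: "zmul 0 x = 0" by (simp add: zmul_def)

lemma zmul_1 [simp]: "zmul 1 x = x" using zmul_add_one[of 0 x] by simp

lemma zmul_add: "zmul (m + n) x = zmul m x + zmul n x"
proof (induction n rule: int_induct[where k=0])
  case (step1 i)
  then show ?case using zmul_add_one[of "m + i" x] zmul_add_one[of i x] by (simp add: algebra_simps)
next
  case (step2 i)
  then show ?case using zmul_add_one[of "m + (i - 1)" x] zmul_add_one[of "i - 1" x] by (simp add: algebra_simps)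
qed simp

lemma zmul_minus [simp]: "zmul (- m) x = - zmul m x"
  using zmul_add[of m "- m" x] by (simp add: minus_unique)

lemma zmul_diff: "zmul (m - n) x = zmul m x - zmul n x"
  using zmul_add[of m "- n" x] by simp

lemma zmul_zero_right [simp]: "zmul m 0 = 0"
  by (simp add: zmul_def)

lemma zmul_plus: "zmul m (x + y) = zmul m x + zmul m y"
  by (simp add: zmul_def sum.distrib)

lemma zmul_mult: "zmul (m * n) x = zmul m (zmul n x)"
proof (induction m rule: int_induct[where k=0])
  case (step1 i)
  then show ?case by (simp add: zmul_add ring_distribs)
next
  case (step2 i)
  then show ?case by (simp add: zmul_diff ring_distribs)
qed simp

lemma zmul_minus_right: "zmul m (- x) = - zmul m x"
  using zmul_plus[of m x "- x"] by (simp add: minus_unique)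

lemma zmul_sum: "zmul (\<Sum>i\<in>F. a i) x = (\<Sum>i\<in>F. zmul (a i) x)"
  by (induction F rule: infinite_finite_induct) (auto simp: zmul_add)

lemma additive_zmul:
  fixes f :: "'n::ab_group_add \<Rightarrow> 'r::ring_1"
  assumes "\<And>x y. f (x + y) = f x + f y"
  shows "f (zmul m x) = of_int m * f x"
proof (induction m rule: int_induct[where k=0])
  case base
  then show ?case using assms[of 0 0] by simp
next
  case (step1 i)
  then show ?case by (simp add: zmul_add assms ring_distribs)
next
  case (step2 i)
  have "f (zmul (i - 1) x) + f x = f (zmul i x)" using assms zmul_add[of "i - 1" 1 x] by simp
  then show ?case using step2 by (simp add: algebra_simps)
qed

lemma additive_sum_zmul:
  fixes f :: "'n::ab_group_add \<Rightarrow> 'r::ring_1"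
  assumes "\<And>x y. f (x + y) = f x + f y"
  shows "f (\<Sum>j\<in>J. zmul (a j) (e j)) = (\<Sum>j\<in>J. of_int (a j) * f (e j))"
  using assms[of 0 0] 
  by (induction J rule: infinite_finite_induct) (auto simp: assms additive_zmul[of f, OF assms])

definition lattice_span :: "('i \<Rightarrow> 'n::ab_group_add) \<Rightarrow> 'i set \<Rightarrow> 'n set" where
  "lattice_span e J = range (\<lambda>a. \<Sum>j\<in>J. zmul (a j) (e j))"

lemma lattice_span_add: "v \<in> lattice_span e J \<Longrightarrow> w \<in> lattice_span e J \<Longrightarrow> v + w \<in> lattice_span e J"
proof -
  assume "v \<in> lattice_span e J" "w \<in> lattice_span e J"
  then obtain a b where "v = (\<Sum>j\<in>J. zmul (a j) (e j))" "w = (\<Sum>j\<in>J. zmul (b j) (e j))"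
    by (auto simp: lattice_span_def)
  then have "v + w = (\<Sum>j\<in>J. zmul (a j + b j) (e j))" by (simp add: zmul_add sum.distrib)
  then show ?thesis by (auto simp: lattice_span_def)
qed

lemma lattice_span_0: "0 \<in> lattice_span e J"
  unfolding lattice_span_def by (rule image_eqI[of _ _ "\<lambda>_. 0"]) auto

lemma lattice_span_basis: "finite J \<Longrightarrow> j \<in> J \<Longrightarrow> e j \<in> lattice_span e J"
  unfolding lattice_span_def
  by (rule image_eqI[of _ _ "\<lambda>i. if i = j then 1 else 0"]) (auto simp: if_distrib[of "\<lambda>m. zmul m _"] cong: if_cong)

section \<open>Quantum tori\<close>

lemma poly_mapping_sum_singles:
  fixes f :: "'n \<Rightarrow>\<^sub>0 'c::comm_monoid_add"
  shows "f = (\<Sum>v\<in>Poly_Mapping.keys f. Poly_Mapping.single v (Poly_Mapping.lookup f v))"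
proof (rule poly_mapping_eqI)
  fix v
  show "Poly_Mapping.lookup f v = Poly_Mapping.lookup (\<Sum>v\<in>Poly_Mapping.keys f. Poly_Mapping.single v (Poly_Mapping.lookup f v)) v"
    by (simp add: lookup_sum lookup_single when_def in_keys_iff)
qed

lemma poly_mapping_additive_induct [case_names single add]:
  fixes f :: "'n \<Rightarrow>\<^sub>0 'c::comm_monoid_add"
  assumes single: "\<And>v r. P (Poly_Mapping.single v r)" and add: "\<And>f g. P f \<Longrightarrow> P g \<Longrightarrow> P (f + g)"
  shows "P f"
proof -
  have "P (\<Sum>v\<in>A. Poly_Mapping.single v (Poly_Mapping.lookup f v))" if "finite A" for A
    using that
  proof (induction A rule: finite_induct)
    case empty
    then show ?case using single[of undefined 0] by simp
  qed (simp add: single add)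
  from this[of "Poly_Mapping.keys f"] show ?thesis using poly_mapping_sum_singles[of f] by simp
qed

text \<open>Only the integral bicharacter \<open>B(v, w) = d{v, w}\<close> enters the structure of the torus.\<close>

locale torus =
  fixes \<Gamma> :: "('i::finite, 'n::ab_group_add) fixed_data" and Q :: "int \<Rightarrow> 'c::comm_ring_1"
    and B :: "'n \<Rightarrow> 'n \<Rightarrow> int" and T :: "('n \<Rightarrow>\<^sub>0 'c) ring"
  defines "B \<equiv> \<lambda>v w. q_exponent \<Gamma> (form \<Gamma> v w)" and "T \<equiv> quantum_torus \<Gamma> Q"
  assumes Q_0 [simp]: "Q 0 = 1" and Q_add: "Q (a + b) = Q a * Q b"
    and B_add_left: "B (u + v) w = B u w + B v w"
    and B_antisym: "B v w = - B w v"
begin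

lemma B_add_right: "B u (v + w) = B u v + B u w"
  using B_add_left B_antisym by (metis add.commute minus_add_distrib)

lemma B_zero [simp]: "B 0 v = 0" "B v 0 = 0"
  using B_add_left[of 0 0 v] B_antisym[of v 0] by auto

lemma B_self [simp]: "B v v = 0"
  using B_antisym[of v v] by simp

lemma B_minus [simp]: "B (- v) w = - B v w" "B v (- w) = - B v w"
  using B_add_left[of v "- v" w] B_add_right[of v w "- w"] by auto

lemma Q_inverse [simp]: "Q a * Q (- a) = 1" "Q (- a) * Q a = 1"
  using Q_add[of a "- a"] Q_add[of "- a" a] by auto

lemma T_simps [simp]: "carrier T = UNIV" "\<one>\<^bsub>T\<^esub> = 1" "\<zero>\<^bsub>T\<^esub> = 0" 
  "f \<oplus>\<^bsub>T\<^esub> g = f + g"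
  by (simp_all add: T_def quantum_torus_def)

text \<open>With index sets independent of the keys, distributivity can be checked termwise.\<close>

lemma mult_sum:
  assumes "finite F" "Poly_Mapping.keys f \<subseteq> F" "finite G" "Poly_Mapping.keys g \<subseteq> G"
  shows "f \<otimes>\<^bsub>T\<^esub> g = (\<Sum>v\<in>F. \<Sum>w\<in>G. Poly_Mapping.single (v + w)
    (Q (B v w) * Poly_Mapping.lookup f v * Poly_Mapping.lookup g w))" (is "_ = (\<Sum>v\<in>F. \<Sum>w\<in>G. ?s v w)")
proof -
  have "f \<otimes>\<^bsub>T\<^esub> g = (\<Sum>v\<in>Poly_Mapping.keys f. \<Sum>w\<in>Poly_Mapping.keys g. ?s v w)"
    by (simp add: T_def quantum_torus_def B_def)
  also have "\<dots> = (\<Sum>v\<in>Poly_Mapping.keys f. \<Sum>w\<in>G. ?s v w)"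
    using assms by (intro sum.cong sum.mono_neutral_left) (auto simp: in_keys_iff)
  also have "\<dots> = (\<Sum>v\<in>F. \<Sum>w\<in>G. ?s v w)"
    using assms by (intro sum.mono_neutral_left) (auto simp: in_keys_iff)
  finally show ?thesis .
qed

lemma single_mult_single [simp]:
  "Poly_Mapping.single v r \<otimes>\<^bsub>T\<^esub> Poly_Mapping.single w s = Poly_Mapping.single (v + w) (Q (B v w) * r * s)"
  by (subst mult_sum[of "{v}" _ "{w}"]) (auto split: if_splits)

lemma mult_add_left: "(f + f') \<otimes>\<^bsub>T\<^esub> g = f \<otimes>\<^bsub>T\<^esub> g + f' \<otimes>\<^bsub>T\<^esub> g"
proof -
  let ?F = "Poly_Mapping.keys f \<union> Poly_Mapping.keys f'"
  have "Poly_Mapping.keys (f + f') \<subseteq> ?F" by (rule keys_add)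
  then show ?thesis
    by (simp add: mult_sum[of ?F _ "Poly_Mapping.keys g"] lookup_add algebra_simps single_add sum.distrib)
qed

lemma mult_add_right: "f \<otimes>\<^bsub>T\<^esub> (g + g') = f \<otimes>\<^bsub>T\<^esub> g + f \<otimes>\<^bsub>T\<^esub> g'"
proof -
  let ?G = "Poly_Mapping.keys g \<union> Poly_Mapping.keys g'"
  have "Poly_Mapping.keys (g + g') \<subseteq> ?G" by (rule keys_add)
  then show ?thesis
    by (simp add: mult_sum[of "Poly_Mapping.keys f" _ ?G] lookup_add algebra_simps single_add sum.distrib)
qed

text \<open>Associativity on monomials is the cocycle identity of \<open>(u, v) \<mapsto> Q (B u v)\<close>, which follows from
  biadditivity.\<close>

lemma ring_T: "ring T"
proof (rule ringI)
  show "abelian_group T"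
    by (rule abelian_groupI) (auto simp: algebra_simps intro!: exI[of _ "- _"])
  have assoc: "f \<otimes>\<^bsub>T\<^esub> g \<otimes>\<^bsub>T\<^esub> h = f \<otimes>\<^bsub>T\<^esub> (g \<otimes>\<^bsub>T\<^esub> h)" for f g h
  proof (induction f rule: poly_mapping_additive_induct)
    case (single u a)
    show ?case
    proof (induction g rule: poly_mapping_additive_induct)
      case (single v b)
      show ?case
        by (induction h rule: poly_mapping_additive_induct)
          (simp_all add: mult_add_right B_add_left B_add_right Q_add algebra_simps)
    qed (simp add: mult_add_left mult_add_right)
  qed (simp add: mult_add_left)
  have "1 \<otimes>\<^bsub>T\<^esub> f = f" for f
    by (induction f rule: poly_mapping_additive_induct) (simp_all add: mult_add_right flip: single_one)
  moreover have "f \<otimes>\<^bsub>T\<^esub> 1 = f" for f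
    by (induction f rule: poly_mapping_additive_induct) (simp_all add: mult_add_left flip: single_one)
  ultimately show "monoid T"
    by (intro monoidI) (simp_all add: assoc)
qed (simp_all add: mult_add_left mult_add_right)

sublocale T: ring T by (rule ring_T)

lemma minus_T: "\<ominus>\<^bsub>T\<^esub> f = - f"
  by (rule T.minus_equality) simp_all

lemma scalar_mult_single [simp]: "scalar r \<otimes>\<^bsub>T\<^esub> Poly_Mapping.single v s = Poly_Mapping.single v (r * s)"
  by (simp add: scalar_def)

lemma scalar_commute: "scalar r \<otimes>\<^bsub>T\<^esub> f = f \<otimes>\<^bsub>T\<^esub> scalar r"
  by (induction f rule: poly_mapping_additive_induct)
    (simp_all add: scalar_def mult_add_left mult_add_right mult.commute)

lemma single_eq_scalar: "Poly_Mapping.single v r = scalar r \<otimes>\<^bsub>T\<^esub> X_monomial v"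
  by (simp add: X_monomial_def)

lemma X_monomial_nonzero [simp]: "X_monomial w \<noteq> (0 :: 'n \<Rightarrow>\<^sub>0 'c)"
  unfolding X_monomial_def by (metis lookup_single_eq lookup_zero zero_neq_one)

text \<open>Right multiplication by a monomial shifts the exponents and changes coefficients by units.\<close>

lemma lookup_mult_monomial:
  "Poly_Mapping.lookup (f \<otimes>\<^bsub>T\<^esub> X_monomial w) (v + w) = Q (B v w) * Poly_Mapping.lookup f v"
  by (induction f rule: poly_mapping_additive_induct)
    (simp_all add: X_monomial_def mult_add_left lookup_add lookup_single when_def algebra_simps)

lemma mult_monomial_nonzero:
  assumes "f \<noteq> 0" shows "f \<otimes>\<^bsub>T\<^esub> X_monomial w \<noteq> 0"
proof
  assume *: "f \<otimes>\<^bsub>T\<^esub> X_monomial w = 0"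
  have "Poly_Mapping.lookup f v = 0" for v
  proof -
    have "Q (B v w) * Poly_Mapping.lookup f v = 0" using lookup_mult_monomial[of f w v] * by simp
    then have "Q (- B v w) * (Q (B v w) * Poly_Mapping.lookup f v) = 0" by simp
    then show ?thesis by (simp flip: mult.assoc)
  qed
  then show False using assms by (auto intro: poly_mapping_eqI)
qed

lemma B_zmul: "B (zmul m v) w = m * B v w" "B w (zmul m v) = m * B w v"
  using additive_zmul[of "\<lambda>v. B v w", OF B_add_left] additive_zmul[of "B w", OF B_add_right] by auto

lemma keys_mult:
  "Poly_Mapping.keys (f \<otimes>\<^bsub>T\<^esub> g) \<subseteq> {v + w | v w. v \<in> Poly_Mapping.keys f \<and> w \<in> Poly_Mapping.keys g}"
proof -
  have "Poly_Mapping.keys (f \<otimes>\<^bsub>T\<^esub> g) \<subseteq> (\<Union>v\<in>Poly_Mapping.keys f. \<Union>w\<in>Poly_Mapping.keys g. {v + w})"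
    unfolding mult_sum[OF finite_keys order_refl finite_keys order_refl]
    by (intro order_trans[OF keys_sum] UN_mono order_refl) (simp split: if_splits)
  then show ?thesis by blast
qed

text \<open>\<open>A J\<close> is the subalgebra generated by the \<open>X_j\<close>, \<open>j \<in> J\<close>. It contains every monomial of the
  cone spanned by the \<open>e_j\<close>, so multiplication with a suitable monomial moves any element of
  the torus over \<open>span J\<close> into \<open>A J\<close>.\<close>

definition A :: "('i \<Rightarrow> 'n) \<Rightarrow> 'i set \<Rightarrow> ('n \<Rightarrow>\<^sub>0 'c) set" where
  "A e J = carrier (cluster_algebra \<Gamma> Q e J)"

definition cone :: "('i \<Rightarrow> 'n) \<Rightarrow> 'i set \<Rightarrow> 'n set" where
  "cone e J = {v. \<forall>r. Poly_Mapping.single v r \<in> A e J}"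

lemma A_generated: "A e J = generate_ring T (range scalar \<union> (\<lambda>i. X_monomial (e i)) ` J)"
  by (simp add: A_def cluster_algebra_def T_def)

lemma A_mult: "f \<in> A e J \<Longrightarrow> g \<in> A e J \<Longrightarrow> f \<otimes>\<^bsub>T\<^esub> g \<in> A e J"
  unfolding A_generated by (rule generate_ring.eng_mult)

lemma A_add: "f \<in> A e J \<Longrightarrow> g \<in> A e J \<Longrightarrow> f + g \<in> A e J"
  unfolding A_generated using generate_ring.eng_add[of f T _ g] by simp

lemma A_scalar: "scalar r \<in> A e J"
  unfolding A_generated by (rule generate_ring.incl) simp

lemma A_zero: "0 \<in> A e J"
  using A_scalar[of 0] by (simp add: scalar_def)

lemma A_sum: "(\<And>v. v \<in> F \<Longrightarrow> f v \<in> A e J) \<Longrightarrow> (\<Sum>v\<in>F. f v) \<in> A e J"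
  by (induction F rule: infinite_finite_induct) (auto simp: A_zero A_add)

lemma A_keys:
  assumes "0 \<in> M" "\<And>v w. v \<in> M \<Longrightarrow> w \<in> M \<Longrightarrow> v + w \<in> M" "e ` J \<subseteq> M" and f: "f \<in> A e J"
  shows "Poly_Mapping.keys f \<subseteq> M"
  using f unfolding A_generated
proof (induction rule: generate_ring.induct)
  case (incl h)
  then show ?case using assms by (auto simp: scalar_def X_monomial_def split: if_splits)
next
  case (eng_add h1 h2)
  then show ?case using keys_add[of h1 h2] by auto
next
  case (eng_mult h1 h2)
  then show ?case using keys_mult[of h1 h2] assms(2) by blast
qed (use assms in \<open>auto simp: minus_T simp flip: single_one split: if_splits\<close>)

lemma cone_0: "0 \<in> cone e J"
  using A_scalar by (auto simp: cone_def scalar_def)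

lemma cone_add: assumes "v \<in> cone e J" "w \<in> cone e J" shows "v + w \<in> cone e J"
  unfolding cone_def
proof (intro CollectI allI)
  fix r
  have "Poly_Mapping.single v (Q (- B v w) * r) \<otimes>\<^bsub>T\<^esub> Poly_Mapping.single w 1 \<in> A e J"
    using assms by (intro A_mult) (auto simp: cone_def)
  then show "Poly_Mapping.single (v + w) r \<in> A e J" by (simp flip: mult.assoc)
qed

lemma cone_basis: assumes "j \<in> J" shows "e j \<in> cone e J"
  unfolding cone_def
proof (intro CollectI allI)
  fix r
  have "X_monomial (e j) \<in> A e J" unfolding A_generated using assms by (intro generate_ring.incl) auto
  then show "Poly_Mapping.single (e j) r \<in> A e J"
    unfolding single_eq_scalar by (intro A_mult A_scalar)
qed

lemma cone_sum: "(\<And>i. i \<in> F \<Longrightarrow> v i \<in> cone e J) \<Longrightarrow> (\<Sum>i\<in>F. v i) \<in> cone e J"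
  by (induction F rule: infinite_finite_induct) (auto simp: cone_0 cone_add)

text \<open>This separates the positive from the negative coefficients of \<open>v\<close>.\<close>

lemma span_cone_diff:
  assumes "v \<in> lattice_span e J"
  obtains w where "w \<in> cone e J" "v + w \<in> cone e J"
proof -
  obtain a where v: "v = (\<Sum>j\<in>J. zmul (a j) (e j))" using assms by (auto simp: lattice_span_def)
  have pos: "(\<Sum>j\<in>J. zmul (int (b j)) (e j)) \<in> cone e J" for b
  proof (rule cone_sum)
    fix j assume "j \<in> J"
    then show "zmul (int (b j)) (e j) \<in> cone e J"
      using cone_sum[of "{..<b j}" "\<lambda>_. e j"] cone_basis by (simp add: zmul_def)
  qed
  have "v + (\<Sum>j\<in>J. zmul (int (nat (- a j))) (e j)) = (\<Sum>j\<in>J. zmul (int (nat (a j))) (e j))"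
    unfolding v sum.distrib[symmetric] zmul_add[symmetric] by (intro sum.cong) auto
  then show ?thesis using that pos by metis
qed

lemma common_cone_shift:
  assumes "finite F" "F \<subseteq> lattice_span e J"
  obtains w where "w \<in> cone e J" "\<And>v. v \<in> F \<Longrightarrow> v + w \<in> cone e J"
proof -
  have "\<exists>w\<in>cone e J. \<forall>v\<in>F. v + w \<in> cone e J"
    using assms
  proof (induction F rule: finite_induct)
    case empty
    then show ?case using cone_0 by blast
  next
    case (insert u F)
    then obtain w where w: "w \<in> cone e J" "\<forall>v\<in>F. v + w \<in> cone e J" by auto
    obtain w' where w': "w' \<in> cone e J" "u + w' \<in> cone e J" using span_cone_diff insert.prems by (metis insert_subset)
    have "v + (w + w') \<in> cone e J" if "v \<in> insert u F" for v
      using that w w' cone_add[of "v + w" e J w'] cone_add[of "u + w'" e J w] by (auto simp: algebra_simps)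
    then show ?case using cone_add w w' by blast
  qed
  then show ?thesis using that by blast
qed

lemma shift_into_A:
  assumes "w \<in> cone e J" "\<And>v. v \<in> Poly_Mapping.keys f \<Longrightarrow> v + w \<in> cone e J"
  shows "f \<otimes>\<^bsub>T\<^esub> X_monomial w \<in> A e J"
proof -
  have "f \<otimes>\<^bsub>T\<^esub> X_monomial w = (\<Sum>v\<in>Poly_Mapping.keys f. Poly_Mapping.single (v + w) (Q (B v w) * Poly_Mapping.lookup f v))"
    by (subst mult_sum[of "Poly_Mapping.keys f" _ "{w}"]) (auto simp: X_monomial_def)
  also have "\<dots> \<in> A e J" using assms by (intro A_sum) (auto simp: cone_def)
  finally show ?thesis .
qed

text \<open>Expanding a fraction of torus elements by a suitable monomial makes numerator and denominator
  polynomial, so localising at the monomials first does not change the fractions.\<close>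

lemma fractions_cluster_algebra:
  assumes "fraction_field K T \<iota>"
  shows "fractions (cluster_algebra \<Gamma> Q e J) K \<iota> =
    {\<iota> a \<otimes>\<^bsub>K\<^esub> inv\<^bsub>K\<^esub> (\<iota> b) | a b. Poly_Mapping.keys a \<subseteq> lattice_span e J \<and>
      Poly_Mapping.keys b \<subseteq> lattice_span e J \<and> b \<noteq> 0}"
proof -
  interpret fraction_field K T \<iota> by fact
  have zero: "\<zero>\<^bsub>cluster_algebra \<Gamma> Q e J\<^esub> = 0" by (simp add: cluster_algebra_def quantum_torus_def)
  have keys: "Poly_Mapping.keys f \<subseteq> lattice_span e J" if "f \<in> A e J" for f
    using that by (rule A_keys[rotated 3]) (auto simp: lattice_span_0 lattice_span_add lattice_span_basis)
  have "\<exists>a'\<in>A e J. \<exists>b'\<in>A e J. b' \<noteq> 0 \<and> \<iota> a \<otimes>\<^bsub>K\<^esub> inv\<^bsub>K\<^esub> (\<iota> b) = \<iota> a' \<otimes>\<^bsub>K\<^esub> inv\<^bsub>K\<^esub> (\<iota> b')"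
    if ab: "Poly_Mapping.keys a \<subseteq> lattice_span e J" "Poly_Mapping.keys b \<subseteq> lattice_span e J" "b \<noteq> 0" for a b
  proof -
    obtain w where w: "w \<in> cone e J" "\<And>v. v \<in> Poly_Mapping.keys a \<union> Poly_Mapping.keys b \<Longrightarrow> v + w \<in> cone e J"
      using common_cone_shift[of "Poly_Mapping.keys a \<union> Poly_Mapping.keys b" e J] ab by auto
    define x where "x = (X_monomial w :: _ \<Rightarrow>\<^sub>0 'c)"
    have x: "\<iota> x \<in> carrier K" "\<iota> x \<noteq> \<zero>\<^bsub>K\<^esub>" by (auto simp: x_def)
    have b: "\<iota> b \<in> carrier K" "\<iota> b \<noteq> \<zero>\<^bsub>K\<^esub>" using ab by auto
    have "\<iota> a \<otimes>\<^bsub>K\<^esub> inv\<^bsub>K\<^esub> (\<iota> b) = (\<iota> a \<otimes>\<^bsub>K\<^esub> \<iota> x) \<otimes>\<^bsub>K\<^esub> inv\<^bsub>K\<^esub> (\<iota> b \<otimes>\<^bsub>K\<^esub> \<iota> x)"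
      using x b by (simp add: K.inv_mult K.m_assoc)
    also have "\<dots> = \<iota> (a \<otimes>\<^bsub>T\<^esub> x) \<otimes>\<^bsub>K\<^esub> inv\<^bsub>K\<^esub> (\<iota> (b \<otimes>\<^bsub>T\<^esub> x))"
      by (simp add: mult)
    finally show ?thesis
      using shift_into_A[OF w(1)] w(2) mult_monomial_nonzero[OF ab(3)] unfolding x_def by blast
  qed
  then show ?thesis using keys zero unfolding fractions_def A_def[symmetric] by auto blast+
qed

text \<open>Injectivity passes from the subalgebra to the torus because some monomial multiple of any
  torus element lies in the subalgebra.\<close>

lemma cluster_fraction_field:
  assumes basis: "Z_basis UNIV e UNIV" and cf: "is_cluster_field \<Gamma> Q e K \<iota>"
  shows "fraction_field K T \<iota>"
proof -
  have hom: "\<iota> \<in> ring_hom T K" and K: "skewfield K"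
    and inj: "inj_on \<iota> (A e UNIV)" and car: "carrier K = fractions (cluster_algebra \<Gamma> Q e UNIV) K \<iota>"
    using cf by (auto simp: is_cluster_field_def is_fraction_field_def T_def A_def skew_field_iff)
  interpret K: skewfield K by fact
  note zero = ring_hom_zero[OF hom ring_T K.ring_axioms]
  have span: "lattice_span e UNIV = UNIV" using basis by (simp add: Z_basis_def lattice_span_def)
  have nz: "\<iota> f \<noteq> \<zero>\<^bsub>K\<^esub>" if f: "f \<noteq> 0" for f
  proof
    assume *: "\<iota> f = \<zero>\<^bsub>K\<^esub>"
    obtain w where w: "w \<in> cone e UNIV" "\<And>v. v \<in> Poly_Mapping.keys f \<Longrightarrow> v + w \<in> cone e UNIV"
      using common_cone_shift[of "Poly_Mapping.keys f" e UNIV] span by auto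
    have "\<iota> (f \<otimes>\<^bsub>T\<^esub> X_monomial w) = \<zero>\<^bsub>K\<^esub>"
      using ring_hom_mult[OF hom, of f "X_monomial w"] ring_hom_closed[OF hom, of "X_monomial w"] * by simp
    then have "f \<otimes>\<^bsub>T\<^esub> X_monomial w = 0"
      using inj_onD[OF inj, of _ 0] shift_into_A[OF w] A_zero zero by simp
    then show False using mult_monomial_nonzero[OF f] by blast
  qed
  have "\<exists>a b. b \<noteq> 0 \<and> x = \<iota> a \<otimes>\<^bsub>K\<^esub> inv\<^bsub>K\<^esub> (\<iota> b)" if "x \<in> carrier K" for x
    using that unfolding car fractions_def by (auto simp: cluster_algebra_def quantum_torus_def)
  then show ?thesis
    using hom nz by unfold_locales auto
qed

end

section \<open>Bases and integrality along mutations\<close>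

lemma basis_expand:
  fixes e :: "'i::finite \<Rightarrow> 'n::ab_group_add"
  assumes "Z_basis UNIV e UNIV" obtains a where "v = (\<Sum>j\<in>UNIV. zmul (a j) (e j))"
proof -
  have "v \<in> range (\<lambda>a. \<Sum>j\<in>UNIV. zmul (a j) (e j))" using assms unfolding Z_basis_def by blast
  then show ?thesis using that by blast
qed

text \<open>The coordinates transform under mutation by an involution.\<close>

lemma Z_basis_mutation:
  fixes e :: "'i::finite \<Rightarrow> 'n::ab_group_add"
  assumes basis: "Z_basis UNIV e UNIV"
    and e': "e' k = - e k" "\<And>i. i \<noteq> k \<Longrightarrow> e' i = e i + zmul (p i) (e k)"
  shows "Z_basis UNIV e' UNIV"
proof -
  define \<phi> where "\<phi> a j = (if j = k then (\<Sum>i\<in>-{k}. a i * p i) - a k else a j)" for a :: "'i \<Rightarrow> int" and j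
  have inv: "\<phi> (\<phi> a) = a" for a
  proof -
    have "(\<Sum>i\<in>-{k}. \<phi> a i * p i) = (\<Sum>i\<in>-{k}. a i * p i)" by (intro sum.cong) (auto simp: \<phi>_def)
    then show ?thesis by (auto simp: fun_eq_iff \<phi>_def)
  qed
  have split: "(\<Sum>j\<in>UNIV. f j) = f k + (\<Sum>j\<in>-{k}. f j)" for f :: "'i \<Rightarrow> 'n"
    by (simp add: sum.remove[of UNIV k] Compl_eq_Diff_UNIV)
  have change: "(\<Sum>j\<in>UNIV. zmul (a j) (e' j)) = (\<Sum>j\<in>UNIV. zmul (\<phi> a j) (e j))" for a
  proof -
    have "(\<Sum>j\<in>-{k}. zmul (a j) (e' j)) = (\<Sum>j\<in>-{k}. zmul (a j) (e j) + zmul (a j * p j) (e k))"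
      by (intro sum.cong) (auto simp: e' zmul_plus zmul_mult)
    also have "\<dots> = (\<Sum>j\<in>-{k}. zmul (\<phi> a j) (e j)) + zmul (\<Sum>j\<in>-{k}. a j * p j) (e k)"
      by (simp add: sum.distrib zmul_sum) (simp add: \<phi>_def)
    finally show ?thesis by (simp add: split e' zmul_minus_right \<phi>_def[of a k] zmul_diff)
  qed
  have "v \<in> range (\<lambda>a. \<Sum>j\<in>UNIV. zmul (a j) (e' j))" for v
  proof -
    obtain a where "v = (\<Sum>j\<in>UNIV. zmul (a j) (e j))" using basis_expand[OF basis] .
    then have "v = (\<Sum>j\<in>UNIV. zmul (\<phi> a j) (e' j))" by (simp add: change inv)
    then show ?thesis by blast
  qed
  moreover have "a j = 0" if "(\<Sum>j\<in>UNIV. zmul (a j) (e' j)) = 0" for a j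
  proof -
    have "\<forall>j. \<phi> a j = 0" using that basis unfolding change Z_basis_def by blast
    then have "\<phi> a = (\<lambda>_. 0)" by blast
    then have "\<phi> (\<phi> a) j = \<phi> (\<lambda>_. 0) j" by simp
    then show ?thesis by (simp add: inv) (simp add: \<phi>_def)
  qed
  ultimately show ?thesis unfolding Z_basis_def by blast
qed

text \<open>These two properties of a seed imply that \<open>d{v, w}\<close> and \<open>{v, e\<^sub>k} d\<^sub>k\<close> are integers for all \<open>v\<close> and
  \<open>w\<close>, and they are inherited by mutated seeds.\<close>

definition integral_basis :: "('i::finite, 'n::ab_group_add) fixed_data \<Rightarrow> ('i \<Rightarrow> 'n) \<Rightarrow> bool" where
  "integral_basis \<Gamma> e \<longleftrightarrow> Z_basis UNIV e UNIV \<and> (\<forall>i j. form \<Gamma> (e i) (e j) * of_nat (mlt \<Gamma> j) \<in> \<int>)"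

context
  fixes \<Gamma> :: "('i::finite, 'n::ab_group_add) fixed_data"
  assumes fixed: "is_fixed_data \<Gamma>"
begin

lemma form_add: "form \<Gamma> (x + y) z = form \<Gamma> x z + form \<Gamma> y z" "form \<Gamma> x (y + z) = form \<Gamma> x y + form \<Gamma> x z"
  using fixed unfolding is_fixed_data_def by blast+

lemma form_skew: "form \<Gamma> x y = - form \<Gamma> y x"
  using fixed unfolding is_fixed_data_def by blast

lemma form_zmul: "form \<Gamma> (zmul m x) y = of_int m * form \<Gamma> x y" "form \<Gamma> y (zmul m x) = of_int m * form \<Gamma> y x"
  using additive_zmul[of "\<lambda>x. form \<Gamma> x y"] additive_zmul[of "form \<Gamma> y"] form_add by auto

lemma form_minus: "form \<Gamma> (- x) y = - form \<Gamma> x y" "form \<Gamma> y (- x) = - form \<Gamma> y x"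
  using form_zmul[where m="-1"] by auto

lemma form_self: "form \<Gamma> x x = 0"
  using form_skew[of x x] by simp

lemma mlt_pos: "0 < mlt \<Gamma> i"
  using fixed unfolding is_fixed_data_def by blast

lemma Lcm_mlt: obtains n where "Lcm (range (mlt \<Gamma>)) = n * mlt \<Gamma> i" "0 < n"
proof -
  have "mlt \<Gamma> i dvd Lcm (range (mlt \<Gamma>))" by (intro dvd_Lcm) simp
  moreover have "Lcm (range (mlt \<Gamma>)) \<noteq> 0"
    using mlt_pos by (simp add: Lcm_0_iff) (metis less_irrefl rangeE)
  ultimately show ?thesis using that by (metis dvd_def mult.commute mult_is_0 not_gr_zero)
qed

lemma form_mlt_integral:
  assumes "integral_basis \<Gamma> e"
  shows "form \<Gamma> v (e k) * of_nat (mlt \<Gamma> k) \<in> \<int>"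
proof -
  obtain a where v: "v = (\<Sum>j\<in>UNIV. zmul (a j) (e j))" using assms basis_expand unfolding integral_basis_def by blast
  have "form \<Gamma> v (e k) * of_nat (mlt \<Gamma> k) = (\<Sum>j\<in>UNIV. of_int (a j) * (form \<Gamma> (e j) (e k) * of_nat (mlt \<Gamma> k)))"
    unfolding v additive_sum_zmul[of "\<lambda>x. form \<Gamma> x (e k)", OF form_add(1)] by (simp add: sum_distrib_right mult.assoc)
  also have "\<dots> \<in> \<int>" using assms by (intro Ints_sum Ints_mult[OF Ints_of_int]) (auto simp: integral_basis_def)
  finally show ?thesis .
qed

lemma form_Lcm_integral:
  assumes "integral_basis \<Gamma> e"
  shows "of_nat (Lcm (range (mlt \<Gamma>))) * form \<Gamma> v w \<in> \<int>"
proof -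
  obtain a where w: "w = (\<Sum>j\<in>UNIV. zmul (a j) (e j))" using assms basis_expand unfolding integral_basis_def by blast
  have "of_nat (Lcm (range (mlt \<Gamma>))) * form \<Gamma> v (e j) \<in> \<int>" for j
  proof -
    obtain n where "Lcm (range (mlt \<Gamma>)) = n * mlt \<Gamma> j" using Lcm_mlt .
    then have "of_nat (Lcm (range (mlt \<Gamma>))) * form \<Gamma> v (e j) = of_nat n * (form \<Gamma> v (e j) * of_nat (mlt \<Gamma> j))" by simp
    then show ?thesis using form_mlt_integral[OF assms] by (metis Ints_mult Ints_of_nat)
  qed
  then have "(\<Sum>j\<in>UNIV. of_int (a j) * (of_nat (Lcm (range (mlt \<Gamma>))) * form \<Gamma> v (e j))) \<in> \<int>"
    by (intro Ints_sum Ints_mult[OF Ints_of_int])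
  also have "(\<Sum>j\<in>UNIV. of_int (a j) * (of_nat (Lcm (range (mlt \<Gamma>))) * form \<Gamma> v (e j))) = of_nat (Lcm (range (mlt \<Gamma>))) * form \<Gamma> v w"
    unfolding w additive_sum_zmul[of "form \<Gamma> v", OF form_add(2)] by (simp add: sum_distrib_left mult.left_commute)
  finally show ?thesis .
qed

lemma exch_exact:
  assumes "integral_basis \<Gamma> e"
  shows "of_int (exch \<Gamma> e i k) = form \<Gamma> (e i) (e k) * of_nat (mlt \<Gamma> k)"
  using form_mlt_integral[OF assms, of "e i" k] unfolding exch_def by (metis Ints_cases floor_of_int)

text \<open>By skew-symmetry \<open>\<epsilon>\<^sub>j\<^sub>k d\<^sub>j = - d\<^sub>k \<epsilon>\<^sub>k\<^sub>j\<close>, so \<open>d\<^sub>j e\<^sub>j\<close> changes by a multiple of \<open>d\<^sub>k e\<^sub>k\<close>.\<close>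

lemma integral_basis_mutation:
  assumes ib: "integral_basis \<Gamma> e"
  shows "integral_basis \<Gamma> (seed_mutation \<Gamma> k e)"
proof -
  let ?e' = "seed_mutation \<Gamma> k e"
  have basis: "Z_basis UNIV ?e' UNIV"
    by (rule Z_basis_mutation[of e _ k]) (use ib in \<open>auto simp: integral_basis_def seed_mutation_def\<close>)
  have int: "form \<Gamma> v (?e' j) * of_nat (mlt \<Gamma> j) \<in> \<int>" for v j
  proof (cases "j = k \<or> exch \<Gamma> e j k \<le> 0")
    case True
    then show ?thesis
      using form_mlt_integral[OF ib, of v j] by (auto simp: seed_mutation_def form_minus max_def)
  next
    case False
    then have "form \<Gamma> v (?e' j) * of_nat (mlt \<Gamma> j) =
        form \<Gamma> v (e j) * of_nat (mlt \<Gamma> j) + (form \<Gamma> (e j) (e k) * of_nat (mlt \<Gamma> k)) * form \<Gamma> v (e k) * of_nat (mlt \<Gamma> j)"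
      using exch_exact[OF ib, of j k]
      by (simp add: seed_mutation_def form_add form_zmul max_def distrib_right)
    also have "\<dots> = form \<Gamma> v (e j) * of_nat (mlt \<Gamma> j) - (form \<Gamma> (e k) (e j) * of_nat (mlt \<Gamma> j)) * (form \<Gamma> v (e k) * of_nat (mlt \<Gamma> k))"
      using form_skew[of "e j" "e k"] by simp
    also have "\<dots> \<in> \<int>"
      by (intro Ints_diff Ints_mult form_mlt_integral[OF ib])
    finally show ?thesis .
  qed
  then show ?thesis using basis by (simp add: integral_basis_def)
qed

lemma reachable_integral_basis:
  assumes "seed_reachable \<Gamma> e0 e c" "is_seed \<Gamma> e0"
  shows "integral_basis \<Gamma> e"
  using assms(1)
proof induction
  case initial
  then show ?case using assms(2) by (simp add: is_seed_def integral_basis_def)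
qed (rule integral_basis_mutation)

lemma torusI:
  assumes "integral_basis \<Gamma> e" "Q 0 = 1" "\<And>a b. Q (a + b) = Q a * Q b"
  shows "torus \<Gamma> Q"
proof
  have exact: "of_int (q_exponent \<Gamma> (form \<Gamma> v w)) = of_nat (Lcm (range (mlt \<Gamma>))) * form \<Gamma> v w" for v w
    using form_Lcm_integral[OF assms(1), of v w] unfolding q_exponent_def by (metis Ints_cases floor_of_int)
  fix u v w
  show "q_exponent \<Gamma> (form \<Gamma> (u + v) w) = q_exponent \<Gamma> (form \<Gamma> u w) + q_exponent \<Gamma> (form \<Gamma> v w)"
  proof -
    have "(of_int (q_exponent \<Gamma> (form \<Gamma> (u + v) w)) :: rat) = of_int (q_exponent \<Gamma> (form \<Gamma> u w) + q_exponent \<Gamma> (form \<Gamma> v w))"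
      unfolding of_int_add exact by (simp only: form_add distrib_left)
    then show ?thesis by (simp only: of_int_eq_iff)
  qed
  show "q_exponent \<Gamma> (form \<Gamma> v w) = - q_exponent \<Gamma> (form \<Gamma> w v)"
  proof -
    have "(of_int (q_exponent \<Gamma> (form \<Gamma> v w)) :: rat) = of_int (- q_exponent \<Gamma> (form \<Gamma> w v))"
      unfolding of_int_minus exact by (simp add: form_skew[of v w])
    then show ?thesis by (simp only: of_int_eq_iff)
  qed
qed (use assms in auto)

end

text \<open>Coordinates with respect to a basis are unique, hence additive; the one of \<open>e\<^sub>k\<close> will grade the torus.\<close>

lemma basis_degree:
  fixes e :: "'i::finite \<Rightarrow> 'n::ab_group_add"
  assumes "Z_basis UNIV e UNIV"
  shows "\<exists>deg :: 'n \<Rightarrow> int. (\<forall>v w. deg (v + w) = deg v + deg w) \<and> deg (e k) = 1 \<and>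
    (\<forall>v. deg v = 0 \<longleftrightarrow> v \<in> lattice_span e (- {k}))"
proof -
  let ?s = "\<lambda>a. \<Sum>j\<in>UNIV. zmul (a j) (e j)"
  have ex: "\<exists>a. v = ?s a" for v using basis_expand[OF assms] by metis
  have uniq: "a = b" if "?s a = ?s b" for a b
  proof -
    have "?s (\<lambda>j. a j - b j) = 0" using that by (simp add: zmul_diff sum_subtractf)
    then have "\<forall>j\<in>UNIV. a j - b j = 0" using assms unfolding Z_basis_def by fast
    then show ?thesis by (simp add: fun_eq_iff)
  qed
  define coord where "coord v = (SOME a. v = ?s a)" for v
  have coord: "v = ?s (coord v)" for v unfolding coord_def by (rule someI_ex[OF ex])
  have coord_eq: "coord (?s a) = a" for a using uniq coord by metis
  have split: "?s a = zmul (a k) (e k) + (\<Sum>j\<in>-{k}. zmul (a j) (e j))" for a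
    by (simp add: sum.remove[of UNIV k] Compl_eq_Diff_UNIV)
  show ?thesis
  proof (intro exI[of _ "\<lambda>v. coord v k"] conjI allI)
    fix v w
    have "v + w = ?s (\<lambda>j. coord v j + coord w j)"
      using coord[of v] coord[of w] by (simp add: zmul_add sum.distrib)
    then show "coord (v + w) k = coord v k + coord w k" by (simp add: coord_eq)
    show "coord v k = 0 \<longleftrightarrow> v \<in> lattice_span e (- {k})"
    proof
      assume "coord v k = 0"
      then have "v = (\<Sum>j\<in>-{k}. zmul (coord v j) (e j))" using coord[of v] by (simp add: split)
      then show "v \<in> lattice_span e (- {k})" unfolding lattice_span_def by blast
    next
      assume "v \<in> lattice_span e (- {k})"
      then obtain a where a: "v = (\<Sum>j\<in>-{k}. zmul (a j) (e j))" by (auto simp: lattice_span_def)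
      have "(\<Sum>j\<in>-{k}. zmul ((a(k := 0)) j) (e j)) = v" unfolding a by (intro sum.cong) auto
      then have "?s (a(k := 0)) = v" by (simp add: split)
      then have "coord v = a(k := 0)" using coord_eq by metis
      then show "coord v k = 0" by simp
    qed
  next
    have "?s (\<lambda>j. if j = k then 1 else 0) = e k" by (simp add: if_distrib[of "\<lambda>m. zmul m _"] cong: if_cong)
    then have "coord (e k) = (\<lambda>j. if j = k then 1 else 0)" using coord_eq by metis
    then show "coord (e k) k = 1" by simp
  qed
qed

section \<open>Fraction fields of quantum tori\<close>

text \<open>A skew field of fractions of a torus; \<open>X v\<close> is the image of the monomial \<open>X\<^sup>v\<close>, and \<open>s r\<close>
  that of the scalar \<open>r\<close>.\<close>

locale torus_field = torus \<Gamma> Q B T + I: fraction_field K T \<iota>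
  for \<Gamma> :: "('i::finite, 'n::ab_group_add) fixed_data" and Q :: "int \<Rightarrow> 'c::comm_ring_1" and B T
    and K :: "'a ring" (structure) and \<iota> :: "('n \<Rightarrow>\<^sub>0 'c) \<Rightarrow> 'a"
begin

definition X :: "'n \<Rightarrow> 'a" where "X v = \<iota> (X_monomial v)"

definition s :: "'c \<Rightarrow> 'a" where "s r = \<iota> (scalar r)"

lemma iota_closed [simp]: "\<iota> f \<in> carrier K"
  by simp

lemma iota_mult: "\<iota> (f \<otimes>\<^bsub>T\<^esub> g) = \<iota> f \<otimes> \<iota> g"
  using I.mult by simp

lemma iota_add: "\<iota> (f + g) = \<iota> f \<oplus> \<iota> g"
  using I.add[of f g] by simp

lemma iota_1 [simp]: "\<iota> 1 = \<one>"
  using I.one by simp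

lemma iota_eq_0 [simp]: "\<iota> f = \<zero> \<longleftrightarrow> f = 0"
  using I.zero_iff[of f] by simp

lemma iota_0 [simp]: "\<iota> 0 = \<zero>"
  by (simp only: iota_eq_0)

lemma X_closed [simp]: "X v \<in> carrier K" by (simp add: X_def)

lemma s_closed [simp]: "s r \<in> carrier K" by (simp add: s_def)

lemma X_nonzero [simp]: "X v \<noteq> \<zero>" by (simp add: X_def)

lemma scalar_add: "scalar (a + b) = scalar a + scalar b"
  by (simp add: scalar_def single_add)

lemma s_hom: "s 1 = \<one>" "s (a * b) = s a \<otimes> s b" "s (a + b) = s a \<oplus> s b"
proof -
  show "s 1 = \<one>" by (simp add: s_def scalar_def)
  have "scalar a \<otimes>\<^bsub>T\<^esub> scalar b = scalar (a * b)" by (simp add: scalar_def)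
  then show "s (a * b) = s a \<otimes> s b" unfolding s_def by (metis iota_mult)
  show "s (a + b) = s a \<oplus> s b" unfolding s_def scalar_add by (rule iota_add)
qed

lemma s_eq_0 [simp]: "s r = \<zero> \<longleftrightarrow> r = 0"
proof -
  have "scalar r = (0 :: 'n \<Rightarrow>\<^sub>0 'c) \<longleftrightarrow> r = 0"
    unfolding scalar_def by (metis lookup_single_eq lookup_zero single_zero)
  then show ?thesis by (simp add: s_def)
qed

lemma s_inj: "s a = s b \<longleftrightarrow> a = b"
proof
  assume "s a = s b"
  then have "scalar a = (scalar b :: 'n \<Rightarrow>\<^sub>0 'c)" using I.inj[of "scalar a" "scalar b"] by (simp add: s_def)
  then show "a = b" unfolding scalar_def by (metis lookup_single_eq)
qed simp

lemma s_central: "I.K.central (s r)"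
  unfolding I.K.central_def
proof (intro conjI ballI)
  fix x assume x: "x \<in> carrier K"
  from I.surj[OF x] obtain a b where ab: "b \<noteq> 0" "x = \<iota> a \<otimes> inv (\<iota> b)" by auto
  have comm: "s r \<otimes> \<iota> f = \<iota> f \<otimes> s r" for f
    unfolding s_def iota_mult[symmetric] by (simp only: scalar_commute)
  have nz: "\<iota> b \<noteq> \<zero>" using ab by simp
  have ci: "inv (\<iota> b) \<otimes> s r = s r \<otimes> inv (\<iota> b)"
    using nz by (intro I.K.commute_inv) (simp_all add: comm)
  have "s r \<otimes> x = s r \<otimes> \<iota> a \<otimes> inv (\<iota> b)" using ab nz by (simp add: I.K.m_assoc)
  also have "\<dots> = \<iota> a \<otimes> (s r \<otimes> inv (\<iota> b))" unfolding comm using nz by (simp add: I.K.m_assoc)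
  also have "\<dots> = \<iota> a \<otimes> inv (\<iota> b) \<otimes> s r" unfolding ci[symmetric] using nz by (simp add: I.K.m_assoc)
  finally show "s r \<otimes> x = x \<otimes> s r" by (simp add: ab)
qed simp

lemma iota_single: "\<iota> (Poly_Mapping.single v r) = s r \<otimes> X v"
  unfolding single_eq_scalar s_def X_def by (rule iota_mult)

lemma X_0 [simp]: "X 0 = \<one>"
  by (simp add: X_def X_monomial_def)

lemma X_mult: "X v \<otimes> X w = s (Q (B v w)) \<otimes> X (v + w)"
proof -
  have "X v \<otimes> X w = \<iota> (Poly_Mapping.single (v + w) (Q (B v w)))"
    unfolding X_def X_monomial_def iota_mult[symmetric] by simp
  then show ?thesis by (simp only: iota_single)
qed

lemma X_mult_orthogonal: "B v w = 0 \<Longrightarrow> X v \<otimes> X w = X (v + w)"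
  by (simp add: X_mult s_hom)

lemma X_commute: "X v \<otimes> X w = s (Q (2 * B v w)) \<otimes> (X w \<otimes> X v)"
proof -
  have "s (Q (2 * B v w)) \<otimes> (X w \<otimes> X v) = s (Q (2 * B v w) * Q (B w v)) \<otimes> X (v + w)"
    unfolding X_mult[of w v] s_hom by (simp add: I.K.m_assoc add.commute)
  also have "Q (2 * B v w) * Q (B w v) = Q (B v w)"
    unfolding Q_add[symmetric] B_antisym[of w v] by simp
  finally show ?thesis by (simp add: X_mult)
qed

lemma X_pow_nat: "X v [^] (n::nat) = X (zmul (int n) v)"
proof (induction n)
  case (Suc n)
  have "X v [^] Suc n = X (zmul (int n) v) \<otimes> X v" using Suc by simp
  also have "\<dots> = X (zmul (int n) v + v)" by (rule X_mult_orthogonal) (simp add: B_zmul)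
  also have "zmul (int n) v + v = zmul (int (Suc n)) v" by (metis add.commute of_nat_Suc zmul_add_one)
  finally show ?case .
qed simp

lemma X_inverse: "inv (X v) = X (- v)"
  using X_mult_orthogonal[of v "- v"] by (intro I.K.inv_unique_right) auto

lemma X_pow_int: "X v [^] (m::int) = X (zmul m v)"
  using X_pow_nat[of v] X_inverse by (cases m rule: int_cases2) (simp_all add: int_pow_int I.K.int_pow_minus)

end

section \<open>The embedding into twisted Laurent series\<close>

text \<open>The three conditions characterise \<open>deg v\<close> as the coefficient of \<open>e\<^sub>k\<close> in \<open>v\<close>, which grades the torus.\<close>

locale graded_torus_field = torus_field \<Gamma> q_monomial B T K \<iota>
  for \<Gamma> :: "('i::finite, 'n::ab_group_add) fixed_data" and B
    and T :: "('n \<Rightarrow>\<^sub>0 'c::comm_ring_1 qlaurent) ring"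
    and K :: "'a ring" (structure) and \<iota> +
  fixes e :: "'i \<Rightarrow> 'n" and k :: 'i and deg :: "'n \<Rightarrow> int"
  assumes deg_add: "deg (v + w) = deg v + deg w"
    and deg_ek: "deg (e k) = 1"
    and deg_0: "deg v = 0 \<longleftrightarrow> v \<in> lattice_span e (- {k})"
begin

definition x :: 'a where "x = X (e k)"

definition D :: "'a ring" where "D = coefficient_field \<Gamma> e K \<iota> k"

definition \<tau> :: "int \<Rightarrow> 'a \<Rightarrow> 'a" where "\<tau> m a = x [^] m \<otimes> a \<otimes> x [^] (- m)"

definition homog :: "int \<Rightarrow> ('n \<Rightarrow>\<^sub>0 'c qlaurent) set" where
  "homog m = {f. \<forall>v\<in>Poly_Mapping.keys f. deg v = m}"

definition part :: "int \<Rightarrow> ('n \<Rightarrow>\<^sub>0 'c qlaurent) \<Rightarrow> ('n \<Rightarrow>\<^sub>0 'c qlaurent)" where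
  "part m f = Abs_poly_mapping (\<lambda>v. if deg v = m then Poly_Mapping.lookup f v else 0)"

lemma deg_minus: "deg (- v) = - deg v"
  using deg_add[of v "- v"] deg_add[of 0 0] by simp

lemma deg_zero [simp]: "deg 0 = 0"
  using deg_add[of 0 0] by simp

lemma deg_zmul: "deg (zmul m v) = m * deg v"
  using additive_zmul[of deg, OF deg_add] by simp

lemma x_closed [simp]: "x \<in> carrier K" and x_nonzero [simp]: "x \<noteq> \<zero>"
  by (simp_all add: x_def)

lemma x_pow: "x [^] (m::int) = X (zmul m (e k))"
  by (simp add: x_def X_pow_int)

lemma lookup_part: "Poly_Mapping.lookup (part m f) v = (if deg v = m then Poly_Mapping.lookup f v else 0)"
proof -
  have "finite {v. (if deg v = m then Poly_Mapping.lookup f v else 0) \<noteq> 0}"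
    by (rule finite_subset[of _ "Poly_Mapping.keys f"]) (auto simp: in_keys_iff)
  then show ?thesis by (simp add: part_def)
qed

lemma part_add: "part m (f + g) = part m f + part m g"
  by (rule poly_mapping_eqI) (simp add: lookup_part lookup_add)

lemma part_homog: "f \<in> homog n \<Longrightarrow> part m f = (if m = n then f else 0)"
  by (rule poly_mapping_eqI) (auto simp: lookup_part homog_def in_keys_iff)

lemma part_in_homog: "part m f \<in> homog m"
  by (auto simp: homog_def in_keys_iff lookup_part split: if_splits)

lemma part_nonzero: assumes "f \<noteq> 0" obtains m where "part m f \<noteq> 0"
proof -
  obtain v where "Poly_Mapping.lookup f v \<noteq> 0" using assms by (metis lookup_zero poly_mapping_eqI)
  then have "part (deg v) f \<noteq> 0" by (metis lookup_part lookup_zero)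
  then show ?thesis using that by blast
qed

lemma homog_single [simp]: "Poly_Mapping.single v r \<in> homog (deg v)"
  by (simp add: homog_def)

lemma homog_1 [simp]: "1 \<in> homog 0"
  by (simp add: homog_def)

lemma homog_add: "f \<in> homog m \<Longrightarrow> g \<in> homog m \<Longrightarrow> f + g \<in> homog m"
  using keys_add[of f g] by (auto simp: homog_def)

lemma homog_mult: "f \<in> homog m \<Longrightarrow> g \<in> homog n \<Longrightarrow> f \<otimes>\<^bsub>T\<^esub> g \<in> homog (m + n)"
  using keys_mult[of f g] by (auto simp: homog_def deg_add)

lemma homog_minus: "f \<in> homog m \<Longrightarrow> - f \<in> homog m"
  by (simp add: homog_def in_keys_iff)

lemma part_mult: 
  assumes "a \<in> homog 0" shows "part m (a \<otimes>\<^bsub>T\<^esub> f) = a \<otimes>\<^bsub>T\<^esub> part m f"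
proof (induction f rule: poly_mapping_additive_induct)
  case (single v r)
  have "a \<otimes>\<^bsub>T\<^esub> Poly_Mapping.single v r \<in> homog (deg v)" using homog_mult[OF assms homog_single] by simp
  then show ?case
    using T.r_null[of a] by (cases "m = deg v") (simp_all add: part_homog[OF homog_single] part_homog)
qed (simp add: part_add mult_add_right)

lemma D_eq: "D = K\<lparr>carrier := {a \<otimes> inv b | a b. a \<in> \<iota> ` homog 0 \<and> b \<in> \<iota> ` homog 0 \<and> b \<noteq> \<zero>}\<rparr>"
proof -
  have "Poly_Mapping.keys a \<subseteq> lattice_span e (- {k}) \<longleftrightarrow> a \<in> homog 0" for a :: "'n \<Rightarrow>\<^sub>0 'c qlaurent"
    unfolding homog_def using deg_0 by auto
  then have "fractions (cluster_algebra \<Gamma> q_monomial e (- {k})) K \<iota> =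
      {a \<otimes> inv b | a b. a \<in> \<iota> ` homog 0 \<and> b \<in> \<iota> ` homog 0 \<and> b \<noteq> \<zero>}"
    unfolding fractions_cluster_algebra[OF I.fraction_field_axioms] by fastforce
  then show ?thesis by (simp add: D_def coefficient_field_def)
qed

lemma D_ops [simp]: "mult D = mult K" "add D = add K" "one D = one K" "zero D = zero K"
  by (simp_all add: D_eq)

lemma D_I: "a \<in> homog 0 \<Longrightarrow> b \<in> homog 0 \<Longrightarrow> b \<noteq> 0 \<Longrightarrow> \<iota> a \<otimes> inv (\<iota> b) \<in> carrier D"
  unfolding D_eq by (simp, intro exI conjI) (auto simp: iota_eq_0)

lemma D_E: 
  assumes "d \<in> carrier D"
  obtains a b where "a \<in> homog 0" "b \<in> homog 0" "b \<noteq> 0" "d = \<iota> a \<otimes> inv (\<iota> b)"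
  using assms unfolding D_eq by auto

lemma D_iota: "a \<in> homog 0 \<Longrightarrow> \<iota> a \<in> carrier D"
  using D_I[of a 1] by simp

lemma D_closed [simp]: "d \<in> carrier D \<Longrightarrow> d \<in> carrier K"
  by (erule D_E) simp

text \<open>If \<open>a d = b c\<close> with \<open>a\<close> and \<open>b\<close> of degree zero, every homogeneous part of \<open>d\<close> and \<open>c\<close> again
  satisfies this equation, and multiplication by a power of \<open>X_k\<close> makes these parts of degree
  zero: the Ore condition descends.\<close>

lemma skewfield_D: "skewfield D"
  unfolding D_eq
proof (rule I.K.fractions_of_Ore_subring)
  have neg: "\<ominus> \<iota> a = \<iota> (- a)" for a
    by (rule I.K.minus_equality) (simp_all flip: iota_add)
  show "subring (\<iota> ` homog 0) K"
  proof (rule I.K.subringI)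
    show "\<one> \<in> \<iota> ` homog 0" using homog_1 iota_1 by (metis imageI)
  next
    fix y assume "y \<in> \<iota> ` homog 0"
    then show "\<ominus> y \<in> \<iota> ` homog 0" using neg homog_minus by (metis (no_types, lifting) image_iff)
  next
    fix y z assume "y \<in> \<iota> ` homog 0" "z \<in> \<iota> ` homog 0"
    then obtain a b where "a \<in> homog 0" "b \<in> homog 0" "y = \<iota> a" "z = \<iota> b" by blast
    then show "y \<otimes> z \<in> \<iota> ` homog 0" "y \<oplus> z \<in> \<iota> ` homog 0"
      using homog_mult[of a 0 b 0] homog_add[of a 0 b] by (auto simp flip: iota_mult iota_add)
  qed auto
  fix y z assume "y \<in> \<iota> ` homog 0" "z \<in> \<iota> ` homog 0" "z \<noteq> \<zero>"
  then obtain a b where ab: "a \<in> homog 0" "b \<in> homog 0" "y = \<iota> a" "z = \<iota> b" "b \<noteq> 0" by auto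
  have "\<exists>c d. d \<noteq> 0 \<and> a \<otimes>\<^bsub>T\<^esub> d = b \<otimes>\<^bsub>T\<^esub> c"
    by (rule I.left_fraction[of a b]) (use ab in auto)
  then obtain c d where cd: "d \<noteq> 0" "a \<otimes>\<^bsub>T\<^esub> d = b \<otimes>\<^bsub>T\<^esub> c" by blast
  obtain m where m: "part m d \<noteq> 0" using part_nonzero[OF cd(1)] .
  \<comment> \<open>the power of \<open>X_k\<close> that moves degree \<open>m\<close> to degree \<open>0\<close>\<close>
  define u where "u = (X_monomial (zmul (- m) (e k)) :: 'n \<Rightarrow>\<^sub>0 'c qlaurent)"
  have u: "u \<in> homog (- m)" using homog_single[of "zmul (- m) (e k)" 1] by (simp add: u_def X_monomial_def deg_minus deg_zmul deg_ek)
  have "a \<otimes>\<^bsub>T\<^esub> part m d = b \<otimes>\<^bsub>T\<^esub> part m c" using part_mult ab cd by metis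
  then have "a \<otimes>\<^bsub>T\<^esub> (part m d \<otimes>\<^bsub>T\<^esub> u) = b \<otimes>\<^bsub>T\<^esub> (part m c \<otimes>\<^bsub>T\<^esub> u)" by (simp flip: T.m_assoc)
  then have "y \<otimes> \<iota> (part m d \<otimes>\<^bsub>T\<^esub> u) = z \<otimes> \<iota> (part m c \<otimes>\<^bsub>T\<^esub> u)" using ab by (simp flip: iota_mult)
  moreover have "part m c \<otimes>\<^bsub>T\<^esub> u \<in> homog 0" "part m d \<otimes>\<^bsub>T\<^esub> u \<in> homog 0"
    using homog_mult[OF part_in_homog[of m] u] by simp_all
  moreover have "part m d \<otimes>\<^bsub>T\<^esub> u \<noteq> 0" using mult_monomial_nonzero[OF m] by (simp add: u_def)
  ultimately show "\<exists>c\<in>\<iota> ` homog 0. \<exists>d\<in>\<iota> ` homog 0. d \<noteq> \<zero> \<and> y \<otimes> d = z \<otimes> c"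
    using iota_eq_0 by blast
qed

sublocale D: skewfield D by (rule skewfield_D)

lemma conj_cancel [simp]:
  assumes "a \<in> carrier K"
  shows "x [^] (- m :: int) \<otimes> (x [^] m \<otimes> a) = a" "x [^] m \<otimes> (x [^] (- m) \<otimes> a) = a"
  using assms by (simp_all add: I.K.int_pow_minus)

lemma \<tau>_mult: "a \<in> carrier K \<Longrightarrow> b \<in> carrier K \<Longrightarrow> \<tau> m (a \<otimes> b) = \<tau> m a \<otimes> \<tau> m b"
  by (simp add: \<tau>_def I.K.m_assoc)

lemma \<tau>_one: "\<tau> m \<one> = \<one>"
  by (simp add: \<tau>_def I.K.int_pow_minus)

lemma \<tau>_homog: assumes "a \<in> homog 0" obtains b where "b \<in> homog 0" "\<tau> m (\<iota> a) = \<iota> b"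
proof
  let ?u = "\<lambda>m. X_monomial (zmul m (e k)) :: 'n \<Rightarrow>\<^sub>0 'c qlaurent"
  have u: "?u m \<in> homog m" for m
    using homog_single[of "zmul m (e k)" 1] by (simp add: X_monomial_def deg_zmul deg_ek)
  show "\<tau> m (\<iota> a) = \<iota> (?u m \<otimes>\<^bsub>T\<^esub> a \<otimes>\<^bsub>T\<^esub> ?u (- m))" by (simp only: \<tau>_def x_pow X_def iota_mult)
  show "?u m \<otimes>\<^bsub>T\<^esub> a \<otimes>\<^bsub>T\<^esub> ?u (- m) \<in> homog 0" using homog_mult[OF homog_mult[OF u[of m] assms] u[of "- m"]] by simp
qed

text \<open>Conjugation by \<open>X_k\<close> preserves the part of degree zero of the torus, hence its fractions.\<close>

sublocale twisted_series D \<tau>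
proof
  fix m n :: int
  show "\<tau> m \<in> ring_hom D D"
  proof (rule ring_hom_memI)
    fix d assume d: "d \<in> carrier D"
    then obtain a b where ab: "a \<in> homog 0" "b \<in> homog 0" "b \<noteq> 0" "d = \<iota> a \<otimes> inv (\<iota> b)" by (rule D_E)
    obtain a' b' where ab': "a' \<in> homog 0" "\<tau> m (\<iota> a) = \<iota> a'" "b' \<in> homog 0" "\<tau> m (\<iota> b) = \<iota> b'"
      using \<tau>_homog ab by metis
    have "\<tau> m d \<otimes> \<iota> b' = \<tau> m (d \<otimes> \<iota> b)" using d ab'(4)[symmetric] by (simp add: \<tau>_mult)
    also have "\<dots> = \<iota> a'" using ab ab' by simp
    finally have "\<tau> m d \<otimes> \<iota> b' = \<iota> a'" .
    moreover have b': "b' \<noteq> 0"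
    proof
      assume "b' = 0"
      then have "\<tau> m (\<iota> b) = \<zero>" using ab'(4) by simp
      then show False using ab(3) by (simp add: \<tau>_def)
    qed
    ultimately have "\<tau> m d = \<iota> a' \<otimes> inv (\<iota> b')" using d by (subst I.K.eq_divide) (simp_all add: \<tau>_def)
    then show "\<tau> m d \<in> carrier D" using D_I ab' b' by simp
    fix d' assume "d' \<in> carrier D"
    then show "\<tau> m (d \<otimes>\<^bsub>D\<^esub> d') = \<tau> m d \<otimes>\<^bsub>D\<^esub> \<tau> m d'" "\<tau> m (d \<oplus>\<^bsub>D\<^esub> d') = \<tau> m d \<oplus>\<^bsub>D\<^esub> \<tau> m d'"
      using d by (simp_all add: \<tau>_mult) (simp add: \<tau>_def I.K.l_distr I.K.r_distr)
  qed (simp add: \<tau>_one)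
  fix d assume d: "d \<in> carrier D"
  then show "\<tau> 0 d = d" by (simp add: \<tau>_def)
  have "- (m + n) = - n + - m" by simp
  then show "\<tau> (m + n) d = \<tau> m (\<tau> n d)"
    using d by (simp only: \<tau>_def I.K.int_pow_add[of x, OF x_closed x_nonzero]) (simp add: I.K.m_assoc)
qed

sublocale L: skewfield L by (rule skewfield_L)

abbreviation mono :: "'a \<Rightarrow> int \<Rightarrow> int \<Rightarrow> 'a" where "mono a m \<equiv> laurent_monomial D a m"

lemma L_eq: "laurent_field \<Gamma> e K \<iota> k = L"
  by (simp add: laurent_field_def D_def \<tau>_def[abs_def] x_def X_def)

text \<open>On the torus the embedding reads off the coefficient of \<open>X_k\<^sup>m\<close>.\<close>

definition expand :: "('n \<Rightarrow>\<^sub>0 'c qlaurent) \<Rightarrow> int \<Rightarrow> 'a" where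
  "expand f = (\<lambda>m. \<iota> (part m f) \<otimes> x [^] (- m))"

lemma homog_coeff: assumes "f \<in> homog m" shows "\<iota> f \<otimes> x [^] (- m) \<in> carrier D"
proof -
  let ?u = "X_monomial (zmul (- m) (e k)) :: 'n \<Rightarrow>\<^sub>0 'c qlaurent"
  have u: "?u \<in> homog (- m)"
    using homog_single[of "zmul (- m) (e k)" 1] by (simp add: X_monomial_def deg_minus deg_zmul deg_ek)
  have "\<iota> f \<otimes> x [^] (- m) = \<iota> (f \<otimes>\<^bsub>T\<^esub> ?u)" by (simp only: x_pow X_def iota_mult)
  then show ?thesis using D_iota homog_mult[OF assms u] by simp
qed

lemma expand_homog: 
  assumes "f \<in> homog m" shows "expand f = mono (\<iota> f \<otimes> x [^] (- m)) m"
  by (rule ext) (simp add: expand_def part_homog[OF assms] laurent_monomial_def)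

lemma expand_add: "expand (f + g) = expand f \<oplus>\<^bsub>L\<^esub> expand g"
  by (rule ext) (simp add: expand_def add_L part_add iota_add I.K.l_distr)

lemma expand_closed: "expand f \<in> carrier L"
proof (induction f rule: poly_mapping_additive_induct)
  case (single v r)
  show ?case using expand_homog[OF homog_single] homog_coeff[OF homog_single] monomial_closed by metis
qed (simp add: expand_add)

lemma expand_mult: "expand (f \<otimes>\<^bsub>T\<^esub> g) = expand f \<otimes>\<^bsub>L\<^esub> expand g"
proof (induction f rule: poly_mapping_additive_induct)
  case (single v r)
  show ?case
  proof (induction g rule: poly_mapping_additive_induct)
    case (single w r')
    let ?f = "Poly_Mapping.single v r" and ?g = "Poly_Mapping.single w r'"
    let ?a = "\<iota> ?f \<otimes> x [^] (- deg v)" and ?b = "\<iota> ?g \<otimes> x [^] (- deg w)"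
    have "- (deg v + deg w) = - deg w + - deg v" by simp
    then have pow: "x [^] (- (deg v + deg w)) = x [^] (- deg w) \<otimes> x [^] (- deg v)"
      by (simp only: I.K.int_pow_add[of x, OF x_closed x_nonzero])
    have "expand ?f \<otimes>\<^bsub>L\<^esub> expand ?g = mono (?a \<otimes> \<tau> (deg v) ?b) (deg v + deg w)"
      using homog_coeff[OF homog_single] by (simp only: expand_homog[OF homog_single] monomial_mult_monomial D_ops)
    also have "?a \<otimes> \<tau> (deg v) ?b = \<iota> (?f \<otimes>\<^bsub>T\<^esub> ?g) \<otimes> x [^] (- (deg v + deg w))"
      unfolding iota_mult pow by (simp add: \<tau>_def I.K.m_assoc)
    also have "mono \<dots> (deg v + deg w) = expand (?f \<otimes>\<^bsub>T\<^esub> ?g)"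
      using expand_homog[OF homog_mult[OF homog_single homog_single], of v r w r'] by simp
    finally show ?case by simp
  next
    case (add g g')
    then show ?case by (simp add: mult_add_right expand_add L.r_distr expand_closed)
  qed
next
  case (add f f')
  then show ?case by (simp add: mult_add_left expand_add L.l_distr expand_closed)
qed

lemma expand_1: "expand 1 = \<one>\<^bsub>L\<^esub>"
  using expand_homog[OF homog_1] by (simp add: one_L)

lemma expand_nonzero: assumes "f \<noteq> 0" shows "expand f \<noteq> \<zero>\<^bsub>L\<^esub>"
proof
  assume *: "expand f = \<zero>\<^bsub>L\<^esub>"
  obtain m where m: "part m f \<noteq> 0" using part_nonzero[OF assms] .
  have "expand f m = \<zero>" using * by (simp add: zero_L)
  moreover have "expand f m \<noteq> \<zero>" using m by (simp add: expand_def)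
  ultimately show False by blast
qed

definition is_embedding :: "('a \<Rightarrow> int \<Rightarrow> 'a) \<Rightarrow> bool" where
  "is_embedding h \<longleftrightarrow> h \<in> ring_hom K L \<inter> extensional (carrier K) \<and>
     (\<forall>a\<in>carrier D. h a = mono a 0) \<and> h x = mono \<one>\<^bsub>D\<^esub> 1"

text \<open>The expansion is injective on the torus and therefore extends to \<open>K\<close>. On a coefficient
  \<open>a = \<iota> u (\<iota> v)\<^sup>-\<^sup>1\<close> its value is forced by \<open>a (\<iota> v) = \<iota> u\<close>.\<close>

lemma embedding_exists: obtains h where "is_embedding h"
proof -
  have "expand \<in> ring_hom T L"
    by (rule ring_hom_memI) (simp_all add: expand_closed expand_mult expand_add expand_1)
  then obtain h where h: "h \<in> ring_hom K L \<inter> extensional (carrier K)" and hT: "\<And>f. h (\<iota> f) = expand f"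
    using I.extend_hom[OF L.skewfield_axioms, of expand] expand_nonzero by auto
  have "h a = mono a 0" if a: "a \<in> carrier D" for a
  proof -
    obtain u v where uv: "u \<in> homog 0" "v \<in> homog 0" "v \<noteq> 0" "a = \<iota> u \<otimes> inv (\<iota> v)" using D_E[OF a] .
    have hv: "h (\<iota> v) = mono (\<iota> v) 0" "h (\<iota> u) = mono (\<iota> u) 0" using expand_homog uv by (auto simp: hT)
    have au: "a \<otimes> \<iota> v = \<iota> u" using uv by simp
    have hc: "h a \<in> carrier L" using h ring_hom_closed[of h K L] a by auto
    have "h a \<otimes>\<^bsub>L\<^esub> h (\<iota> v) = h (a \<otimes> \<iota> v)" using h ring_hom_mult[of h K L a "\<iota> v"] a by auto
    also have "\<dots> = mono a 0 \<otimes>\<^bsub>L\<^esub> h (\<iota> v)"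
      unfolding au hv using monomial_mult_monomial[OF a D_iota[OF uv(2)], of 0 0] au twist_0[OF D_iota[OF uv(2)]] by simp
    finally show ?thesis
      using hc a expand_nonzero[OF uv(3)] expand_closed[of v] hT[of v] by simp
  qed
  moreover have "h x = mono \<one>\<^bsub>D\<^esub> 1"
  proof -
    have "(X_monomial (e k) :: 'n \<Rightarrow>\<^sub>0 'c qlaurent) \<in> homog 1"
      using homog_single[of "e k" 1] by (simp add: X_monomial_def deg_ek)
    from expand_homog[OF this] have "h x = mono (x \<otimes> x [^] (- 1 :: int)) 1"
      by (simp only: x_def X_def hT)
    moreover have "x \<otimes> x [^] (- 1 :: int) = \<one>\<^bsub>D\<^esub>"
      using I.K.int_pow_minus[of x 1] by simp
    ultimately show ?thesis by (simp only:)
  qed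
  ultimately show ?thesis using that h unfolding is_embedding_def by blast
qed

text \<open>The coefficients and the powers of \<open>X_k\<close> generate the torus.\<close>

lemma embedding_unique: assumes "is_embedding g" "is_embedding h" shows "g = h"
proof -
  have gh: "g \<in> ring_hom K L" "h \<in> ring_hom K L" using assms by (auto simp: is_embedding_def)
  have pow: "g (x [^] n) = h (x [^] n)" for n :: nat
  proof (induction n)
    case (Suc n)
    then show ?case using assms
      by (simp add: ring_hom_mult[OF gh(1)] ring_hom_mult[OF gh(2)] is_embedding_def)
  qed (simp add: ring_hom_one[OF gh(1)] ring_hom_one[OF gh(2)])
  have pow': "g (x [^] m) = h (x [^] m)" for m :: int
    using pow I.K.nat_pow_nonzero[of x] I.K.hom_inv[OF L.skewfield_axioms gh(1)] I.K.hom_inv[OF L.skewfield_axioms gh(2)]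
    by (cases m rule: int_cases2) (simp_all add: int_pow_int I.K.int_pow_minus)
  have T: "g (\<iota> f) = h (\<iota> f)" for f
  proof (induction f rule: poly_mapping_additive_induct)
    case (single v r)
    let ?d = "\<iota> (Poly_Mapping.single v r) \<otimes> x [^] (- deg v)"
    have d: "?d \<in> carrier D" by (rule homog_coeff) simp
    have eq: "\<iota> (Poly_Mapping.single v r) = ?d \<otimes> x [^] deg v"
      by (simp add: I.K.m_assoc I.K.int_pow_minus)
    have "g ?d = h ?d" using d assms by (simp add: is_embedding_def)
    then have "g (?d \<otimes> x [^] deg v) = h (?d \<otimes> x [^] deg v)"
      using ring_hom_mult[OF gh(1), of ?d "x [^] deg v"] ring_hom_mult[OF gh(2), of ?d "x [^] deg v"] pow' by simp
    then show ?case unfolding eq[symmetric] .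
  qed (simp add: iota_add ring_hom_add[OF gh(1)] ring_hom_add[OF gh(2)])
  have "g y = h y" if "y \<in> carrier K" for y
    using I.hom_eqI[OF L.skewfield_axioms gh] T that by simp
  then show ?thesis using assms by (intro extensionalityI[of _ "carrier K"]) (auto simp: is_embedding_def)
qed

definition j :: "'a \<Rightarrow> int \<Rightarrow> 'a" where "j = laurent_embedding \<Gamma> e K \<iota> k"

lemma j_embedding: "is_embedding j"
proof -
  have "j = (THE h. is_embedding h)"
    unfolding j_def laurent_embedding_def is_embedding_def L_eq Let_def
    by (simp only: D_def x_def X_def)
  then show ?thesis using embedding_exists embedding_unique by (metis theI)
qed

lemma j_hom: "j \<in> ring_hom K L" using j_embedding by (simp add: is_embedding_def)

lemma j_coeff: "a \<in> carrier D \<Longrightarrow> j a = mono a 0" using j_embedding by (simp add: is_embedding_def)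

lemma j_x: "j x = mono \<one>\<^bsub>D\<^esub> 1" using j_embedding by (simp add: is_embedding_def)

lemma j_closed [simp]: "y \<in> carrier K \<Longrightarrow> j y \<in> carrier L" using ring_hom_closed[OF j_hom] .

lemma j_inj: "inj_on j (carrier K)"
  using I.K.hom_inj[OF ring_L L.nontrivial j_hom] .

lemma j_pow: "j (x [^] (m::int)) = mono \<one>\<^bsub>D\<^esub> m"
proof -
  have nat: "j (x [^] n) = mono \<one>\<^bsub>D\<^esub> (int n)" for n :: nat
  proof (induction n)
    case (Suc n)
    have "j (x [^] Suc n) = mono \<one>\<^bsub>D\<^esub> (int n) \<otimes>\<^bsub>L\<^esub> mono \<one>\<^bsub>D\<^esub> 1"
      using Suc by (simp add: ring_hom_mult[OF j_hom] j_x)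
    also have "\<dots> = mono (\<one>\<^bsub>D\<^esub> \<otimes>\<^bsub>D\<^esub> \<tau> (int n) \<one>\<^bsub>D\<^esub>) (int n + 1)" by (rule monomial_mult_monomial) (rule D.one_closed)+
    finally show ?case by (simp add: \<tau>_one add.commute)
  qed (simp add: ring_hom_one[OF j_hom] one_L)
  show ?thesis
  proof (cases m rule: int_cases2)
    case (nonpos n)
    have "mono \<one>\<^bsub>D\<^esub> (int n) \<otimes>\<^bsub>L\<^esub> mono \<one>\<^bsub>D\<^esub> (- int n) = mono (\<one>\<^bsub>D\<^esub> \<otimes>\<^bsub>D\<^esub> \<tau> (int n) \<one>\<^bsub>D\<^esub>) (int n + - int n)"
      by (rule monomial_mult_monomial) (rule D.one_closed)+
    also have "\<dots> = \<one>\<^bsub>L\<^esub>" by (simp add: \<tau>_one one_L)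
    finally have "inv\<^bsub>L\<^esub> (mono \<one>\<^bsub>D\<^esub> (int n)) = mono \<one>\<^bsub>D\<^esub> (- int n)"
      using D.one_closed by (intro L.inv_unique_right monomial_closed)
    then show ?thesis
      using nonpos nat[of n] I.K.hom_inv[OF L.skewfield_axioms j_hom, of "x [^] n"] I.K.nat_pow_nonzero[of x n]
      by (simp add: I.K.int_pow_minus int_pow_int)
  qed (simp add: nat int_pow_int)
qed

lemma j_homogeneous:
  assumes "w \<in> carrier K" "w \<otimes> x [^] (- m) \<in> carrier D"
  shows "j w = mono (w \<otimes> x [^] (- m)) m"
proof -
  let ?d = "w \<otimes> x [^] (- m)"
  have eq: "w = ?d \<otimes> x [^] m" using assms by (simp add: I.K.m_assoc I.K.int_pow_minus)
  have "j (?d \<otimes> x [^] m) = mono ?d 0 \<otimes>\<^bsub>L\<^esub> mono \<one>\<^bsub>D\<^esub> m"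
    using assms by (simp only: ring_hom_mult[OF j_hom] j_coeff j_pow D_closed I.K.int_pow_nonzero x_closed x_nonzero not_False_eq_True)
  also have "\<dots> = mono (?d \<otimes>\<^bsub>D\<^esub> \<tau> 0 \<one>\<^bsub>D\<^esub>) (0 + m)" using assms D.one_closed by (intro monomial_mult_monomial)
  also have "\<dots> = mono ?d m" using assms by (simp add: \<tau>_one)
  finally show ?thesis unfolding eq[symmetric] .
qed

end

section \<open>Conjugation by the quantum dilogarithm\<close>

lemma (in monoid) foldr_mult_unit:
  "set xs \<subseteq> carrier G \<Longrightarrow> b \<in> carrier G \<Longrightarrow> foldr (\<otimes>) xs \<one> \<in> carrier G \<and> foldr (\<otimes>) xs b = foldr (\<otimes>) xs \<one> \<otimes> b"
  by (induction xs) (auto simp: m_assoc)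

lemma ordered_product_0 [simp]: "ordered_product R f 0 = \<one>\<^bsub>R\<^esub>"
  by (simp add: ordered_product_def)

lemma (in skewfield) ordered_product_closed [simp]:
  "(\<And>l. f l \<in> carrier K) \<Longrightarrow> ordered_product K f n \<in> carrier K"
  unfolding ordered_product_def using foldr_mult_unit[of "map f [1..<Suc n]" \<one>] by fastforce

lemma (in skewfield) ordered_product_Suc:
  assumes "\<And>l. f l \<in> carrier K"
  shows "ordered_product K f (Suc n) = ordered_product K f n \<otimes> f (Suc n)"
  using foldr_mult_unit[of "map f [1..<Suc n]" "f (Suc n)"] assms
  by (auto simp: ordered_product_def image_subset_iff)

lemma (in skewfield) ordered_product_commute:
  assumes f: "\<And>l. f l \<in> carrier K" and y: "y \<in> carrier K" and comm: "\<And>l. y \<otimes> f l = f l \<otimes> y"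
  shows "y \<otimes> ordered_product K f n = ordered_product K f n \<otimes> y"
proof (induction n)
  case (Suc n)
  let ?P = "ordered_product K f n"
  have P: "?P \<in> carrier K" using f by simp
  have "y \<otimes> (?P \<otimes> f (Suc n)) = (y \<otimes> ?P) \<otimes> f (Suc n)" using P f y by (simp add: m_assoc)
  also have "\<dots> = ?P \<otimes> (y \<otimes> f (Suc n))" unfolding Suc using P f y by (simp add: m_assoc)
  also have "\<dots> = (?P \<otimes> f (Suc n)) \<otimes> y" unfolding comm using P f y by (simp add: m_assoc)
  finally show ?case by (simp only: ordered_product_Suc[of f, OF f])
qed (use y in simp)

lemma (in skewfield) ordered_product_mult:
  assumes f: "\<And>l. f l \<in> carrier K" and g: "\<And>l. g l \<in> carrier K"
    and comm: "\<And>i l. g i \<otimes> f l = f l \<otimes> g i"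
  shows "ordered_product K (\<lambda>l. g l \<otimes> f l) n = ordered_product K g n \<otimes> ordered_product K f n"
proof (induction n)
  case (Suc n)
  let ?F = "ordered_product K f n" and ?G = "ordered_product K g n"
  have FG: "?F \<in> carrier K" "?G \<in> carrier K" using f g by simp_all
  have c: "g (Suc n) \<otimes> ?F = ?F \<otimes> g (Suc n)" using f g comm by (intro ordered_product_commute) auto
  have "(?G \<otimes> ?F) \<otimes> (g (Suc n) \<otimes> f (Suc n)) = ?G \<otimes> (?F \<otimes> g (Suc n)) \<otimes> f (Suc n)"
    using FG f g by (simp add: m_assoc)
  also have "\<dots> = (?G \<otimes> g (Suc n)) \<otimes> (?F \<otimes> f (Suc n))"
    unfolding c[symmetric] using FG f g by (simp add: m_assoc)
  finally show ?case
    using Suc f g by (simp add: ordered_product_Suc)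
qed simp

lemma (in skewfield) ordered_product_nonzero:
  assumes "\<And>l. f l \<in> carrier K" "\<And>l. f l \<noteq> \<zero>"
  shows "ordered_product K f n \<noteq> \<zero>"
  by (induction n) (simp_all add: assms nontrivial ordered_product_Suc)

context graded_torus_field
begin

text \<open>The element \<open>q\<^sup>m\<^sup>/\<^sup>d\<close> of \<open>K\<close>.\<close>

definition qi :: "int \<Rightarrow> 'a" where "qi m = s (q_monomial m)"

lemma qi_central [simp]: "I.K.central (qi m)"
  by (simp add: qi_def s_central)

lemma qi_closed [simp]: "qi m \<in> carrier K"
  by (simp add: qi_def)

lemma qi_D [simp]: "qi m \<in> carrier D"
  using D_iota[OF homog_single[of 0, unfolded deg_zero]] by (simp add: qi_def s_def scalar_def)

lemma qi_nonzero [simp]: "qi m \<noteq> \<zero>"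
  unfolding qi_def s_eq_0 q_monomial_def by (metis lookup_single_eq lookup_zero zero_neq_one)

lemma qi_add: "qi (m + n) = qi m \<otimes> qi n"
proof -
  have "q_monomial (m + n) = (q_monomial m * q_monomial n :: 'c qlaurent)"
    by (simp add: q_monomial_def mult_single)
  then show ?thesis by (simp add: qi_def s_hom)
qed

lemma qi_0 [simp]: "qi 0 = \<one>"
  by (simp add: qi_def q_monomial_def s_hom)

lemma qi_eq_1: "qi m = \<one> \<longleftrightarrow> m = 0"
proof
  assume "qi m = \<one>"
  then have "q_monomial m = (q_monomial 0 :: 'c qlaurent)" using s_inj qi_0 unfolding qi_def by metis
  then show "m = 0" unfolding q_monomial_def by (metis lookup_single_eq lookup_single_not_eq zero_neq_one)
qed simp

lemma qi_pow: "qi m [^] (n::nat) = qi (int n * m)"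
  by (induction n) (simp_all add: distrib_right qi_add[of _ m, symmetric] add.commute)

lemma D_pow: "a [^]\<^bsub>D\<^esub> (n::nat) = a [^] n"
  by (simp add: nat_pow_def)

definition central_coeff :: "'a \<Rightarrow> bool" where
  "central_coeff a \<longleftrightarrow> I.K.central a \<and> a \<in> carrier D"

lemma central_coeffD: "central_coeff a \<Longrightarrow> a \<in> carrier K" "central_coeff a \<Longrightarrow> a \<in> carrier D" 
  "central_coeff a \<Longrightarrow> y \<in> carrier K \<Longrightarrow> a \<otimes> y = y \<otimes> a"
  using I.K.central_commute by (auto simp: central_coeff_def)

lemma qi_central_coeff: "central_coeff (qi m)"
  by (simp add: central_coeff_def)

lemma central_coeff_mult: "central_coeff a \<Longrightarrow> central_coeff b \<Longrightarrow> central_coeff (a \<otimes> b)"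
  using D.m_closed by (simp add: central_coeff_def I.K.central_mult)

lemma central_coeff_pow: "central_coeff a \<Longrightarrow> central_coeff (a [^] (n::nat))"
  using I.K.central_pow[of a n] D.nat_pow_closed[of a n] by (simp add: central_coeff_def D_pow)

lemma inv_D: "a \<in> carrier D \<Longrightarrow> a \<noteq> \<zero> \<Longrightarrow> inv\<^bsub>D\<^esub> a = inv a"
  using D.inv_in[of a] D.inv_right[of a] by (intro I.K.inv_unique_right[symmetric]) auto

lemma central_coeff_inv: "central_coeff a \<Longrightarrow> a \<noteq> \<zero> \<Longrightarrow> central_coeff (inv a)"
  using D.inv_in[of a] inv_D[of a] by (simp add: central_coeff_def I.K.central_inv)

lemma \<tau>_central: "central_coeff a \<Longrightarrow> \<tau> m a = a"
proof -
  assume a: "central_coeff a"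
  have "\<tau> m a = (a \<otimes> x [^] m) \<otimes> x [^] (- m)"
    unfolding \<tau>_def using central_coeffD(3)[OF a, of "x [^] m"] by simp
  then show ?thesis using central_coeffD(1)[OF a] by (simp add: I.K.int_pow_minus)
qed

definition \<psi> :: "int \<Rightarrow> nat \<Rightarrow> 'a" where "\<psi> p = dilog_coeff D (qi p)"

text \<open>Since \<open>q\<close> is not a root of unity, the recursion for the coefficients can be solved, and the
  solution consists of rational functions of \<open>q\<close>, which are central.\<close>

lemma dilog_coefficients:
  assumes p: "0 < p"
  shows "central_coeff (\<psi> p m)" and "\<psi> p 0 = \<one>"
    and "qi (2 * p * int (Suc m)) \<otimes> \<psi> p (Suc m) = \<psi> p (Suc m) \<oplus> qi p \<otimes> \<psi> p m"
proof -
  define r where "r m = qi (2 * p * int (Suc m)) \<ominus> \<one>" for m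
  have r: "r m \<in> carrier K" for m by (simp add: r_def)
  have r_nz: "r m \<noteq> \<zero>" for m
    using p qi_eq_1[of "2 * p * int (Suc m)"] by (simp add: r_def)
  have "r m = qi (2 * p * int (Suc m)) \<oplus>\<^bsub>D\<^esub> (\<ominus>\<^bsub>D\<^esub> \<one>\<^bsub>D\<^esub>)" for m
  proof -
    have "\<ominus>\<^bsub>D\<^esub> \<one>\<^bsub>D\<^esub> = \<ominus> \<one>"
      using D.l_neg[OF D.one_closed] D.a_inv_closed[OF D.one_closed] by (intro I.K.minus_equality[symmetric]) auto
    then show ?thesis by (simp add: r_def I.K.minus_eq)
  qed
  then have r_D: "r m \<in> carrier D" for m
    using D.a_closed[OF qi_D D.a_inv_closed[OF D.one_closed]] by simp
  have rc: "central_coeff (r m)" for m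
    unfolding central_coeff_def r_def using r_D[of m, unfolded r_def] I.K.central_minus[OF qi_central I.K.central_one] by blast
  define P where "P \<psi> \<longleftrightarrow> (\<forall>m. \<psi> m \<in> carrier D) \<and> \<psi> 0 = \<one>\<^bsub>D\<^esub> \<and>
     (\<forall>m. (qi p [^]\<^bsub>D\<^esub> (2::nat)) [^]\<^bsub>D\<^esub> Suc m \<otimes>\<^bsub>D\<^esub> \<psi> (Suc m) = \<psi> (Suc m) \<oplus>\<^bsub>D\<^esub> qi p \<otimes>\<^bsub>D\<^esub> \<psi> m)" for \<psi>
  have pow: "(qi p [^]\<^bsub>D\<^esub> (2::nat)) [^]\<^bsub>D\<^esub> Suc m = qi (2 * p * int (Suc m))" for m
    unfolding D_pow qi_pow by (simp only: mult_ac of_nat_numeral)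
  have rec: "qi (2 * p * int (Suc m)) \<otimes> b = b \<oplus> a \<longleftrightarrow> b = inv (r m) \<otimes> a"
    if ab: "a \<in> carrier K" "b \<in> carrier K" for a b m
  proof -
    let ?Q = "qi (2 * p * int (Suc m))"
    have *: "?Q \<otimes> b = r m \<otimes> b \<oplus> b"
      using ab by (simp add: r_def I.K.l_distr I.K.minus_eq I.K.l_minus I.K.a_assoc I.K.l_neg)
    have "?Q \<otimes> b = b \<oplus> a \<longleftrightarrow> r m \<otimes> b \<oplus> b = a \<oplus> b"
      unfolding * using I.K.a_comm[OF ab(2,1)] by simp
    also have "\<dots> \<longleftrightarrow> r m \<otimes> b = a" using ab r by simp
    also have "\<dots> \<longleftrightarrow> b = inv (r m) \<otimes> a" using ab r r_nz by auto
    finally show ?thesis .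
  qed
  define \<psi>' where "\<psi>' = rec_nat \<one> (\<lambda>m a. inv (r m) \<otimes> (qi p \<otimes> a))"
  have \<psi>'c: "central_coeff (\<psi>' m)" for m
  proof (induction m)
    case 0
    then show ?case using qi_central_coeff[of 0] by (simp add: \<psi>'_def)
  next
    case (Suc m)
    then show ?case using central_coeff_mult central_coeff_inv[OF rc r_nz] qi_central_coeff by (simp add: \<psi>'_def)
  qed
  have P': "P \<psi>'"
    unfolding P_def pow D_ops using \<psi>'c central_coeffD rec by (auto simp: \<psi>'_def I.K.m_closed r r_nz)
  have "f = \<psi>'" if "P f" for f
  proof
    fix m
    have f: "f m \<in> carrier K" for m using that D_closed unfolding P_def by blast
    show "f m = \<psi>' m"
    proof (induction m)
      case (Suc m)
      have "f (Suc m) = inv (r m) \<otimes> (qi p \<otimes> f m)"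
        using that f rec[of "qi p \<otimes> f m" "f (Suc m)" m] unfolding P_def pow D_ops by simp
      then show ?case by (simp add: Suc \<psi>'_def)
    qed (use that in \<open>simp add: P_def \<psi>'_def\<close>)
  qed
  then have "\<psi> p = \<psi>'" unfolding \<psi>_def dilog_coeff_def using P' unfolding P_def by (intro the_equality)
  then show "central_coeff (\<psi> p m)" "\<psi> p 0 = \<one>"
    "qi (2 * p * int (Suc m)) \<otimes> \<psi> p (Suc m) = \<psi> p (Suc m) \<oplus> qi p \<otimes> \<psi> p m"
    using \<psi>'c P' unfolding P_def pow D_ops by auto
qed

text \<open>The series \<open>\<Psi>(z X_k)\<close> for the parameter \<open>q\<^sup>p\<^sup>/\<^sup>d\<close>.\<close>

definition \<Phi> :: "int \<Rightarrow> 'a \<Rightarrow> int \<Rightarrow> 'a" where "\<Phi> p z = dilog_series D (qi p) z"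

lemma \<Phi>_coeff: "\<Phi> p z (int n) = \<psi> p n \<otimes> z [^] n" "n' < 0 \<Longrightarrow> \<Phi> p z n' = \<zero>"
  by (simp_all add: \<Phi>_def dilog_series_def \<psi>_def D_pow)

context
  fixes p :: int and z :: 'a
  assumes p: "0 < p" and z: "central_coeff z"
begin

lemma \<Phi>_coeff_central: "central_coeff (\<Phi> p z n)"
proof (cases n rule: int_cases)
  case (nonneg n)
  then show ?thesis using dilog_coefficients(1)[OF p] z
    by (simp add: \<Phi>_coeff central_coeff_mult central_coeff_pow)
next
  case (neg n)
  have "central_coeff \<zero>"
    unfolding central_coeff_def I.K.central_def using D.zero_closed by simp
  then show ?thesis using neg by (simp add: \<Phi>_coeff)
qed

lemma \<Phi>_closed: "\<Phi> p z \<in> carrier L"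
  unfolding carrier_L below_def using central_coeffD(2)[OF \<Phi>_coeff_central]
  by (auto simp: \<Phi>_coeff(2) intro!: exI[of _ "0::int"])

lemma \<Phi>_nonzero: "\<Phi> p z \<noteq> \<zero>\<^bsub>L\<^esub>"
proof
  assume *: "\<Phi> p z = \<zero>\<^bsub>L\<^esub>"
  have "\<Phi> p z (int 0) = \<one>"
    unfolding \<Phi>_coeff by (simp add: dilog_coefficients(2)[OF p])
  then show False using * I.K.nontrivial by (simp add: zero_L)
qed

text \<open>The coefficients of \<open>\<Psi>\<close> commute with everything, and passing the monomial \<open>X_k\<^sup>m\<close> past \<open>w\<close>
  costs the \<open>m\<close>-th power of a central factor, which is absorbed into the argument of \<open>\<Psi>\<close>.\<close>

lemma \<Phi>_commute:
  assumes w: "w \<in> carrier K" "w \<otimes> x [^] (- d :: int) \<in> carrier D"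
    and comm: "x \<otimes> w = qi a \<otimes> (w \<otimes> x)"
  shows "\<Phi> p z \<otimes>\<^bsub>L\<^esub> j w = j w \<otimes>\<^bsub>L\<^esub> \<Phi> p (qi a \<otimes> z)"
proof
  fix n
  define b where "b = w \<otimes> x [^] (- d)"
  have b: "b \<in> carrier D" "b \<in> carrier K" "j w = mono b d" using w j_homogeneous by (auto simp: b_def)
  have z': "central_coeff (qi a \<otimes> z)" using z qi_central_coeff central_coeff_mult by blast
  have conj: "x \<otimes> b = qi a \<otimes> (b \<otimes> x)"
  proof -
    have xx: "x \<otimes> x [^] (- d) = x [^] (- d) \<otimes> x"
      using I.K.int_pow_add[of x 1 "- d"] I.K.int_pow_add[of x "- d" 1] by (simp add: add.commute)
    have "x \<otimes> b = qi a \<otimes> (w \<otimes> (x \<otimes> x [^] (- d)))"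
      using w comm unfolding b_def by (simp flip: I.K.m_assoc)
    then show ?thesis unfolding xx b_def using w by (simp add: I.K.m_assoc)
  qed
  have \<tau>b: "x [^] (m::nat) \<otimes> b = qi (int m * a) \<otimes> (b \<otimes> x [^] m)" for m
  proof (induction m)
    case (Suc m)
    have "x [^] Suc m \<otimes> b = x [^] m \<otimes> (x \<otimes> b)" using b by (simp add: I.K.m_assoc)
    also have "\<dots> = (x [^] m \<otimes> qi a) \<otimes> b \<otimes> x" unfolding conj using b by (simp add: I.K.m_assoc)
    also have "\<dots> = qi a \<otimes> (x [^] m \<otimes> b) \<otimes> x"
      unfolding I.K.central_commute[OF qi_central, of "x [^] m", symmetric, OF I.K.nat_pow_closed[OF x_closed]]
      using b by (simp add: I.K.m_assoc)
    also have "\<dots> = qi (a + int m * a) \<otimes> (b \<otimes> x [^] Suc m)"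
      unfolding Suc qi_add using b by (simp add: I.K.m_assoc)
    finally show ?case by (simp add: algebra_simps)
  qed (use b in simp)
  have left: "(\<Phi> p z \<otimes>\<^bsub>L\<^esub> j w) n = \<Phi> p z (n - d) \<otimes> \<tau> (n - d) b"
    unfolding b using monomial_mult_right[OF b(1) \<Phi>_closed] by simp
  have right: "(j w \<otimes>\<^bsub>L\<^esub> \<Phi> p z') n = b \<otimes> \<tau> d (\<Phi> p z' (n - d))" if "\<Phi> p z' \<in> carrier L" for z'
    unfolding b using monomial_mult_left[OF b(1) that] by simp
  have \<Phi>': "\<Phi> p (qi a \<otimes> z) \<in> carrier L"
    unfolding carrier_L below_def
  proof (intro conjI allI exI impI)
    fix n show "\<Phi> p (qi a \<otimes> z) n \<in> carrier D"
    proof (cases n rule: int_cases)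
      case (nonneg n)
      then show ?thesis using dilog_coefficients(1)[OF p] z'
        by (simp add: \<Phi>_coeff central_coeffD central_coeff_mult central_coeff_pow)
    qed (use D.zero_closed in \<open>simp add: \<Phi>_coeff\<close>)
  next
    fix n :: int assume "n < 0"
    then show "\<Phi> p (qi a \<otimes> z) n = \<zero>\<^bsub>D\<^esub>" by (simp add: \<Phi>_coeff)
  qed
  show "(\<Phi> p z \<otimes>\<^bsub>L\<^esub> j w) n = (j w \<otimes>\<^bsub>L\<^esub> \<Phi> p (qi a \<otimes> z)) n"
  proof (cases "n - d" rule: int_cases)
    case (nonneg m)
    define c where "c = \<psi> p m"
    have c: "central_coeff c" using dilog_coefficients(1)[OF p] by (simp add: c_def)
    define y where "y = z [^] m"
    have y: "central_coeff y" using z by (simp add: y_def central_coeff_pow)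
    note cy = central_coeff_mult[OF c y]
    let ?q = "qi (int m * a)"
    have "\<tau> (int m) b = ?q \<otimes> b"
      unfolding \<tau>_def using \<tau>b[of m] b by (simp add: I.K.int_pow_minus int_pow_int I.K.m_assoc I.K.nat_pow_nonzero)
    then have "(\<Phi> p z \<otimes>\<^bsub>L\<^esub> j w) n = (c \<otimes> y) \<otimes> (?q \<otimes> b)"
      by (simp only: left nonneg \<Phi>_coeff c_def y_def)
    also have "\<dots> = (c \<otimes> y \<otimes> ?q) \<otimes> b" using b central_coeffD(1)[OF c] central_coeffD(1)[OF y] by (simp add: I.K.m_assoc)
    also have "\<dots> = b \<otimes> (c \<otimes> y \<otimes> ?q)"
      using central_coeffD(3)[OF central_coeff_mult[OF cy qi_central_coeff] b(2)] .
    also have "c \<otimes> y \<otimes> ?q = c \<otimes> (?q \<otimes> y)"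
      using central_coeffD(3)[OF y qi_closed] central_coeffD(1)[OF c] central_coeffD(1)[OF y] by (simp add: I.K.m_assoc)
    also have "\<dots> = \<Phi> p (qi a \<otimes> z) (n - d)"
    proof -
      have "(qi a \<otimes> z) [^] m = qi a [^] m \<otimes> z [^] m"
        using I.K.central_commute[OF qi_central] central_coeffD(1)[OF z] by (intro I.K.pow_mult_distrib) auto
      then show ?thesis by (simp only: nonneg \<Phi>_coeff c_def y_def qi_pow)
    qed
    also have "b \<otimes> \<dots> = b \<otimes> \<tau> d (\<Phi> p (qi a \<otimes> z) (n - d))"
    proof -
      have "central_coeff (\<Phi> p (qi a \<otimes> z) (n - d))"
        unfolding nonneg \<Phi>_coeff using z' dilog_coefficients(1)[OF p] central_coeff_mult central_coeff_pow by blast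
      then show ?thesis by (simp only: \<tau>_central)
    qed
    finally show ?thesis using right[OF \<Phi>'] by simp
  next
    case (neg m)
    then have "n - d < 0" by simp
    then show ?thesis using left right[OF \<Phi>'] b by (simp add: \<Phi>_coeff(2) \<tau>_def)
  qed
qed

text \<open>This is \<open>\<Psi>(q\<^sup>2 X) = (1 + q X) \<Psi>(X)\<close> in the ring of Laurent series; coefficientwise it is the recursion
  for \<open>\<psi>\<close> multiplied by a power of \<open>z\<close>.\<close>

lemma \<Phi>_functional_equation:
  "\<Phi> p (qi (2 * p) \<otimes> z) = j (\<one> \<oplus> qi p \<otimes> z \<otimes> x) \<otimes>\<^bsub>L\<^esub> \<Phi> p z"
proof
  fix n
  define u where "u = qi p \<otimes> z"
  have u: "central_coeff u" using central_coeff_mult qi_central_coeff z by (simp add: u_def)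
  note zc [simp] = central_coeffD(1,2)[OF z] central_coeffD(1,2)[OF u]
  have "u \<otimes> x \<otimes> x [^] (- 1 :: int) = u" by (simp add: I.K.int_pow_minus)
  then have ju: "j (u \<otimes> x) = mono u 1" using j_homogeneous[of "u \<otimes> x" 1] by simp
  have "j (\<one> \<oplus> u \<otimes> x) \<otimes>\<^bsub>L\<^esub> \<Phi> p z = \<Phi> p z \<oplus>\<^bsub>L\<^esub> mono u 1 \<otimes>\<^bsub>L\<^esub> \<Phi> p z"
    using \<Phi>_closed by (simp add: ring_hom_add[OF j_hom] ring_hom_one[OF j_hom] ju L.l_distr)
  then have rhs: "(j (\<one> \<oplus> u \<otimes> x) \<otimes>\<^bsub>L\<^esub> \<Phi> p z) n = \<Phi> p z n \<oplus> u \<otimes> \<Phi> p z (n - 1)"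
    using monomial_mult_left[OF zc(4) \<Phi>_closed, of 1 n] by (simp add: add_L \<tau>_central \<Phi>_coeff_central)
  show "\<Phi> p (qi (2 * p) \<otimes> z) n = (j (\<one> \<oplus> qi p \<otimes> z \<otimes> x) \<otimes>\<^bsub>L\<^esub> \<Phi> p z) n"
    unfolding u_def[symmetric] rhs
  proof (cases n rule: int_cases)
    case (nonneg n')
    show "\<Phi> p (qi (2 * p) \<otimes> z) n = \<Phi> p z n \<oplus> u \<otimes> \<Phi> p z (n - 1)"
    proof (cases n')
      case 0
      then show ?thesis using nonneg \<Phi>_coeff(1)[of p z 0] \<Phi>_coeff(1)[of p "qi (2 * p) \<otimes> z" 0]
        by (simp add: \<Phi>_coeff(2) dilog_coefficients(2)[OF p])
    next
      case (Suc m)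
      define a b y where "a = \<psi> p (Suc m)" and "b = \<psi> p m" and "y = z [^] m"
      have ab: "central_coeff a" "central_coeff b" "central_coeff y"
        using dilog_coefficients(1)[OF p] z central_coeff_pow by (simp_all add: a_def b_def y_def)
      note abc [simp] = central_coeffD(1)[OF ab(1)] central_coeffD(1)[OF ab(2)] central_coeffD(1)[OF ab(3)]
      let ?Q = "qi (2 * p * int (Suc m))"
      have n: "n = int (Suc m)" "n - 1 = int m" using nonneg Suc by simp_all
      have pow: "(qi (2 * p) \<otimes> z) [^] Suc m = ?Q \<otimes> (y \<otimes> z)"
      proof -
        have "(qi (2 * p) \<otimes> z) [^] Suc m = qi (2 * p) [^] Suc m \<otimes> z [^] Suc m"
          using I.K.central_commute[OF qi_central] by (intro I.K.pow_mult_distrib) auto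
        also have "qi (2 * p) [^] Suc m = ?Q" unfolding qi_pow by (simp only: mult.commute)
        finally show ?thesis by (simp add: y_def)
      qed
      have "\<Phi> p (qi (2 * p) \<otimes> z) n = a \<otimes> (?Q \<otimes> (y \<otimes> z))"
        unfolding n \<Phi>_coeff pow a_def ..
      also have "\<dots> = (?Q \<otimes> a) \<otimes> (y \<otimes> z)"
        using central_coeffD(3)[OF ab(1) qi_closed] by (simp flip: I.K.m_assoc)
      also have "?Q \<otimes> a = a \<oplus> qi p \<otimes> b"
        unfolding a_def b_def by (rule dilog_coefficients(3)[OF p])
      also have "(a \<oplus> qi p \<otimes> b) \<otimes> (y \<otimes> z) = a \<otimes> (y \<otimes> z) \<oplus> qi p \<otimes> ((b \<otimes> y) \<otimes> z)"
        by (simp add: I.K.l_distr I.K.m_assoc)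
      also have "(b \<otimes> y) \<otimes> z = z \<otimes> (b \<otimes> y)"
        using central_coeffD(3)[OF z, of "b \<otimes> y"] by simp
      also have "qi p \<otimes> (z \<otimes> (b \<otimes> y)) = u \<otimes> (b \<otimes> y)" by (simp add: u_def I.K.m_assoc)
      finally show ?thesis unfolding n(2) unfolding n(1) \<Phi>_coeff a_def b_def y_def by (simp only: I.K.nat_pow_Suc)
    qed
  qed (simp add: \<Phi>_coeff)
qed

end

lemma commuting_factors:
  assumes "central_coeff a" "central_coeff b"
  shows "(\<one> \<oplus> a \<otimes> x) \<otimes> (\<one> \<oplus> b \<otimes> x) = (\<one> \<oplus> b \<otimes> x) \<otimes> (\<one> \<oplus> a \<otimes> x)"
proof -
  have ab: "a \<in> carrier K" "b \<in> carrier K" using assms central_coeffD by auto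
  have move: "(c \<otimes> x) \<otimes> (d \<otimes> x) = (c \<otimes> d) \<otimes> (x \<otimes> x)"
    if "c \<in> carrier K" "central_coeff d" for c d
    using that central_coeffD(1)[OF that(2)] central_coeffD(3)[OF that(2) x_closed]
    by (metis I.K.m_assoc I.K.m_closed x_closed)
  have "(a \<otimes> x) \<otimes> (b \<otimes> x) = (b \<otimes> x) \<otimes> (a \<otimes> x)"
    unfolding move[OF ab(1) assms(2)] move[OF ab(2) assms(1)] using central_coeffD(3)[OF assms(1) ab(2)] by simp
  then show ?thesis using ab by (simp add: I.K.l_distr I.K.r_distr I.K.a_ac)
qed

definition dilog_factor :: "int \<Rightarrow> 'a \<Rightarrow> 'a" where
  "dilog_factor m z = \<one> \<oplus> qi m \<otimes> z \<otimes> x"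

lemma dilog_factor_closed [simp]: "central_coeff z \<Longrightarrow> dilog_factor m z \<in> carrier K"
  by (simp add: dilog_factor_def central_coeffD)

lemma dilog_factor_nonzero:
  assumes z: "central_coeff z" shows "dilog_factor m z \<noteq> \<zero>"
proof
  assume *: "dilog_factor m z = \<zero>"
  define u where "u = qi m \<otimes> z"
  have u: "central_coeff u" using central_coeff_mult qi_central_coeff z by (simp add: u_def)
  note uc [simp] = central_coeffD(1,2)[OF u]
  have "u \<otimes> x \<otimes> x [^] (- 1 :: int) = u" by (simp add: I.K.int_pow_minus)
  then have "j (u \<otimes> x) = mono u 1" using j_homogeneous[of "u \<otimes> x" 1] by simp
  then have "j (dilog_factor m z) 0 = \<one>"
    unfolding dilog_factor_def u_def[symmetric]
    by (simp add: ring_hom_add[OF j_hom] ring_hom_one[OF j_hom] add_L one_L laurent_monomial_def)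
  then show False
    using I.K.nontrivial ring_hom_zero[OF j_hom I.K.ring_axioms ring_L] by (simp add: * zero_L)
qed

lemma dilog_factor_shift:
  "central_coeff z \<Longrightarrow> dilog_factor m (qi n \<otimes> z) = dilog_factor (m + n) z"
  by (simp add: dilog_factor_def qi_add I.K.m_assoc central_coeffD)

text \<open>This is the functional equation iterated \<open>n\<close> times; it puts the new factor first, so the factors
  have to be commuted. Iterating in the other direction appends the new factor.\<close>

lemma \<Phi>_product_up:
  assumes p: "0 < p" and z: "central_coeff z"
  shows "\<Phi> p (qi (2 * p * int n) \<otimes> z) = j (ordered_product K (\<lambda>l. dilog_factor (p * (2 * int l - 1)) z) n) \<otimes>\<^bsub>L\<^esub> \<Phi> p z"
proof (induction n)
  case 0
  then show ?case using \<Phi>_closed[OF p z] by (simp add: central_coeffD[OF z] ring_hom_one[OF j_hom])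
next
  case (Suc n)
  let ?f = "\<lambda>l. dilog_factor (p * (2 * int l - 1)) z"
  let ?P = "ordered_product K ?f n" and ?z = "qi (2 * p * int n) \<otimes> z"
  have z': "central_coeff ?z" using z central_coeff_mult qi_central_coeff by blast
  have P: "?P \<in> carrier K" using z by simp
  have "2 * p * int (Suc n) = 2 * p + 2 * p * int n" by (simp add: algebra_simps)
  then have "\<Phi> p (qi (2 * p * int (Suc n)) \<otimes> z) = \<Phi> p (qi (2 * p) \<otimes> ?z)"
    by (simp only: qi_add I.K.m_assoc qi_closed central_coeffD(1)[OF z])
  also have "\<dots> = j (dilog_factor p ?z) \<otimes>\<^bsub>L\<^esub> \<Phi> p ?z"
    unfolding dilog_factor_def by (rule \<Phi>_functional_equation[OF p z'])
  also have "dilog_factor p ?z = ?f (Suc n)"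
    unfolding dilog_factor_shift[OF z] by (simp add: algebra_simps)
  also have "j (?f (Suc n)) \<otimes>\<^bsub>L\<^esub> \<Phi> p ?z = j (?f (Suc n) \<otimes> ?P) \<otimes>\<^bsub>L\<^esub> \<Phi> p z"
    using Suc z P \<Phi>_closed[OF p z] by (simp add: ring_hom_mult[OF j_hom] L.m_assoc)
  also have "?f (Suc n) \<otimes> ?P = ?P \<otimes> ?f (Suc n)"
  proof (rule I.K.ordered_product_commute)
    fix l show "?f (Suc n) \<otimes> ?f l = ?f l \<otimes> ?f (Suc n)"
      unfolding dilog_factor_def by (intro commuting_factors central_coeff_mult qi_central_coeff z)
  qed (use z in auto)
  finally show ?case using z by (simp add: I.K.ordered_product_Suc)
qed

lemma \<Phi>_product_down:
  assumes p: "0 < p" and z: "central_coeff z"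
  shows "\<Phi> p z = j (ordered_product K (\<lambda>l. dilog_factor (- p * (2 * int l - 1)) z) n) \<otimes>\<^bsub>L\<^esub> \<Phi> p (qi (- 2 * p * int n) \<otimes> z)"
proof (induction n)
  case 0
  then show ?case using \<Phi>_closed[OF p z] by (simp add: central_coeffD[OF z] ring_hom_one[OF j_hom])
next
  case (Suc n)
  let ?f = "\<lambda>l. dilog_factor (- p * (2 * int l - 1)) z"
  let ?P = "ordered_product K ?f n" and ?z = "qi (- 2 * p * int (Suc n)) \<otimes> z"
  have z': "central_coeff ?z" using z central_coeff_mult qi_central_coeff by blast
  have P: "?P \<in> carrier K" using z by simp
  have "- 2 * p * int n = 2 * p + (- 2 * p * int (Suc n))" by (simp add: algebra_simps)
  then have "\<Phi> p (qi (- 2 * p * int n) \<otimes> z) = \<Phi> p (qi (2 * p) \<otimes> ?z)"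
    by (simp only: qi_add I.K.m_assoc qi_closed central_coeffD(1)[OF z])
  also have "\<dots> = j (dilog_factor p ?z) \<otimes>\<^bsub>L\<^esub> \<Phi> p ?z"
    unfolding dilog_factor_def by (rule \<Phi>_functional_equation[OF p z'])
  also have "dilog_factor p ?z = ?f (Suc n)"
    unfolding dilog_factor_shift[OF z] by (simp add: algebra_simps)
  finally have "\<Phi> p z = j ?P \<otimes>\<^bsub>L\<^esub> (j (?f (Suc n)) \<otimes>\<^bsub>L\<^esub> \<Phi> p ?z)" using Suc by simp
  also have "\<dots> = j (?P \<otimes> ?f (Suc n)) \<otimes>\<^bsub>L\<^esub> \<Phi> p ?z"
    using z P \<Phi>_closed[OF p z'] by (simp add: ring_hom_mult[OF j_hom] L.m_assoc)
  finally show ?case using z by (simp add: I.K.ordered_product_Suc)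
qed

text \<open>Passing \<open>w\<close> through \<open>\<Psi>\<close> rescales the argument by an even power of \<open>q\<^sup>p\<^sup>/\<^sup>d\<close>, and the two telescoping
  identities express the rescaled series through the original one.\<close>

lemma conjugate_dilog:
  assumes p: "0 < p" and z: "central_coeff z"
    and w: "w \<in> carrier K" "w \<otimes> x [^] (- d :: int) \<in> carrier D"
  shows "x \<otimes> w = qi (2 * p * int n) \<otimes> (w \<otimes> x) \<Longrightarrow>
      \<Phi> p z \<otimes>\<^bsub>L\<^esub> j w \<otimes>\<^bsub>L\<^esub> inv\<^bsub>L\<^esub> (\<Phi> p z) = j (w \<otimes> ordered_product K (\<lambda>l. dilog_factor (p * (2 * int l - 1)) z) n)"
    and "x \<otimes> w = qi (- 2 * p * int n) \<otimes> (w \<otimes> x) \<Longrightarrow>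
      \<Phi> p z \<otimes>\<^bsub>L\<^esub> j w \<otimes>\<^bsub>L\<^esub> inv\<^bsub>L\<^esub> (\<Phi> p z) = j (w \<otimes> inv (ordered_product K (\<lambda>l. dilog_factor (- p * (2 * int l - 1)) z) n))"
proof -
  note \<Phi> [simp] = \<Phi>_closed[OF p z] \<Phi>_nonzero[OF p z]
  have conj: "\<Phi> p z \<otimes>\<^bsub>L\<^esub> j w \<otimes>\<^bsub>L\<^esub> inv\<^bsub>L\<^esub> (\<Phi> p z) = j (w \<otimes> y)"
    if "y \<in> carrier K" "\<Phi> p z \<otimes>\<^bsub>L\<^esub> j w = j w \<otimes>\<^bsub>L\<^esub> (j y \<otimes>\<^bsub>L\<^esub> \<Phi> p z)" for y
    unfolding that(2) using that(1) w by (simp add: ring_hom_mult[OF j_hom] L.m_assoc)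
  {
    assume c: "x \<otimes> w = qi (2 * p * int n) \<otimes> (w \<otimes> x)"
    show "\<Phi> p z \<otimes>\<^bsub>L\<^esub> j w \<otimes>\<^bsub>L\<^esub> inv\<^bsub>L\<^esub> (\<Phi> p z) = j (w \<otimes> ordered_product K (\<lambda>l. dilog_factor (p * (2 * int l - 1)) z) n)"
      using z \<Phi>_commute[OF p z w c] \<Phi>_product_up[OF p z, of n] by (intro conj) simp_all
  next
    assume c: "x \<otimes> w = qi (- 2 * p * int n) \<otimes> (w \<otimes> x)"
    let ?P = "ordered_product K (\<lambda>l. dilog_factor (- p * (2 * int l - 1)) z) n" 
    let ?z = "qi (- 2 * p * int n) \<otimes> z"
    have z': "central_coeff ?z" using z central_coeff_mult qi_central_coeff by blast
    have P: "?P \<in> carrier K" using z by simp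
    have nz: "j ?P \<noteq> \<zero>\<^bsub>L\<^esub>"
    proof
      assume "j ?P = \<zero>\<^bsub>L\<^esub>"
      then have "\<Phi> p z = \<zero>\<^bsub>L\<^esub>" using \<Phi>_product_down[OF p z, of n] \<Phi>_closed[OF p z'] by simp
      then show False by simp
    qed
    then have P_nz: "?P \<noteq> \<zero>" using ring_hom_zero[OF j_hom I.K.ring_axioms ring_L] by auto
    have "j (inv ?P) \<otimes>\<^bsub>L\<^esub> \<Phi> p z = inv\<^bsub>L\<^esub> (j ?P) \<otimes>\<^bsub>L\<^esub> (j ?P \<otimes>\<^bsub>L\<^esub> \<Phi> p ?z)"
      using \<Phi>_product_down[OF p z, of n] I.K.hom_inv[OF L.skewfield_axioms j_hom P P_nz] by simp
    also have "\<dots> = \<Phi> p ?z" using P nz \<Phi>_closed[OF p z'] by simp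
    finally show "\<Phi> p z \<otimes>\<^bsub>L\<^esub> j w \<otimes>\<^bsub>L\<^esub> inv\<^bsub>L\<^esub> (\<Phi> p z) = j (w \<otimes> inv ?P)"
      using P P_nz \<Phi>_commute[OF p z w c] by (intro conj) simp_all
  }
qed

end

section \<open>Coefficients and the monomial part of the mutation\<close>

lemma t_monomial_single:
  fixes x :: "'i::finite \<Rightarrow> int"
  shows "\<exists>m. t_monomial x = Poly_Mapping.single m 1"
proof -
  have power: "\<exists>m. (Poly_Mapping.single a 1 :: 'i tpoly) ^ n = Poly_Mapping.single m 1" for a n
  proof (induction n)
    case (Suc n)
    then show ?case by (auto simp: mult_single)
  qed (auto intro: exI[of _ 0])
  have "\<exists>m. (\<Prod>i\<in>F. Poly_Mapping.single (Poly_Mapping.single i 1) 1 ^ nat (x i) :: 'i tpoly) = Poly_Mapping.single m 1" for F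
  proof (induction F rule: infinite_finite_induct)
    case (insert i F)
    then obtain m where "(\<Prod>i\<in>F. Poly_Mapping.single (Poly_Mapping.single i 1) 1 ^ nat (x i) :: 'i tpoly) = Poly_Mapping.single m 1"
      by blast
    moreover obtain m' where "(Poly_Mapping.single (Poly_Mapping.single i 1) 1 :: 'i tpoly) ^ nat (x i) = Poly_Mapping.single m' 1"
      using power by blast
    ultimately show ?case using insert.hyps by (auto simp: mult_single)
  qed (auto intro: exI[of _ 0])
  then show ?thesis unfolding t_monomial_def .
qed

lemma t_monomial_nonzero: "t_monomial x \<noteq> 0"
  using t_monomial_single[of x] by (metis lookup_single_eq lookup_zero zero_neq_one)

text \<open>Multiplication by \<open>t\<^sup>x\<close> shifts exponents and is therefore injective.\<close>

lemma t_monomial_regular: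
  assumes "r \<noteq> 0" shows "t_monomial x * r \<noteq> 0"
proof
  obtain m where m: "t_monomial x = Poly_Mapping.single m 1" using t_monomial_single by blast
  have shift: "Poly_Mapping.lookup (t_monomial x * r) (m + a) = Poly_Mapping.lookup r a" for a r
    by (induction r rule: poly_mapping_additive_induct)
      (simp_all add: m mult_single lookup_single when_def distrib_left lookup_add)
  assume "t_monomial x * r = 0"
  then have "r = 0" using shift[of r] by (intro poly_mapping_eqI) simp
  then show False using assms by simp
qed

lemma single_0_t_monomial_regular:
  fixes r :: "'i::finite tpoly qlaurent"
  assumes "r \<noteq> 0" shows "Poly_Mapping.single 0 (t_monomial x) * r \<noteq> 0"
proof
  have shift: "Poly_Mapping.lookup (Poly_Mapping.single 0 (t_monomial x) * r) a = t_monomial x * Poly_Mapping.lookup r a"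
    for a and r :: "'i tpoly qlaurent"
    by (induction r rule: poly_mapping_additive_induct)
      (simp_all add: mult_single lookup_single when_def distrib_left lookup_add)
  assume *: "Poly_Mapping.single 0 (t_monomial x) * r = 0"
  have "Poly_Mapping.lookup r a = 0" for a using shift[of r a] t_monomial_regular * by fastforce
  then show False using assms by (auto intro: poly_mapping_eqI)
qed

lemma t_monomial_nonpos [simp]: "(\<And>i. x i \<le> 0) \<Longrightarrow> t_monomial x = 1"
  by (simp add: t_monomial_def)

lemma t_monomial_scale: "t_monomial (\<lambda>i. int n * x i) = t_monomial x ^ n"
  by (simp add: t_monomial_def nat_mult_distrib power_mult prod_power_distrib mult.commute[of "int n"] mult.commute[of n])
     (simp add: power_mult[symmetric] mult.commute nat_mult_distrib)

lemma plus_part_nonneg: "0 \<le> plus_part c j"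
  by (simp add: plus_part_def)

context torus_field
begin

lemma iota_sum: "finite V \<Longrightarrow> \<iota> (\<Sum>v\<in>V. g v) = (\<Oplus>v\<in>V. \<iota> (g v))"
proof (induction V rule: finite_induct)
  case (insert v V)
  then show ?case by (subst I.K.finsum_insert) (auto simp: iota_add)
qed simp

text \<open>Rescaling the monomial \<open>X\<^sup>v\<close> by \<open>u\<^sup>-\<^sup>d\<^sup>(\<^sup>v\<^sup>)\<close>, for additive \<open>d\<close> and the central \<open>u = s \<rho>\<close>, is a
  homomorphism on the torus. It is injective because, up to a power of \<open>u\<close>, it multiplies each
  coefficient by a power of the regular element \<open>\<rho>\<close>.\<close>

lemma rescaling_hom:
  fixes K' :: "'b ring" and \<iota>' :: "('n \<Rightarrow>\<^sub>0 'c) \<Rightarrow> 'b" and d :: "'n \<Rightarrow> int"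
  assumes K': "fraction_field K' T \<iota>'"
    and d: "\<And>v w. d (v + w) = d v + d w" and \<rho>: "\<And>r. r \<noteq> 0 \<Longrightarrow> \<rho> * r \<noteq> 0"
  shows "\<exists>!h. h \<in> ring_hom K' K \<inter> extensional (carrier K') \<and> (\<forall>r. h (\<iota>' (scalar r)) = s r) \<and>
     (\<forall>v. h (\<iota>' (X_monomial v)) = s \<rho> [^] (- d v) \<otimes> X v)"
proof (rule ex_ex1I)
  interpret K': fraction_field K' T \<iota>' by fact
  define u where "u = s \<rho>"
  have u: "u \<in> carrier K" "u \<noteq> \<zero>" "I.K.central u" using \<rho>[of 1] s_central by (auto simp: u_def)
  have upow: "I.K.central (u [^] (m::int))" for m using I.K.central_int_pow u by blast
  define tw where "tw f = (\<Oplus>v\<in>Poly_Mapping.keys f. u [^] (- d v) \<otimes> \<iota> (Poly_Mapping.single v (Poly_Mapping.lookup f v)))" for f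
  have tw_sum: "tw f = (\<Oplus>v\<in>A. u [^] (- d v) \<otimes> \<iota> (Poly_Mapping.single v (Poly_Mapping.lookup f v)))"
    if "finite A" "Poly_Mapping.keys f \<subseteq> A" for f A
    unfolding tw_def using that u by (intro I.K.add.finprod_mono_neutral_cong_left) (auto simp: in_keys_iff)
  have tw_single: "tw (Poly_Mapping.single v r) = u [^] (- d v) \<otimes> \<iota> (Poly_Mapping.single v r)" for v r
    using u by (subst tw_sum[of "{v}"]) auto
  have tw_closed: "tw f \<in> carrier K" for f unfolding tw_def using u by (intro I.K.finsum_closed) auto
  have tw_add: "tw (f + g) = tw f \<oplus> tw g" for f g
  proof -
    define A where "A = Poly_Mapping.keys f \<union> Poly_Mapping.keys g"
    have A: "finite A" "Poly_Mapping.keys f \<subseteq> A" "Poly_Mapping.keys g \<subseteq> A" "Poly_Mapping.keys (f + g) \<subseteq> A"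
      using keys_add[of f g] by (auto simp: A_def)
    have "tw f \<oplus> tw g = (\<Oplus>v\<in>A. u [^] (- d v) \<otimes> \<iota> (Poly_Mapping.single v (Poly_Mapping.lookup f v))
        \<oplus> u [^] (- d v) \<otimes> \<iota> (Poly_Mapping.single v (Poly_Mapping.lookup g v)))"
      unfolding tw_sum[OF A(1,2)] tw_sum[OF A(1,3)] using u by (intro I.K.finsum_addf[symmetric]) auto
    also have "\<dots> = tw (f + g)"
      unfolding tw_sum[OF A(1,4)] using u by (simp add: lookup_add single_add iota_add I.K.r_distr)
    finally show ?thesis ..
  qed
  have d0: "d 0 = 0" using d[of 0 0] by simp
  have tw_mult: "tw (f \<otimes>\<^bsub>T\<^esub> g) = tw f \<otimes> tw g" for f g
  proof (induction f rule: poly_mapping_additive_induct)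
    case (single v r)
    show ?case
    proof (induction g rule: poly_mapping_additive_induct)
      case (single w r')
      let ?f = "\<iota> (Poly_Mapping.single v r)" and ?g = "\<iota> (Poly_Mapping.single w r')"
      let ?a = "u [^] (- d v)" and ?b = "u [^] (- d w)"
      have ab: "?a \<in> carrier K" "?b \<in> carrier K" using u by simp_all
      have "- d (v + w) = - d v + - d w" by (simp add: d)
      then have "u [^] (- d (v + w)) = ?a \<otimes> ?b" by (simp only: I.K.int_pow_add[OF u(1,2)])
      then have "tw (Poly_Mapping.single v r \<otimes>\<^bsub>T\<^esub> Poly_Mapping.single w r') = ?a \<otimes> ?b \<otimes> (?f \<otimes> ?g)"
        unfolding iota_mult[symmetric] single_mult_single tw_single by simp
      also have "\<dots> = ?a \<otimes> (?b \<otimes> ?f) \<otimes> ?g" using ab by (simp add: I.K.m_assoc)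
      also have "?b \<otimes> ?f = ?f \<otimes> ?b" by (rule I.K.central_commute[OF upow]) simp
      also have "?a \<otimes> (?f \<otimes> ?b) \<otimes> ?g = (?a \<otimes> ?f) \<otimes> (?b \<otimes> ?g)" using ab by (simp add: I.K.m_assoc)
      finally show ?case unfolding tw_single .
    qed (simp add: mult_add_right tw_add I.K.r_distr tw_closed)
  qed (simp add: mult_add_left tw_add I.K.l_distr tw_closed)
  have tw_1: "tw 1 = \<one>" using tw_single[of 0 1] by (simp add: d0)
  have tw_nz: "tw f \<noteq> \<zero>" if f: "f \<noteq> 0" for f
  proof
    assume *: "tw f = \<zero>"
    \<comment> \<open>Multiplying by \<open>u\<^sup>N\<close> makes all exponents of \<open>u\<close> nonnegative, so that the sum comes from the torus.\<close>
    define N where "N = Max (d ` Poly_Mapping.keys f)"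
    have N: "d v \<le> N" if "v \<in> Poly_Mapping.keys f" for v using that by (simp add: N_def)
    define g where "g = (\<Sum>v\<in>Poly_Mapping.keys f. Poly_Mapping.single v (\<rho> ^ nat (N - d v) * Poly_Mapping.lookup f v))"
    have "s (\<rho> ^ n) = u [^] n" for n
    proof (induction n)
      case (Suc n)
      then show ?case
        using I.K.central_commute[OF s_central, of "u [^] n" \<rho>] by (simp add: s_hom u_def)
    qed (simp add: s_hom)
    then have s_pow: "s (\<rho> ^ n) = u [^] int n" for n
      by (simp add: int_pow_int)
    have "\<iota> g = (\<Oplus>v\<in>Poly_Mapping.keys f. \<iota> (Poly_Mapping.single v (\<rho> ^ nat (N - d v) * Poly_Mapping.lookup f v)))"
      unfolding g_def by (rule iota_sum) simp
    also have "\<dots> = (\<Oplus>v\<in>Poly_Mapping.keys f. u [^] N \<otimes> (u [^] (- d v) \<otimes> \<iota> (Poly_Mapping.single v (Poly_Mapping.lookup f v))))"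
    proof (rule I.K.finsum_cong')
      fix v assume "v \<in> Poly_Mapping.keys f"
      then have n: "int (nat (N - d v)) = N + - d v" using N by simp
      have "\<iota> (Poly_Mapping.single v (\<rho> ^ nat (N - d v) * Poly_Mapping.lookup f v)) =
          u [^] (N + - d v) \<otimes> (s (Poly_Mapping.lookup f v) \<otimes> X v)"
        unfolding iota_single s_hom s_pow n using u by (simp add: I.K.m_assoc)
      then show "\<iota> (Poly_Mapping.single v (\<rho> ^ nat (N - d v) * Poly_Mapping.lookup f v)) =
          u [^] N \<otimes> (u [^] (- d v) \<otimes> \<iota> (Poly_Mapping.single v (Poly_Mapping.lookup f v)))"
        unfolding I.K.int_pow_add[OF u(1,2)] iota_single using u by (simp add: I.K.m_assoc)
    qed (use u in auto)
    also have "\<dots> = u [^] N \<otimes> tw f"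
      unfolding tw_def using u by (intro I.K.finsum_rdistr[symmetric]) auto
    finally have "g = 0" using * u by simp
    obtain v where v: "Poly_Mapping.lookup f v \<noteq> 0" using f by (metis lookup_zero poly_mapping_eqI)
    have "Poly_Mapping.lookup g v = \<rho> ^ nat (N - d v) * Poly_Mapping.lookup f v"
      using v by (simp add: g_def lookup_sum lookup_single when_def in_keys_iff)
    moreover have "\<rho> ^ n * Poly_Mapping.lookup f v \<noteq> 0" for n
      by (induction n) (use v \<rho> in \<open>auto simp: mult.assoc\<close>)
    ultimately show False using \<open>g = 0\<close> by simp
  qed
  have "tw \<in> ring_hom T K"
    by (rule ring_hom_memI) (simp_all add: tw_closed tw_mult tw_add tw_1)
  then obtain h where h: "h \<in> ring_hom K' K \<inter> extensional (carrier K')" "\<And>f. h (\<iota>' f) = tw f"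
    using K'.extend_hom[OF I.K.skewfield_axioms, of tw] tw_nz by auto
  have "tw (scalar r) = s r" for r unfolding scalar_def tw_single by (simp add: d0 s_def scalar_def)
  moreover have "tw (X_monomial v) = s \<rho> [^] (- d v) \<otimes> X v" for v
    unfolding X_monomial_def tw_single u_def X_def ..
  ultimately show "\<exists>h. h \<in> ring_hom K' K \<inter> extensional (carrier K') \<and> (\<forall>r. h (\<iota>' (scalar r)) = s r) \<and>
     (\<forall>v. h (\<iota>' (X_monomial v)) = s \<rho> [^] (- d v) \<otimes> X v)"
    using h by auto
next
  interpret K': fraction_field K' T \<iota>' by fact
  fix g h
  assume g: "g \<in> ring_hom K' K \<inter> extensional (carrier K') \<and> (\<forall>r. g (\<iota>' (scalar r)) = s r) \<and>
     (\<forall>v. g (\<iota>' (X_monomial v)) = s \<rho> [^] (- d v) \<otimes> X v)"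
    and h: "h \<in> ring_hom K' K \<inter> extensional (carrier K') \<and> (\<forall>r. h (\<iota>' (scalar r)) = s r) \<and>
     (\<forall>v. h (\<iota>' (X_monomial v)) = s \<rho> [^] (- d v) \<otimes> X v)"
  then have gh: "g \<in> ring_hom K' K" "h \<in> ring_hom K' K" by auto
  have c: "\<iota>' f \<in> carrier K'" for f using K'.closed by simp
  have T: "g (\<iota>' f) = h (\<iota>' f)" for f
  proof (induction f rule: poly_mapping_additive_induct)
    case (single v r)
    have "\<iota>' (Poly_Mapping.single v r) = \<iota>' (scalar r) \<otimes>\<^bsub>K'\<^esub> \<iota>' (X_monomial v)"
      unfolding single_eq_scalar by (rule K'.mult) simp_all
    then show ?case using g h by (simp add: ring_hom_mult[OF gh(1)] ring_hom_mult[OF gh(2)] c)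
  next
    case (add f f')
    then show ?case
      using K'.add[of f f'] ring_hom_add[OF gh(1) c c, of f f'] ring_hom_add[OF gh(2) c c, of f f'] by simp
  qed
  have "g y = h y" if "y \<in> carrier K'" for y
    using K'.hom_eqI[OF I.K.skewfield_axioms gh T that] .
  then show "g = h" using g h by (intro extensionalityI[of _ "carrier K'"]) auto
qed

end

section \<open>The quantum mutation\<close>

locale quantum_mutation = graded_torus_field \<Gamma> B T K \<iota> e k deg
  for \<Gamma> :: "('i::finite, 'n::ab_group_add) fixed_data" and B
    and T :: "('n \<Rightarrow>\<^sub>0 'i tpoly qlaurent) ring"
    and K :: "'a ring" (structure) and \<iota> and e k deg +
  fixes c :: "'i \<Rightarrow> int"
  assumes fixed: "is_fixed_data \<Gamma>" and basis: "integral_basis \<Gamma> e"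
begin

text \<open>With this exponent \<open>q\<^sub>k = q\<^sup>p\<^sup>/\<^sup>d\<close>, that is, \<open>p = d / d\<^sub>k\<close>.\<close>

definition p :: int where "p = q_exponent \<Gamma> (1 / of_nat (mlt \<Gamma> k))"

definition wt :: "'n \<Rightarrow> int" where "wt v = \<lfloor>form \<Gamma> v (e k) * of_nat (mlt \<Gamma> k)\<rfloor>"

definition coeff :: "('i \<Rightarrow> int) \<Rightarrow> 'a" where "coeff y = s (Poly_Mapping.single 0 (t_monomial (plus_part y)))"

lemma mlt_k_pos: "0 < mlt \<Gamma> k"
  using mlt_pos[OF fixed] .

lemma Lcm_p: obtains n where "Lcm (range (mlt \<Gamma>)) = n * mlt \<Gamma> k" "0 < n" "p = int n"
proof -
  obtain n where n: "Lcm (range (mlt \<Gamma>)) = n * mlt \<Gamma> k" "0 < n" using Lcm_mlt[OF fixed] .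
  have "p = int n" unfolding p_def q_exponent_def n(1) using mlt_k_pos by (simp add: floor_eq_iff)
  then show ?thesis using that n by blast
qed

lemma p_pos: "0 < p"
  using Lcm_p by (metis of_nat_0_less_iff)

lemma q_exponent_multiple: "q_exponent \<Gamma> (of_int m / of_nat (mlt \<Gamma> k)) = p * m"
proof -
  obtain n where n: "Lcm (range (mlt \<Gamma>)) = n * mlt \<Gamma> k" "0 < n" "p = int n" using Lcm_p .
  have "of_nat (Lcm (range (mlt \<Gamma>))) * (of_int m / of_nat (mlt \<Gamma> k)) = (of_int (p * m) :: rat)"
    unfolding n using mlt_k_pos by simp
  then show ?thesis unfolding q_exponent_def by (simp only: floor_of_int)
qed

lemma q_in_multiple: "q_in \<Gamma> \<iota> (of_int m / of_nat (mlt \<Gamma> k)) = qi (p * m)"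
  unfolding q_in_def q_exponent_multiple qi_def s_def ..

lemma wt_exact: "of_int (wt v) = form \<Gamma> v (e k) * of_nat (mlt \<Gamma> k)"
  using form_mlt_integral[OF fixed basis, of v k] unfolding wt_def by (metis Ints_cases floor_of_int)

lemma wt_add: "wt (v + w) = wt v + wt w"
proof -
  have "(of_int (wt (v + w)) :: rat) = of_int (wt v + wt w)"
    unfolding of_int_add wt_exact by (simp only: form_add[OF fixed] distrib_right)
  then show ?thesis by (simp only: of_int_eq_iff)
qed

lemma wt_exch: "wt (e i) = exch \<Gamma> e i k"
  by (simp add: wt_def exch_def)

lemma wt_ek: "wt (e k) = 0"
  by (simp add: wt_def form_self[OF fixed])

lemma B_ek: "B v (e k) = p * wt v"
proof -
  obtain n where n: "Lcm (range (mlt \<Gamma>)) = n * mlt \<Gamma> k" "0 < n" "p = int n" using Lcm_p .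
  have "of_nat (Lcm (range (mlt \<Gamma>))) * form \<Gamma> v (e k) = (of_int (p * wt v) :: rat)"
    unfolding n of_int_mult wt_exact by simp
  then show ?thesis unfolding B_def q_exponent_def by (simp only: floor_of_int)
qed

lemma coeff_central: "central_coeff (coeff y)"
  using D_iota[OF homog_single[of 0, unfolded deg_zero]] s_central
  by (simp add: coeff_def central_coeff_def s_def scalar_def)

lemma coeff_closed [simp]: "coeff y \<in> carrier K"
  by (simp add: coeff_def)

lemma coeff_nonzero [simp]: "coeff y \<noteq> \<zero>"
  unfolding coeff_def s_eq_0 using t_monomial_nonzero by (metis lookup_single_eq lookup_zero)

lemma t_in_plus_part: "t_in K (R_in_quantum \<iota>) (plus_part y) = coeff y"
  using plus_part_nonneg[of y]
  by (simp add: t_in_def R_in_quantum_def coeff_def s_def[symmetric] s_hom I.K.inv_one)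

lemma t_in_multiple: "t_in K (R_in_quantum \<iota>) (\<lambda>i. - m * plus_part y i) = coeff y [^] (- m)"
proof -
  have pow: "s (Poly_Mapping.single 0 (t_monomial (plus_part y) ^ n)) = coeff y [^] n" for n
  proof (induction n)
    case (Suc n)
    have "(Poly_Mapping.single 0 (t_monomial (plus_part y) ^ Suc n) :: 'i tpoly qlaurent) =
      Poly_Mapping.single 0 (t_monomial (plus_part y) ^ n) * Poly_Mapping.single 0 (t_monomial (plus_part y))"
      by (simp add: mult_single mult.commute)
    then show ?case by (simp add: s_hom Suc) (simp add: coeff_def)
  qed (simp add: s_hom)
  show ?thesis
  proof (cases m rule: int_cases2)
    case (nonneg n)
    have "t_monomial (\<lambda>i. - m * plus_part y i) = 1"
      using nonneg plus_part_nonneg[of y] by (intro t_monomial_nonpos) simp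
    moreover have "t_monomial (\<lambda>i. - (- m * plus_part y i)) = t_monomial (plus_part y) ^ n"
      using t_monomial_scale[of n "plus_part y"] nonneg by simp
    ultimately show ?thesis
      using nonneg I.K.nat_pow_nonzero[of "coeff y" n] I.K.int_pow_minus[of "coeff y" "int n"]
      by (simp add: t_in_def R_in_quantum_def s_def[symmetric] pow s_hom int_pow_int)
  next
    case (nonpos n)
    have "t_monomial (\<lambda>i. - (- m * plus_part y i)) = 1"
      using nonpos plus_part_nonneg[of y] by (intro t_monomial_nonpos) (simp add: mult_nonneg_nonneg)
    moreover have "t_monomial (\<lambda>i. - m * plus_part y i) = t_monomial (plus_part y) ^ n"
      using t_monomial_scale[of n "plus_part y"] nonpos by simp
    ultimately show ?thesis
      using nonpos by (simp add: t_in_def R_in_quantum_def s_def[symmetric] pow s_hom I.K.inv_one int_pow_int)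
  qed
qed

definition tP :: 'a where "tP = coeff c"

definition tM :: 'a where "tM = coeff (\<lambda>j. - c j)"

definition z :: 'a where "z = tP \<otimes> inv tM"

lemma tPM [simp]: "tP \<in> carrier K" "tM \<in> carrier K" "tP \<noteq> \<zero>" "tM \<noteq> \<zero>"
  by (simp_all add: tP_def tM_def)

lemma tPM_central: "central_coeff tP" "central_coeff tM"
  by (simp_all add: tP_def tM_def coeff_central)

lemma z_central: "central_coeff z"
  unfolding z_def by (intro central_coeff_mult central_coeff_inv tPM_central tPM)

lemma z_closed [simp]: "z \<in> carrier K"
  using central_coeffD(1)[OF z_central] .

lemma tM_z: "tM \<otimes> z = tP"
  using central_coeffD(3)[OF z_central, of tM] by (simp add: z_def)

lemma mu_prime_monomial:
  assumes "fraction_field K' T \<iota>'"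
  shows "mu_prime \<Gamma> e c k K' \<iota>' K \<iota> (\<iota>' (X_monomial v)) = tM [^] (- wt v) \<otimes> X v"
proof -
  let ?\<rho> = "Poly_Mapping.single 0 (t_monomial (plus_part (\<lambda>j. - c j))) :: 'i tpoly qlaurent"
  let ?P = "\<lambda>h. h \<in> ring_hom K' K \<inter> extensional (carrier K') \<and> (\<forall>r. h (\<iota>' (scalar r)) = s r) \<and>
     (\<forall>v. h (\<iota>' (X_monomial v)) = s ?\<rho> [^] (- wt v) \<otimes> X v)"
  have "\<exists>!h. ?P h" by (rule rescaling_hom[OF assms wt_add single_0_t_monomial_regular])
  moreover have "mu_prime \<Gamma> e c k K' \<iota>' K \<iota> = (THE h. ?P h)"
    unfolding mu_prime_def t_in_multiple wt_def[symmetric] coeff_def s_def X_def ..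
  ultimately have "?P (mu_prime \<Gamma> e c k K' \<iota>' K \<iota>)" using theI'[of ?P] by simp
  then show ?thesis by (simp add: tM_def coeff_def)
qed

text \<open>The Laurent embedding is injective, so reading the result back in \<open>K\<close> is unambiguous.\<close>

lemma mu_sharp_eq:
  assumes "y \<in> carrier K" "\<Phi> p z \<otimes>\<^bsub>L\<^esub> j w \<otimes>\<^bsub>L\<^esub> inv\<^bsub>L\<^esub> (\<Phi> p z) = j y"
  shows "mu_sharp \<Gamma> e c k K \<iota> w = y"
proof -
  have "dilog_series (coefficient_field \<Gamma> e K \<iota> k) (q_in \<Gamma> \<iota> (1 / of_nat (mlt \<Gamma> k)))
     (t_in K (R_in_quantum \<iota>) (plus_part c) \<otimes> inv (t_in K (R_in_quantum \<iota>) (plus_part (\<lambda>j. - c j)))) = \<Phi> p z"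
    unfolding t_in_plus_part \<Phi>_def D_def z_def tP_def tM_def
    using q_in_multiple[of 1] by simp
  then have "mu_sharp \<Gamma> e c k K \<iota> w = inv_into (carrier K) j (j y)"
    unfolding mu_sharp_def Let_def L_eq j_def[symmetric] by (simp only: assms(2))
  then show ?thesis using j_inj assms(1) by simp
qed

text \<open>The monomial map multiplies \<open>X\<^sup>v\<close> by a central element, and \<open>X_k\<close> commutes with the result up to
  \<open>q\<^sub>k\<close> to the power \<open>-2 wt v\<close>, so \<open>conjugate_dilog\<close> applies.\<close>

lemma mu_quantum_monomial:
  assumes K': "fraction_field K' T \<iota>'"
  shows "wt v = - int n \<Longrightarrow> mu_quantum \<Gamma> e c k K' \<iota>' K \<iota> (\<iota>' (X_monomial v)) =
      tM [^] n \<otimes> X v \<otimes> ordered_product K (\<lambda>l. dilog_factor (p * (2 * int l - 1)) z) n"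
    and "wt v = int n \<Longrightarrow> mu_quantum \<Gamma> e c k K' \<iota>' K \<iota> (\<iota>' (X_monomial v)) =
      tM [^] (- int n) \<otimes> X v \<otimes> inv (ordered_product K (\<lambda>l. dilog_factor (- p * (2 * int l - 1)) z) n)"
proof -
  define u where "u = tM [^] (- wt v)"
  define w where "w = u \<otimes> X v"
  have u: "central_coeff u"
  proof -
    have "central_coeff (tM [^] m)" for m :: nat by (intro central_coeff_pow tPM_central)
    then show ?thesis unfolding u_def
      using central_coeff_inv I.K.nat_pow_nonzero[of tM]
      by (cases "- wt v" rule: int_cases2) (simp_all add: int_pow_int I.K.int_pow_minus)
  qed
  note uK = central_coeffD(1)[OF u]
  have w: "w \<in> carrier K" using uK by (simp add: w_def)
  have wD: "w \<otimes> x [^] (- deg v) \<in> carrier D"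
  proof -
    have "X v \<otimes> x [^] (- deg v) \<in> carrier D"
      using homog_coeff[OF homog_single[of v 1]] by (simp add: X_def X_monomial_def)
    then have "u \<otimes>\<^bsub>D\<^esub> (X v \<otimes> x [^] (- deg v)) \<in> carrier D"
      using D.m_closed central_coeffD(2)[OF u] by blast
    then show ?thesis using uK by (simp add: w_def I.K.m_assoc)
  qed
  have comm: "x \<otimes> w = qi (- 2 * p * wt v) \<otimes> (w \<otimes> x)"
  proof -
    have "x \<otimes> w = u \<otimes> (x \<otimes> X v)"
      using uK central_coeffD(3)[OF u x_closed] unfolding w_def by (simp flip: I.K.m_assoc)
    also have "x \<otimes> X v = qi (2 * B (e k) v) \<otimes> (X v \<otimes> x)"
      unfolding x_def qi_def by (rule X_commute)
    also have "2 * B (e k) v = - 2 * p * wt v" using B_antisym[of "e k" v] B_ek[of v] by simp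
    also have "u \<otimes> (qi (- 2 * p * wt v) \<otimes> (X v \<otimes> x)) = (u \<otimes> qi (- 2 * p * wt v)) \<otimes> (X v \<otimes> x)"
      using uK by (simp add: I.K.m_assoc)
    also have "u \<otimes> qi (- 2 * p * wt v) = qi (- 2 * p * wt v) \<otimes> u"
      by (rule central_coeffD(3)[OF u]) simp
    finally show ?thesis using uK by (simp add: w_def I.K.m_assoc)
  qed
  have mu: "mu_quantum \<Gamma> e c k K' \<iota>' K \<iota> (\<iota>' (X_monomial v)) = mu_sharp \<Gamma> e c k K \<iota> w"
    by (simp add: mu_quantum_def mu_prime_monomial[OF K'] w_def u_def)
  note conj = conjugate_dilog[OF p_pos z_central w wD]
  {
    assume n: "wt v = - int n"
    have "mu_sharp \<Gamma> e c k K \<iota> w = w \<otimes> ordered_product K (\<lambda>l. dilog_factor (p * (2 * int l - 1)) z) n"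
      using w z_central comm by (intro mu_sharp_eq conj(1)) (simp_all add: n)
    then show "mu_quantum \<Gamma> e c k K' \<iota>' K \<iota> (\<iota>' (X_monomial v)) =
      tM [^] n \<otimes> X v \<otimes> ordered_product K (\<lambda>l. dilog_factor (p * (2 * int l - 1)) z) n"
      unfolding mu by (simp add: w_def u_def n int_pow_int)
  next
    assume n: "wt v = int n"
    have "ordered_product K (\<lambda>l. dilog_factor (- p * (2 * int l - 1)) z) n \<noteq> \<zero>"
      by (intro I.K.ordered_product_nonzero dilog_factor_closed dilog_factor_nonzero z_central)
    then have "mu_sharp \<Gamma> e c k K \<iota> w = w \<otimes> inv (ordered_product K (\<lambda>l. dilog_factor (- p * (2 * int l - 1)) z) n)"
      using w z_central comm by (intro mu_sharp_eq conj(2)) (simp_all add: n)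
    then show "mu_quantum \<Gamma> e c k K' \<iota>' K \<iota> (\<iota>' (X_monomial v)) =
      tM [^] (- int n) \<otimes> X v \<otimes> inv (ordered_product K (\<lambda>l. dilog_factor (- p * (2 * int l - 1)) z) n)"
      unfolding mu by (simp add: w_def u_def n)
  }
qed

end

lemma (in skewfield) ordered_product_const:
  "a \<in> carrier K \<Longrightarrow> ordered_product K (\<lambda>_. a) n = a [^] n"
  by (induction n) (simp_all add: ordered_product_Suc)

context quantum_mutation
begin

text \<open>Both orders of multiplication give the same result; this evaluates the factors for
  \<open>\<epsilon> > 0\<close> and shows that they commute.\<close>

lemma x_inverse_commute:
  assumes "central_coeff a" "central_coeff b"
  shows "(\<one> \<oplus> a \<otimes> x) \<otimes> (b \<otimes> inv x) = b \<otimes> inv x \<oplus> a \<otimes> b"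
    "(b \<otimes> inv x) \<otimes> (\<one> \<oplus> a \<otimes> x) = b \<otimes> inv x \<oplus> a \<otimes> b"
proof -
  note ab = central_coeffD(1)[OF assms(1)] central_coeffD(1)[OF assms(2)]
  have "x \<otimes> (b \<otimes> inv x) = (b \<otimes> x) \<otimes> inv x"
    unfolding central_coeffD(3)[OF assms(2) x_closed] using ab by (simp add: I.K.m_assoc)
  then have "x \<otimes> (b \<otimes> inv x) = b" using ab by simp
  then have "(a \<otimes> x) \<otimes> (b \<otimes> inv x) = a \<otimes> b"
    using ab by (simp add: I.K.m_assoc)
  then show "(\<one> \<oplus> a \<otimes> x) \<otimes> (b \<otimes> inv x) = b \<otimes> inv x \<oplus> a \<otimes> b"
    using ab by (simp add: I.K.l_distr)
  have "inv x \<otimes> (a \<otimes> x) = a"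
    unfolding central_coeffD(3)[OF assms(1) x_closed] using ab by simp
  then have "(b \<otimes> inv x) \<otimes> (a \<otimes> x) = a \<otimes> b"
    using ab central_coeffD(3)[OF assms(1) ab(2)] by (simp add: I.K.m_assoc)
  then show "(b \<otimes> inv x) \<otimes> (\<one> \<oplus> a \<otimes> x) = b \<otimes> inv x \<oplus> a \<otimes> b"
    using ab by (simp add: I.K.r_distr)
qed

text \<open>A factor of the formula for \<open>\<epsilon> < 0\<close> is \<open>tM\<close> times a factor of the dilogarithm quotient, because
  \<open>tM z = tP\<close>.\<close>

lemma product_negative:
  "ordered_product K (\<lambda>l. tM \<oplus> tP \<otimes> qi (p * (2 * int l - 1)) \<otimes> x) n =
   tM [^] n \<otimes> ordered_product K (\<lambda>l. dilog_factor (p * (2 * int l - 1)) z) n"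
proof -
  have "tM \<oplus> tP \<otimes> qi m \<otimes> x = tM \<otimes> dilog_factor m z" for m
  proof -
    have "tM \<otimes> dilog_factor m z = tM \<oplus> (tM \<otimes> (qi m \<otimes> z)) \<otimes> x"
      by (simp add: dilog_factor_def I.K.r_distr I.K.m_assoc)
    also have "qi m \<otimes> z = z \<otimes> qi m" by (rule central_coeffD(3)[OF qi_central_coeff]) simp
    also have "tM \<otimes> (z \<otimes> qi m) = tP \<otimes> qi m" unfolding tM_z[symmetric] by (simp add: I.K.m_assoc)
    finally show ?thesis ..
  qed
  then have "ordered_product K (\<lambda>l. tM \<oplus> tP \<otimes> qi (p * (2 * int l - 1)) \<otimes> x) n =
      ordered_product K (\<lambda>l. tM \<otimes> dilog_factor (p * (2 * int l - 1)) z) n" by simp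
  also have "\<dots> = ordered_product K (\<lambda>_. tM) n \<otimes> ordered_product K (\<lambda>l. dilog_factor (p * (2 * int l - 1)) z) n"
    using z_central by (intro I.K.ordered_product_mult) (simp_all add: central_coeffD(3)[OF tPM_central(2)])
  finally show ?thesis by (simp add: I.K.ordered_product_const)
qed

text \<open>For \<open>\<epsilon> > 0\<close> the monomial \<open>tM q\<^sub>k\<^sup>2\<^sup>l\<^sup>-\<^sup>1 X_k\<^sup>-\<^sup>1\<close> is extracted from the \<open>l\<close>-th factor. The exponents of
  \<open>q\<^sub>k\<close> in these monomials add up to \<open>1 + 3 + \<cdots> + (2n - 1) = n\<^sup>2\<close>.\<close>

lemma product_positive:
  "ordered_product K (\<lambda>l. tP \<oplus> tM \<otimes> qi (p * (2 * int l - 1)) \<otimes> inv x) n =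
   ordered_product K (\<lambda>l. dilog_factor (- p * (2 * int l - 1)) z) n \<otimes>
     (tM [^] n \<otimes> qi (p * int n * int n) \<otimes> X (zmul (- int n) (e k)))"
proof -
  let ?a = "\<lambda>l. tM \<otimes> qi (p * (2 * int l - 1)) \<otimes> inv x"
  let ?f = "\<lambda>l. dilog_factor (- p * (2 * int l - 1)) z"
  have c: "central_coeff (tM \<otimes> qi m)" "central_coeff (qi m \<otimes> z)" for m
    by (intro central_coeff_mult tPM_central qi_central_coeff z_central)+
  have "?f l \<otimes> ?a l = tP \<oplus> ?a l" for l
  proof -
    let ?m = "p * (2 * int l - 1)"
    have "qi (- ?m) \<otimes> z \<otimes> (tM \<otimes> qi ?m) = (tM \<otimes> qi ?m) \<otimes> (qi (- ?m) \<otimes> z)"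
      by (rule central_coeffD(3)[OF c(2)]) simp
    also have "\<dots> = tM \<otimes> (qi (?m + - ?m) \<otimes> z)" unfolding qi_add by (simp add: I.K.m_assoc)
    also have "\<dots> = tP" by (simp add: tM_z)
    finally show ?thesis
      unfolding dilog_factor_def using x_inverse_commute(1)[OF c(2,1), of "- ?m" ?m] by (simp add: I.K.a_comm)
  qed
  then have "ordered_product K (\<lambda>l. tP \<oplus> ?a l) n = ordered_product K (\<lambda>l. ?f l \<otimes> ?a l) n" by simp
  also have "\<dots> = ordered_product K ?f n \<otimes> ordered_product K ?a n"
  proof (rule I.K.ordered_product_mult)
    fix i l show "?f i \<otimes> ?a l = ?a l \<otimes> ?f i"
      unfolding dilog_factor_def x_inverse_commute[OF c(2,1)] ..
  qed (use z_central in auto)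
  also have "ordered_product K ?a n = tM [^] n \<otimes> qi (p * int n * int n) \<otimes> X (zmul (- int n) (e k))"
  proof (induction n)
    case (Suc n)
    define Q where "Q = tM [^] n"
    define q where "q = qi (p * int n * int n)"
    define q' where "q' = qi (p * (2 * int (Suc n) - 1))"
    define y where "y = X (zmul (- int n) (e k))"
    have cl: "Q \<in> carrier K" "q \<in> carrier K" "q' \<in> carrier K" "y \<in> carrier K"
      by (simp_all add: Q_def q_def q'_def y_def)
    have cq: "central_coeff (tM \<otimes> q')" unfolding q'_def by (rule c)
    have y': "y \<otimes> inv x = X (zmul (- int (Suc n)) (e k))"
    proof -
      have "y \<otimes> inv x = X (zmul (- int n) (e k) + - e k)"
        unfolding y_def x_def X_inverse by (rule X_mult_orthogonal) (simp add: B_zmul)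
      moreover have "zmul (- int n) (e k) + - e k = zmul (- int (Suc n)) (e k)"
      proof -
        have *: "- int (Suc n) = - int n - 1" by simp
        show ?thesis unfolding * zmul_diff by simp
      qed
      ultimately show ?thesis by (simp only:)
    qed
    have "p * int (Suc n) * int (Suc n) = p * int n * int n + p * (2 * int (Suc n) - 1)" by (simp add: algebra_simps)
    then have q2: "qi (p * int (Suc n) * int (Suc n)) = q \<otimes> q'" by (simp only: qi_add q_def q'_def)
    have "ordered_product K ?a (Suc n) = (Q \<otimes> q \<otimes> y) \<otimes> (tM \<otimes> q' \<otimes> inv x)"
      using Suc by (simp add: I.K.ordered_product_Suc Q_def q_def q'_def y_def)
    also have "\<dots> = Q \<otimes> (q \<otimes> (y \<otimes> (tM \<otimes> q'))) \<otimes> inv x" using cl by (simp add: I.K.m_assoc)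
    also have "y \<otimes> (tM \<otimes> q') = (tM \<otimes> q') \<otimes> y" using central_coeffD(3)[OF cq cl(4)] ..
    also have "q \<otimes> (tM \<otimes> q' \<otimes> y) = (q \<otimes> tM) \<otimes> (q' \<otimes> y)" using cl by (simp add: I.K.m_assoc)
    also have "q \<otimes> tM = tM \<otimes> q" using central_coeffD(3)[OF tPM_central(2) cl(2)] ..
    also have "Q \<otimes> (tM \<otimes> q \<otimes> (q' \<otimes> y)) \<otimes> inv x = (Q \<otimes> tM) \<otimes> (q \<otimes> q') \<otimes> (y \<otimes> inv x)"
      using cl by (simp add: I.K.m_assoc)
    finally show ?case unfolding y' q2[symmetric] by (simp add: Q_def)
  qed simp
  finally show ?thesis .
qed

text \<open>For \<open>\<epsilon> > 0\<close> the exponent \<open>e\<^sub>i\<close> is recovered from \<open>e\<^sub>i' = e\<^sub>i + \<epsilon> e\<^sub>k\<close> with the help of the monomial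
  extracted in \<open>product_positive\<close>, whose power of \<open>q\<^sub>k\<close> compensates the one from multiplying \<open>X\<^sup>v\<close> by \<open>X_k\<^sup>-\<^sup>n\<close>.\<close>

theorem mu_quantum_cluster_variable:
  assumes K': "fraction_field K' T \<iota>'"
  shows "mu_quantum \<Gamma> e c k K' \<iota>' K \<iota> (\<iota>' (X_monomial (seed_mutation \<Gamma> k e i))) =
    (if i = k then inv x
     else X (e i) \<otimes> ordered_product K
       (\<lambda>l. coeff (\<lambda>j. sgn (exch \<Gamma> e i k) * c j) \<oplus> coeff (\<lambda>j. - sgn (exch \<Gamma> e i k) * c j) \<otimes>
          qi (p * (2 * int l - 1)) \<otimes> x [^] (- sgn (exch \<Gamma> e i k)))
       (nat \<bar>exch \<Gamma> e i k\<bar>) [^] (- sgn (exch \<Gamma> e i k)))"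
proof (cases "i = k")
  case True
  have "wt (- e k) = - int 0" using wt_add[of "e k" "- e k"] wt_add[of 0 0] wt_ek by simp
  from mu_quantum_monomial(1)[OF K' this] show ?thesis
    using True by (simp add: seed_mutation_def x_def X_inverse)
next
  case False
  define \<epsilon> where "\<epsilon> = exch \<Gamma> e i k"
  consider "\<epsilon> \<le> 0" | "\<epsilon> > 0" by linarith
  then show ?thesis
  proof cases
    case 1
    define n where "n = nat (- \<epsilon>)"
    have n: "\<epsilon> = - int n" using 1 by (simp add: n_def)
    have e': "seed_mutation \<Gamma> k e i = e i" using False 1 by (simp add: seed_mutation_def \<epsilon>_def max_def)
    have "wt (e i) = - int n" using n by (simp add: wt_exch \<epsilon>_def)
    from mu_quantum_monomial(1)[OF K' this]
    have mu: "mu_quantum \<Gamma> e c k K' \<iota>' K \<iota> (\<iota>' (X_monomial (e i))) =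
        tM [^] n \<otimes> X (e i) \<otimes> ordered_product K (\<lambda>l. dilog_factor (p * (2 * int l - 1)) z) n" .
    also have "\<dots> = X (e i) \<otimes> (tM [^] n \<otimes> ordered_product K (\<lambda>l. dilog_factor (p * (2 * int l - 1)) z) n)"
      using central_coeffD(3)[OF central_coeff_pow[OF tPM_central(2)], of "X (e i)" n] z_central
      by (simp add: I.K.m_assoc)
    also have "\<dots> = X (e i) \<otimes> ordered_product K (\<lambda>l. tM \<oplus> tP \<otimes> qi (p * (2 * int l - 1)) \<otimes> x) n"
      by (simp only: product_negative)
    finally have res: "mu_quantum \<Gamma> e c k K' \<iota>' K \<iota> (\<iota>' (X_monomial (seed_mutation \<Gamma> k e i))) = \<dots>"
      unfolding e' .
    show ?thesis
    proof (cases "n = 0")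
      case True
      then have "\<epsilon> = 0" using n by simp
      then show ?thesis using res \<open>i \<noteq> k\<close> unfolding \<epsilon>_def[symmetric] by (simp add: True)
    next
      case n0: False
      then have "sgn \<epsilon> = -1" "nat \<bar>\<epsilon>\<bar> = n" using n by simp_all
      then show ?thesis using res \<open>i \<noteq> k\<close> unfolding \<epsilon>_def[symmetric] by (simp add: tP_def tM_def)
    qed
  next
    case 2
    define n where "n = nat \<epsilon>"
    have n: "\<epsilon> = int n" "n \<noteq> 0" using 2 by (simp_all add: n_def)
    define v where "v = e i + zmul (int n) (e k)"
    have e': "seed_mutation \<Gamma> k e i = v" using False 2 n by (simp add: seed_mutation_def \<epsilon>_def v_def max_def)
    have "wt v = wt (e i) + int n * wt (e k)" using additive_zmul[of wt, OF wt_add] by (simp add: v_def wt_add)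
    then have "wt v = int n" using n wt_ek wt_exch[of i] by (simp add: \<epsilon>_def)
    from mu_quantum_monomial(2)[OF K' this]
    have mu: "mu_quantum \<Gamma> e c k K' \<iota>' K \<iota> (\<iota>' (X_monomial v)) =
        tM [^] (- int n) \<otimes> X v \<otimes> inv (ordered_product K (\<lambda>l. dilog_factor (- p * (2 * int l - 1)) z) n)" .
    let ?F = "ordered_product K (\<lambda>l. dilog_factor (- p * (2 * int l - 1)) z) n"
    let ?A = "tM [^] n \<otimes> qi (p * int n * int n) \<otimes> X (zmul (- int n) (e k))"
    have F: "?F \<in> carrier K" "?F \<noteq> \<zero>" using z_central
      by (simp, intro I.K.ordered_product_nonzero dilog_factor_closed dilog_factor_nonzero)
    have A: "?A \<in> carrier K" "?A \<noteq> \<zero>" using I.K.nat_pow_nonzero[of tM n] by simp_all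
    let ?w = "tM [^] (- int n) \<otimes> X v"
    have w: "?w \<in> carrier K" by simp
    have "?w \<otimes> ?A = X (e i)"
    proof -
      define u where "u = tM [^] n"
      have u: "central_coeff u" "u \<in> carrier K" "u \<noteq> \<zero>"
        using central_coeff_pow[OF tPM_central(2)] I.K.nat_pow_nonzero[of tM] by (simp_all add: u_def)
      define q where "q = qi (p * int n * int n)"
      have q: "central_coeff q" "q \<in> carrier K" by (simp_all add: q_def qi_central_coeff)
      let ?y = "X (zmul (- int n) (e k))"
      have "B v (zmul (- int n) (e k)) = - (p * int n * int n)"
        using B_ek[of v] \<open>wt v = int n\<close> B_zmul(2)[of v "- int n" "e k"] by simp
      moreover have "v + zmul (- int n) (e k) = e i" by (simp add: v_def)
      ultimately have Xy: "X v \<otimes> ?y = qi (- (p * int n * int n)) \<otimes> X (e i)"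
        using X_mult[of v "zmul (- int n) (e k)"] by (simp only: qi_def)
      have "?w \<otimes> ?A = inv u \<otimes> (X v \<otimes> (u \<otimes> q)) \<otimes> ?y"
        using u q by (simp add: u_def q_def I.K.int_pow_minus int_pow_int I.K.m_assoc)
      also have "X v \<otimes> (u \<otimes> q) = (u \<otimes> q) \<otimes> X v"
        using central_coeffD(3)[OF central_coeff_mult[OF u(1) q(1)], of "X v"] by simp
      also have "inv u \<otimes> (u \<otimes> q \<otimes> X v) \<otimes> ?y = q \<otimes> (X v \<otimes> ?y)"
        using u q by (simp add: I.K.m_assoc)
      also have "\<dots> = qi (p * int n * int n + - (p * int n * int n)) \<otimes> X (e i)"
        unfolding Xy qi_add q_def by (simp add: I.K.m_assoc)
      finally show ?thesis by simp
    qed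
    then have wA: "?w = X (e i) \<otimes> inv ?A" by (rule I.K.eq_divide[OF A w X_closed, THEN iffD2])
    have "?w \<otimes> inv ?F = X (e i) \<otimes> inv (?F \<otimes> ?A)"
      unfolding I.K.inv_mult[OF F A] wA by (rule I.K.m_assoc[OF X_closed I.K.inv_in[OF A] I.K.inv_in[OF F]])
    then have res: "mu_quantum \<Gamma> e c k K' \<iota>' K \<iota> (\<iota>' (X_monomial (seed_mutation \<Gamma> k e i))) =
        X (e i) \<otimes> inv (ordered_product K (\<lambda>l. tP \<oplus> tM \<otimes> qi (p * (2 * int l - 1)) \<otimes> inv x) n)"
      unfolding e' mu product_positive .
    have "sgn \<epsilon> = 1" "nat \<bar>\<epsilon>\<bar> = n" using n by simp_all
    moreover have "y [^] (- 1 :: int) = inv y" if "y \<in> carrier K" for y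
      using that int_pow_def2[of K y "-1"] by simp
    ultimately show ?thesis
      using res False unfolding \<epsilon>_def[symmetric] by (simp add: tP_def tM_def)
  qed
qed

end

section \<open>Specialisation\<close>

lemma ordered_product_hom:
  assumes "monoid R" "h \<in> ring_hom R S" "\<And>l. f l \<in> carrier R"
  shows "h (ordered_product R f n) = ordered_product S (\<lambda>l. h (f l)) n"
proof -
  interpret monoid R by fact
  have "foldr (\<otimes>\<^bsub>R\<^esub>) (map f ls) \<one>\<^bsub>R\<^esub> \<in> carrier R \<and>
      h (foldr (\<otimes>\<^bsub>R\<^esub>) (map f ls) \<one>\<^bsub>R\<^esub>) = foldr (\<otimes>\<^bsub>S\<^esub>) (map (\<lambda>l. h (f l)) ls) \<one>\<^bsub>S\<^esub>" for ls
    by (induction ls) (auto simp: ring_hom_one[OF assms(2)] ring_hom_mult[OF assms(2)] assms(3))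
  then show ?thesis by (simp add: ordered_product_def)
qed

lemma lookup_map_zero: "\<theta> 0 = 0 \<Longrightarrow> Poly_Mapping.lookup (Poly_Mapping.map \<theta> f) v = \<theta> (Poly_Mapping.lookup f v)"
  by (simp add: Poly_Mapping.map.rep_eq when_def)

text \<open>Substitutions for \<open>t\<close> and \<open>q\<close> are homomorphisms of the coefficient rings, applied to each
  coefficient of a torus element.\<close>

locale coefficient_hom =
  fixes \<theta> :: "'c::comm_ring_1 \<Rightarrow> 'd::comm_ring_1"
  assumes \<theta>_add: "\<theta> (a + b) = \<theta> a + \<theta> b" and \<theta>_mult: "\<theta> (a * b) = \<theta> a * \<theta> b" and \<theta>_1: "\<theta> 1 = 1"
begin

lemma \<theta>_0 [simp]: "\<theta> 0 = 0"
  using \<theta>_add[of 0 0] by simp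

lemma map_add: "Poly_Mapping.map \<theta> (f + g) = Poly_Mapping.map \<theta> f + Poly_Mapping.map \<theta> g"
  by (rule poly_mapping_eqI) (simp add: lookup_map_zero lookup_add \<theta>_add)

lemma map_single: "Poly_Mapping.map \<theta> (Poly_Mapping.single v r) = Poly_Mapping.single v (\<theta> r)"
  by (rule poly_mapping_eqI) (simp add: lookup_map_zero lookup_single when_def)

lemma map_torus_hom:
  assumes "torus \<Gamma> Q" "torus \<Gamma> Q'" "\<And>m. \<theta> (Q m) = Q' m"
  shows "Poly_Mapping.map \<theta> \<in> ring_hom (quantum_torus \<Gamma> Q) (quantum_torus \<Gamma> Q')"
proof -
  interpret S: torus \<Gamma> Q "\<lambda>v w. q_exponent \<Gamma> (form \<Gamma> v w)" "quantum_torus \<Gamma> Q" by fact (rule reflexive)+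
  interpret S': torus \<Gamma> Q' "\<lambda>v w. q_exponent \<Gamma> (form \<Gamma> v w)" "quantum_torus \<Gamma> Q'" by fact (rule reflexive)+
  have "Poly_Mapping.map \<theta> (f \<otimes>\<^bsub>quantum_torus \<Gamma> Q\<^esub> g) = Poly_Mapping.map \<theta> f \<otimes>\<^bsub>quantum_torus \<Gamma> Q'\<^esub> Poly_Mapping.map \<theta> g" for f g
  proof (induction f rule: poly_mapping_additive_induct)
    case (single v r)
    show ?case
      by (induction g rule: poly_mapping_additive_induct)
        (simp_all add: S.mult_add_right S'.mult_add_right map_add map_single \<theta>_mult assms(3))
  qed (simp add: S.mult_add_left S'.mult_add_left map_add)
  then show ?thesis
    using map_single[of 0 1] by (intro ring_hom_memI) (simp_all add: map_add \<theta>_1)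
qed

end

lemma eval_at_one_sum: "finite F \<Longrightarrow> Poly_Mapping.keys f \<subseteq> F \<Longrightarrow> eval_at_one f = (\<Sum>m\<in>F. Poly_Mapping.lookup f m)"
  unfolding eval_at_one_def by (intro sum.mono_neutral_left) (auto simp: in_keys_iff)

lemma eval_at_one_single: "eval_at_one (Poly_Mapping.single m r) = r"
  by (subst eval_at_one_sum[of "{m}"]) auto

lemma eval_at_one_add: "eval_at_one (f + g) = eval_at_one f + eval_at_one g"
proof -
  let ?F = "Poly_Mapping.keys f \<union> Poly_Mapping.keys g"
  show ?thesis using keys_add[of f g]
    by (simp add: eval_at_one_sum[of ?F] lookup_add sum.distrib)
qed

lemma eval_at_one_hom: "coefficient_hom (eval_at_one :: ('m::comm_monoid_add \<Rightarrow>\<^sub>0 'c::comm_ring_1) \<Rightarrow> 'c)"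
proof
  fix f g :: "'m \<Rightarrow>\<^sub>0 'c"
  show "eval_at_one (f * g) = eval_at_one f * eval_at_one g"
  proof (induction f rule: poly_mapping_additive_induct)
    case (single v r)
    show ?case
      by (induction g rule: poly_mapping_additive_induct)
        (simp_all add: mult_single eval_at_one_single eval_at_one_add distrib_left)
  qed (simp add: eval_at_one_add distrib_right)
  show "eval_at_one (1 :: 'm \<Rightarrow>\<^sub>0 'c) = 1" using eval_at_one_single[of 0 "1::'c"] by simp
qed (rule eval_at_one_add)

lemma (in coefficient_hom) map_hom: "coefficient_hom (Poly_Mapping.map \<theta> :: ('m::comm_monoid_add \<Rightarrow>\<^sub>0 'c) \<Rightarrow> ('m \<Rightarrow>\<^sub>0 'd))"
proof
  fix f g :: "'m \<Rightarrow>\<^sub>0 'c"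
  show "Poly_Mapping.map \<theta> (f * g) = Poly_Mapping.map \<theta> f * Poly_Mapping.map \<theta> g"
  proof (induction f rule: poly_mapping_additive_induct)
    case (single v r)
    show ?case
      by (induction g rule: poly_mapping_additive_induct)
        (simp_all add: mult_single map_single map_add \<theta>_mult distrib_left)
  qed (simp add: map_add distrib_right)
  show "Poly_Mapping.map \<theta> 1 = 1" using map_single[of 0 1] by (simp add: \<theta>_1)
qed (rule map_add)

text \<open>Every value of the mutation is a fraction of torus elements whose denominator is \<open>1\<close> or a product
  of binomials, and a specialisation acts on these elements coefficientwise.\<close>

lemma specialise_mutation:
  fixes Q :: "int \<Rightarrow> 'c::comm_ring_1" and Q' :: "int \<Rightarrow> 'd::comm_ring_1"
    and K :: "'a ring" and F :: "'f ring" and sg :: int and b :: "nat \<Rightarrow> 'c"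
  assumes K: "torus_field \<Gamma> Q K \<iota>" and F: "torus_field \<Gamma> Q' F \<phi>"
    and \<theta>: "coefficient_hom \<theta>" "\<And>m. \<theta> (Q m) = Q' m"
    and sg: "sg = -1 \<or> sg = 0 \<or> sg = 1" and v: "sg = 1 \<Longrightarrow> v \<noteq> 0" "sg = 1 \<Longrightarrow> \<theta> a \<noteq> 0"
  shows "specialises_to (Poly_Mapping.map \<theta>) K \<iota> F \<phi>
     (\<iota> (X_monomial u) \<otimes>\<^bsub>K\<^esub> ordered_product K
        (\<lambda>l. \<iota> (scalar a) \<oplus>\<^bsub>K\<^esub> \<iota> (scalar a') \<otimes>\<^bsub>K\<^esub> \<iota> (scalar (b l)) \<otimes>\<^bsub>K\<^esub> \<iota> (X_monomial v)) n [^]\<^bsub>K\<^esub> (- sg))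
     (\<phi> (X_monomial u) \<otimes>\<^bsub>F\<^esub> ordered_product F
        (\<lambda>l. \<phi> (scalar (\<theta> a)) \<oplus>\<^bsub>F\<^esub> \<phi> (scalar (\<theta> a')) \<otimes>\<^bsub>F\<^esub> \<phi> (scalar (\<theta> (b l))) \<otimes>\<^bsub>F\<^esub> \<phi> (X_monomial v)) n [^]\<^bsub>F\<^esub> (- sg))"
proof -
  interpret K: torus_field \<Gamma> Q "\<lambda>v w. q_exponent \<Gamma> (form \<Gamma> v w)" "quantum_torus \<Gamma> Q" K \<iota> by (fact K) (rule reflexive)+
  interpret F: torus_field \<Gamma> Q' "\<lambda>v w. q_exponent \<Gamma> (form \<Gamma> v w)" "quantum_torus \<Gamma> Q'" F \<phi> by (fact F) (rule reflexive)+
  interpret \<theta>: coefficient_hom \<theta> by fact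
  let ?T = "quantum_torus \<Gamma> Q" and ?T' = "quantum_torus \<Gamma> Q'" and ?\<sigma> = "Poly_Mapping.map \<theta>"
  have \<sigma>: "?\<sigma> \<in> ring_hom ?T ?T'" by (rule \<theta>.map_torus_hom) (unfold_locales, rule \<theta>(2))
  define G where "G l = scalar a + Poly_Mapping.single v (a' * b l)" for l
  define g where "g l = \<iota> (scalar a) \<oplus>\<^bsub>K\<^esub> \<iota> (scalar a') \<otimes>\<^bsub>K\<^esub> \<iota> (scalar (b l)) \<otimes>\<^bsub>K\<^esub> \<iota> (X_monomial v)" for l
  define g' where "g' l = \<phi> (scalar (\<theta> a)) \<oplus>\<^bsub>F\<^esub> \<phi> (scalar (\<theta> a')) \<otimes>\<^bsub>F\<^esub> \<phi> (scalar (\<theta> (b l))) \<otimes>\<^bsub>F\<^esub> \<phi> (X_monomial v)" for l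
  have G: "\<iota> (G l) = g l" for l
    unfolding G_def g_def K.iota_add K.iota_single K.s_hom unfolding K.s_def K.X_def ..
  have \<sigma>G: "?\<sigma> (G l) = scalar (\<theta> a) + Poly_Mapping.single v (\<theta> a' * \<theta> (b l))" for l
    by (simp add: G_def \<theta>.map_add \<theta>.map_single scalar_def \<theta>.\<theta>_mult)
  have G': "\<phi> (?\<sigma> (G l)) = g' l" for l
    unfolding \<sigma>G g'_def F.iota_add F.iota_single F.s_hom unfolding F.s_def F.X_def ..
  define P where "P = ordered_product ?T G n"
  have P: "\<iota> P = ordered_product K g n"
    unfolding P_def using ordered_product_hom[OF K.T.monoid_axioms K.I.hom, of G n] by (simp add: G)
  have P': "\<phi> (?\<sigma> P) = ordered_product F g' n"
    unfolding P_def using ordered_product_hom[OF K.T.monoid_axioms \<sigma>, of G n]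
      ordered_product_hom[OF F.T.monoid_axioms F.I.hom, of "\<lambda>l. ?\<sigma> (G l)" n] by (simp add: G')
  have \<sigma>X: "?\<sigma> (X_monomial w) = X_monomial w" for w
    by (simp add: X_monomial_def \<theta>.map_single \<theta>.\<theta>_1)
  have \<sigma>1: "?\<sigma> 1 = 1" using \<sigma>X[of 0] by (simp add: X_monomial_def)
  have g_closed: "g l \<in> carrier K" "g' l \<in> carrier F" for l
    unfolding G[symmetric] G'[symmetric] by simp_all
  have P_closed: "ordered_product K g n \<in> carrier K" "ordered_product F g' n \<in> carrier F"
    using g_closed by simp_all
  show ?thesis
    unfolding g_def[symmetric] g'_def[symmetric] specialises_to_def
  proof (cases "sg = 1")
    case True
    have "?\<sigma> (G l) \<noteq> 0" for l
    proof -
      have "Poly_Mapping.lookup (?\<sigma> (G l)) 0 = \<theta> a"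
        using v(1)[OF True] unfolding \<sigma>G by (simp add: lookup_add scalar_def lookup_single_not_eq)
      then show ?thesis using v(2)[OF True] by auto
    qed
    then have "g' l \<noteq> \<zero>\<^bsub>F\<^esub>" for l unfolding G'[symmetric] by simp
    then have "ordered_product F g' n \<noteq> \<zero>\<^bsub>F\<^esub>"
      using g_closed by (intro F.I.K.ordered_product_nonzero) auto
    then have "?\<sigma> P \<noteq> 0" unfolding P'[symmetric] by simp
    moreover have "y [^]\<^bsub>K\<^esub> (- 1 :: int) = inv\<^bsub>K\<^esub> y" if "y \<in> carrier K" for y
      using that int_pow_def2[of K y "-1"] by simp
    moreover have "y [^]\<^bsub>F\<^esub> (- 1 :: int) = inv\<^bsub>F\<^esub> y" if "y \<in> carrier F" for y
      using that int_pow_def2[of F y "-1"] by simp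
    ultimately show "\<exists>a b. ?\<sigma> b \<noteq> 0 \<and>
      \<iota> (X_monomial u) \<otimes>\<^bsub>K\<^esub> ordered_product K g n [^]\<^bsub>K\<^esub> (- sg) = \<iota> a \<otimes>\<^bsub>K\<^esub> inv\<^bsub>K\<^esub> (\<iota> b) \<and>
      \<phi> (X_monomial u) \<otimes>\<^bsub>F\<^esub> ordered_product F g' n [^]\<^bsub>F\<^esub> (- sg) = \<phi> (?\<sigma> a) \<otimes>\<^bsub>F\<^esub> inv\<^bsub>F\<^esub> (\<phi> (?\<sigma> b))"
      using P_closed True by - (rule exI[of _ "X_monomial u"], rule exI[of _ P], simp add: P P' \<sigma>X)
  next
    case False
    define m where "m = nat (- sg)"
    have m: "- sg = int m" "m = 0 \<or> m = 1" using sg False by (auto simp: m_def)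
    let ?a = "X_monomial u \<otimes>\<^bsub>?T\<^esub> (if m = 0 then 1 else P)"
    have a: "\<iota> ?a = \<iota> (X_monomial u) \<otimes>\<^bsub>K\<^esub> ordered_product K g n [^]\<^bsub>K\<^esub> (- sg)"
      unfolding K.iota_mult m(1) using m(2) P_closed by (auto simp: P int_pow_int)
    have a': "\<phi> (?\<sigma> ?a) = \<phi> (X_monomial u) \<otimes>\<^bsub>F\<^esub> ordered_product F g' n [^]\<^bsub>F\<^esub> (- sg)"
    proof -
      have "?\<sigma> ?a = X_monomial u \<otimes>\<^bsub>?T'\<^esub> (if m = 0 then 1 else ?\<sigma> P)"
        using ring_hom_mult[OF \<sigma>, of "X_monomial u"] by (simp add: \<sigma>X \<sigma>1)
      then show ?thesis
        unfolding m(1) using m(2) P_closed by (auto simp: F.iota_mult P' int_pow_int)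
    qed
    show "\<exists>a b. ?\<sigma> b \<noteq> 0 \<and>
      \<iota> (X_monomial u) \<otimes>\<^bsub>K\<^esub> ordered_product K g n [^]\<^bsub>K\<^esub> (- sg) = \<iota> a \<otimes>\<^bsub>K\<^esub> inv\<^bsub>K\<^esub> (\<iota> b) \<and>
      \<phi> (X_monomial u) \<otimes>\<^bsub>F\<^esub> ordered_product F g' n [^]\<^bsub>F\<^esub> (- sg) = \<phi> (?\<sigma> a) \<otimes>\<^bsub>F\<^esub> inv\<^bsub>F\<^esub> (\<phi> (?\<sigma> b))"
      unfolding a[symmetric] a'[symmetric] by (rule exI[of _ ?a], rule exI[of _ 1], simp add: \<sigma>1)
  qed
qed

theorem proposition1p1:
  fixes \<Gamma> :: "('i::finite, 'n::ab_group_add) fixed_data"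
    and e0 e e' :: "'i \<Rightarrow> 'n" and c :: "'i \<Rightarrow> 'i \<Rightarrow> int" and k :: 'i
    and K :: "'a ring" and \<iota> :: "('n \<Rightarrow>\<^sub>0 'i tpoly qlaurent) \<Rightarrow> 'a"
    and K' :: "'b ring" and \<iota>' :: "('n \<Rightarrow>\<^sub>0 'i tpoly qlaurent) \<Rightarrow> 'b"
    and F :: "'f ring" and \<phi> :: "('n \<Rightarrow>\<^sub>0 complex qlaurent) \<Rightarrow> 'f"
    and C :: "'g ring" and \<kappa> :: "('n \<Rightarrow>\<^sub>0 'i tpoly) \<Rightarrow> 'g"
  assumes "is_fixed_data \<Gamma>" and "is_seed \<Gamma> e0"
    and "seed_reachable \<Gamma> e0 e c" and "k \<in> uf \<Gamma>" and "e' = seed_mutation \<Gamma> k e"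
    and "is_cluster_field \<Gamma> q_monomial e K \<iota>"
    and "is_cluster_field \<Gamma> q_monomial e' K' \<iota>'"
    and "is_cluster_field \<Gamma> q_monomial e F \<phi>"
    and "is_cluster_field \<Gamma> (\<lambda>_. 1) e C \<kappa>"
  shows
    "(\<forall>i. mu_quantum \<Gamma> e (c k) k K' \<iota>' K \<iota> (\<iota>' (X_monomial (e' i))) =
       (if i = k then inv\<^bsub>K\<^esub> (\<iota> (X_monomial (e k)))
        else let \<epsilon> = exch \<Gamma> e i k;
                 t = t_in K (R_in_quantum \<iota>);
                 tplus = t (plus_part (\<lambda>j. sgn \<epsilon> * c k j));
                 tminus = t (plus_part (\<lambda>j. - sgn \<epsilon> * c k j))
             in \<iota> (X_monomial (e i)) \<otimes>\<^bsub>K\<^esub>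
                ordered_product K
                  (\<lambda>l. tplus \<oplus>\<^bsub>K\<^esub> tminus \<otimes>\<^bsub>K\<^esub> q_in \<Gamma> \<iota> (of_int (2 * int l - 1) / of_nat (mlt \<Gamma> k))
                           \<otimes>\<^bsub>K\<^esub> \<iota> (X_monomial (e k)) [^]\<^bsub>K\<^esub> (- sgn \<epsilon>))
                  (nat \<bar>\<epsilon>\<bar>) [^]\<^bsub>K\<^esub> (- sgn \<epsilon>))) \<and>
     \<comment> \<open>setting all \<open>t\<^sub>i = 1\<close>: the Fock-Goncharov quantum mutation\<close>
     (\<forall>i. specialises_to set_t_one K \<iota> F \<phi>
       (mu_quantum \<Gamma> e (c k) k K' \<iota>' K \<iota> (\<iota>' (X_monomial (e' i))))
       (if i = k then inv\<^bsub>F\<^esub> (\<phi> (X_monomial (e k)))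
        else let \<epsilon> = exch \<Gamma> e i k
             in \<phi> (X_monomial (e i)) \<otimes>\<^bsub>F\<^esub>
                ordered_product F
                  (\<lambda>l. \<one>\<^bsub>F\<^esub> \<oplus>\<^bsub>F\<^esub> q_in \<Gamma> \<phi> (of_int (2 * int l - 1) / of_nat (mlt \<Gamma> k))
                           \<otimes>\<^bsub>F\<^esub> \<phi> (X_monomial (e k)) [^]\<^bsub>F\<^esub> (- sgn \<epsilon>))
                  (nat \<bar>\<epsilon>\<bar>) [^]\<^bsub>F\<^esub> (- sgn \<epsilon>))) \<and>
     \<comment> \<open>setting \<open>q = 1\<close>: the classical mutation with principal coefficients\<close>
     (\<forall>i. specialises_to set_q_one K \<iota> C \<kappa>
       (mu_quantum \<Gamma> e (c k) k K' \<iota>' K \<iota> (\<iota>' (X_monomial (e' i))))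
       (if i = k then inv\<^bsub>C\<^esub> (\<kappa> (X_monomial (e k)))
        else let \<epsilon> = exch \<Gamma> e i k;
                 t = t_in C (R_in_classical \<kappa>)
             in \<kappa> (X_monomial (e i)) \<otimes>\<^bsub>C\<^esub>
                (t (plus_part (\<lambda>j. sgn \<epsilon> * c k j)) \<oplus>\<^bsub>C\<^esub>
                 t (plus_part (\<lambda>j. - sgn \<epsilon> * c k j)) \<otimes>\<^bsub>C\<^esub> \<kappa> (X_monomial (e k)) [^]\<^bsub>C\<^esub> (- sgn \<epsilon>))
                  [^]\<^bsub>C\<^esub> (- \<epsilon>)))"
proof -
  note ib = reachable_integral_basis[OF assms(1,3,2)]
  have ib': "integral_basis \<Gamma> e'" unfolding assms(5) by (rule integral_basis_mutation[OF assms(1) ib])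
  note basis = ib[unfolded integral_basis_def, THEN conjunct1]
  note basis' = ib'[unfolded integral_basis_def, THEN conjunct1]
  have torus: "torus \<Gamma> (q_monomial :: int \<Rightarrow> 'i tpoly qlaurent)" "torus \<Gamma> (q_monomial :: int \<Rightarrow> complex qlaurent)"
    "torus \<Gamma> (\<lambda>_. 1 :: 'i tpoly)"
    by (rule torusI[OF assms(1) ib]; simp add: q_monomial_def mult_single)+
  obtain deg :: "'n \<Rightarrow> int" where deg: "\<forall>v w. deg (v + w) = deg v + deg w" "deg (e k) = 1"
    "\<forall>v. deg v = 0 \<longleftrightarrow> v \<in> lattice_span e (- {k})"
    using basis_degree[OF basis, of k] by (elim exE conjE)
  have K: "torus_field \<Gamma> q_monomial K \<iota>" and F: "torus_field \<Gamma> q_monomial F \<phi>" and C: "torus_field \<Gamma> (\<lambda>_. 1) C \<kappa>"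
    by (rule torus_field.intro[OF torus(1) torus.cluster_fraction_field[OF torus(1) basis assms(6)]]
      torus_field.intro[OF torus(2) torus.cluster_fraction_field[OF torus(2) basis assms(8)]]
      torus_field.intro[OF torus(3) torus.cluster_fraction_field[OF torus(3) basis assms(9)]])+
  have K': "fraction_field K' (quantum_torus \<Gamma> q_monomial) \<iota>'"
    by (rule torus.cluster_fraction_field[OF torus(1) basis' assms(7)])
  interpret F: torus_field \<Gamma> q_monomial "\<lambda>v w. q_exponent \<Gamma> (form \<Gamma> v w)" "quantum_torus \<Gamma> q_monomial" F \<phi>
    by (fact F) (rule reflexive)+
  interpret C: torus_field \<Gamma> "\<lambda>_. 1" "\<lambda>v w. q_exponent \<Gamma> (form \<Gamma> v w)" "quantum_torus \<Gamma> (\<lambda>_. 1)" C \<kappa>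
    by (fact C) (rule reflexive)+
  interpret M: quantum_mutation \<Gamma> "\<lambda>v w. q_exponent \<Gamma> (form \<Gamma> v w)" "quantum_torus \<Gamma> q_monomial" K \<iota> e k deg "c k"
    by (intro quantum_mutation.intro graded_torus_field.intro graded_torus_field_axioms.intro
      quantum_mutation_axioms.intro K deg(1,3)[rule_format] deg(2) ib assms(1)) (rule reflexive)+
  have ek: "e k \<noteq> 0" using deg(1)[rule_format, of 0 0] deg(2) by auto

  let ?\<mu> = "\<lambda>i. mu_quantum \<Gamma> e (c k) k K' \<iota>' K \<iota> (\<iota>' (X_monomial (e' i)))"
  let ?sg = "\<lambda>i. sgn (exch \<Gamma> e i k)"
  let ?n = "\<lambda>i. nat \<bar>exch \<Gamma> e i k\<bar>"
  let ?p = "\<lambda>i j. ?sg i * c k j" and ?m = "\<lambda>i j. - ?sg i * c k j"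
  let ?a = "\<lambda>y. Poly_Mapping.single 0 (t_monomial (plus_part y)) :: 'i tpoly qlaurent"
  let ?b = "\<lambda>l. q_monomial (M.p * (2 * int l - 1)) :: 'i tpoly qlaurent"
  note mu = M.mu_quantum_cluster_variable[OF K', folded assms(5)]
  have formula: "?\<mu> i = (if i = k then inv\<^bsub>K\<^esub> (\<iota> (X_monomial (e k)))
        else let \<epsilon> = exch \<Gamma> e i k;
                 t = t_in K (R_in_quantum \<iota>);
                 tplus = t (plus_part (\<lambda>j. sgn \<epsilon> * c k j));
                 tminus = t (plus_part (\<lambda>j. - sgn \<epsilon> * c k j))
             in \<iota> (X_monomial (e i)) \<otimes>\<^bsub>K\<^esub>
                ordered_product K
                  (\<lambda>l. tplus \<oplus>\<^bsub>K\<^esub> tminus \<otimes>\<^bsub>K\<^esub> q_in \<Gamma> \<iota> (of_int (2 * int l - 1) / of_nat (mlt \<Gamma> k))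
                           \<otimes>\<^bsub>K\<^esub> \<iota> (X_monomial (e k)) [^]\<^bsub>K\<^esub> (- sgn \<epsilon>))
                  (nat \<bar>\<epsilon>\<bar>) [^]\<^bsub>K\<^esub> (- sgn \<epsilon>))" for i
    unfolding mu Let_def M.t_in_plus_part M.q_in_multiple M.x_def M.X_def ..
  have sgn: "?sg i = -1 \<or> ?sg i = 0 \<or> ?sg i = 1" for i by (auto simp: sgn_if)
  \<comment> \<open>For the specialisations every constituent is written as the image of a torus element, and the
     case \<open>i = k\<close> as an empty product.\<close>
  have torus_value: "?\<mu> i = (if i = k then \<iota> (X_monomial (- e k)) \<otimes>\<^bsub>K\<^esub> ordered_product K
        (\<lambda>l. \<iota> (scalar 1) \<oplus>\<^bsub>K\<^esub> \<iota> (scalar 1) \<otimes>\<^bsub>K\<^esub> \<iota> (scalar 1) \<otimes>\<^bsub>K\<^esub> \<iota> (X_monomial 0)) 0 [^]\<^bsub>K\<^esub> (- 0 :: int)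
      else \<iota> (X_monomial (e i)) \<otimes>\<^bsub>K\<^esub> ordered_product K
        (\<lambda>l. \<iota> (scalar (?a (?p i))) \<oplus>\<^bsub>K\<^esub> \<iota> (scalar (?a (?m i))) \<otimes>\<^bsub>K\<^esub> \<iota> (scalar (?b l)) \<otimes>\<^bsub>K\<^esub> \<iota> (X_monomial (zmul (- ?sg i) (e k))))
        (?n i) [^]\<^bsub>K\<^esub> (- ?sg i))" for i
  proof (cases "i = k")
    case True
    then show ?thesis unfolding mu by (simp add: M.x_def M.X_inverse) (simp add: M.X_def)
  next
    case False
    then show ?thesis
      unfolding mu M.x_pow M.coeff_def M.qi_def M.s_def M.X_def by simp
  qed
  have v: "zmul (- ?sg i) (e k) \<noteq> 0" if "?sg i = 1" for i using that ek by simp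

  let ?\<theta>t = "Poly_Mapping.map eval_at_one :: 'i tpoly qlaurent \<Rightarrow> complex qlaurent"
  have \<theta>t: "coefficient_hom ?\<theta>t" by (rule coefficient_hom.map_hom[OF eval_at_one_hom])
  have \<theta>t_q: "?\<theta>t (q_monomial m) = q_monomial m" for m
    unfolding q_monomial_def coefficient_hom.map_single[OF eval_at_one_hom]
      coefficient_hom.\<theta>_1[OF eval_at_one_hom] ..
  have \<theta>t_a: "?\<theta>t (?a y) = 1" for y
  proof -
    obtain m where "t_monomial (plus_part y) = (Poly_Mapping.single m 1 :: 'i tpoly)" using t_monomial_single by blast
    then have "?\<theta>t (?a y) = Poly_Mapping.single 0 1"
      by (simp only: coefficient_hom.map_single[OF eval_at_one_hom] eval_at_one_single)
    then show ?thesis by simp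
  qed
  have set_t: "set_t_one = Poly_Mapping.map ?\<theta>t" by (rule set_t_one_def)
  note spec_t = specialise_mutation[OF K F \<theta>t \<theta>t_q]
  have t_one: "specialises_to set_t_one K \<iota> F \<phi> (?\<mu> i)
       (if i = k then inv\<^bsub>F\<^esub> (\<phi> (X_monomial (e k)))
        else let \<epsilon> = exch \<Gamma> e i k
             in \<phi> (X_monomial (e i)) \<otimes>\<^bsub>F\<^esub>
                ordered_product F
                  (\<lambda>l. \<one>\<^bsub>F\<^esub> \<oplus>\<^bsub>F\<^esub> q_in \<Gamma> \<phi> (of_int (2 * int l - 1) / of_nat (mlt \<Gamma> k))
                           \<otimes>\<^bsub>F\<^esub> \<phi> (X_monomial (e k)) [^]\<^bsub>F\<^esub> (- sgn \<epsilon>))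
                  (nat \<bar>\<epsilon>\<bar>) [^]\<^bsub>F\<^esub> (- sgn \<epsilon>))" for i
  proof (cases "i = k")
    case True
    have "inv\<^bsub>F\<^esub> (\<phi> (X_monomial (e k))) = \<phi> (X_monomial (- e k))"
      using F.X_inverse unfolding F.X_def .
    then show ?thesis
      using spec_t[of 0 0 1 "- e k" 1 "\<lambda>_. 1" 0] True unfolding torus_value set_t by simp
  next
    case False
    have X: "\<phi> (X_monomial (zmul m (e k))) = \<phi> (X_monomial (e k)) [^]\<^bsub>F\<^esub> m" for m
      using F.X_pow_int unfolding F.X_def by simp
    have one: "\<phi> (scalar 1) = \<one>\<^bsub>F\<^esub>" using F.s_hom(1) unfolding F.s_def .
    have qF: "q_in \<Gamma> \<phi> (of_int m / of_nat (mlt \<Gamma> k)) = \<phi> (scalar (q_monomial (M.p * m)))" for m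
      by (simp only: q_in_def M.q_exponent_multiple)
    have "specialises_to set_t_one K \<iota> F \<phi> (?\<mu> i)
      (\<phi> (X_monomial (e i)) \<otimes>\<^bsub>F\<^esub> ordered_product F
        (\<lambda>l. \<phi> (scalar (?\<theta>t (?a (?p i)))) \<oplus>\<^bsub>F\<^esub> \<phi> (scalar (?\<theta>t (?a (?m i)))) \<otimes>\<^bsub>F\<^esub> \<phi> (scalar (?\<theta>t (?b l)))
           \<otimes>\<^bsub>F\<^esub> \<phi> (X_monomial (zmul (- ?sg i) (e k)))) (?n i) [^]\<^bsub>F\<^esub> (- ?sg i))"
      unfolding torus_value set_t if_not_P[OF False] by (rule spec_t[OF sgn v]) (simp_all only: \<theta>t_a zero_neq_one[symmetric] not_False_eq_True)
    moreover have "\<one>\<^bsub>F\<^esub> \<otimes>\<^bsub>F\<^esub> \<phi> f = \<phi> f" for f by simp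
    ultimately show ?thesis
      unfolding \<theta>t_a \<theta>t_q one X if_not_P[OF False] Let_def qF by (simp only:)
  qed

  let ?\<theta>q = "eval_at_one :: 'i tpoly qlaurent \<Rightarrow> 'i tpoly"
  have \<theta>q_q: "?\<theta>q (q_monomial m) = 1" for m
    unfolding q_monomial_def by (rule eval_at_one_single)
  have \<theta>q_a: "?\<theta>q (?a y) = t_monomial (plus_part y)" for y
    by (rule eval_at_one_single)
  have set_q: "set_q_one = Poly_Mapping.map ?\<theta>q" by (rule set_q_one_def)
  note spec_q = specialise_mutation[OF K C eval_at_one_hom \<theta>q_q]
  have q_one: "specialises_to set_q_one K \<iota> C \<kappa> (?\<mu> i)
       (if i = k then inv\<^bsub>C\<^esub> (\<kappa> (X_monomial (e k)))
        else let \<epsilon> = exch \<Gamma> e i k;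
                 t = t_in C (R_in_classical \<kappa>)
             in \<kappa> (X_monomial (e i)) \<otimes>\<^bsub>C\<^esub>
                (t (plus_part (\<lambda>j. sgn \<epsilon> * c k j)) \<oplus>\<^bsub>C\<^esub>
                 t (plus_part (\<lambda>j. - sgn \<epsilon> * c k j)) \<otimes>\<^bsub>C\<^esub> \<kappa> (X_monomial (e k)) [^]\<^bsub>C\<^esub> (- sgn \<epsilon>))
                  [^]\<^bsub>C\<^esub> (- \<epsilon>))" for i
  proof (cases "i = k")
    case True
    have "inv\<^bsub>C\<^esub> (\<kappa> (X_monomial (e k))) = \<kappa> (X_monomial (- e k))"
      using C.X_inverse unfolding C.X_def .
    then show ?thesis
      using spec_q[of 0 0 1 "- e k" 1 "\<lambda>_. 1" 0] True unfolding torus_value set_q by simp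
  next
    case False
    have X: "\<kappa> (X_monomial (zmul m (e k))) = \<kappa> (X_monomial (e k)) [^]\<^bsub>C\<^esub> m" for m
      using C.X_pow_int unfolding C.X_def by simp
    have one: "\<kappa> (scalar 1) = \<one>\<^bsub>C\<^esub>" using C.s_hom(1) unfolding C.s_def .
    have t: "t_in C (R_in_classical \<kappa>) (plus_part y) = \<kappa> (scalar (t_monomial (plus_part y)))" for y
    proof -
      have *: "t_monomial (\<lambda>i. - plus_part y i) = 1"
        using plus_part_nonneg[of y] by (intro t_monomial_nonpos) simp
      show ?thesis
        unfolding t_in_def R_in_classical_def * one C.I.K.inv_one by (rule C.I.K.r_one) simp
    qed
    let ?g = "\<kappa> (scalar (t_monomial (plus_part (?p i)))) \<oplus>\<^bsub>C\<^esub> \<kappa> (scalar (t_monomial (plus_part (?m i)))) \<otimes>\<^bsub>C\<^esub>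
       \<kappa> (X_monomial (zmul (- ?sg i) (e k)))"
    have "specialises_to set_q_one K \<iota> C \<kappa> (?\<mu> i)
      (\<kappa> (X_monomial (e i)) \<otimes>\<^bsub>C\<^esub> ordered_product C
        (\<lambda>l. \<kappa> (scalar (?\<theta>q (?a (?p i)))) \<oplus>\<^bsub>C\<^esub> \<kappa> (scalar (?\<theta>q (?a (?m i)))) \<otimes>\<^bsub>C\<^esub> \<kappa> (scalar (?\<theta>q (?b l)))
           \<otimes>\<^bsub>C\<^esub> \<kappa> (X_monomial (zmul (- ?sg i) (e k)))) (?n i) [^]\<^bsub>C\<^esub> (- ?sg i))"
      unfolding torus_value set_q if_not_P[OF False] by (rule spec_q[OF sgn v]) (simp_all only: \<theta>q_a t_monomial_nonzero not_False_eq_True)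
    moreover have "\<kappa> f \<otimes>\<^bsub>C\<^esub> \<one>\<^bsub>C\<^esub> = \<kappa> f" for f by simp
    moreover have "ordered_product C (\<lambda>_. ?g) (?n i) [^]\<^bsub>C\<^esub> (- ?sg i) = ?g [^]\<^bsub>C\<^esub> (- exch \<Gamma> e i k)"
    proof -
      have g: "?g \<in> carrier C" by simp
      show ?thesis
        unfolding C.I.K.ordered_product_const[OF g]
        by (cases "exch \<Gamma> e i k" rule: int_cases3) (simp_all add: int_pow_def2 del: pow_nat)
    qed
    ultimately show ?thesis
      unfolding \<theta>q_a \<theta>q_q one if_not_P[OF False] Let_def t X by (simp only:)
  qed
  show ?thesis using formula t_one q_one by blast
qed

end
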